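(* Let $d\in\mathbb N$ and, for each $n\in\mathbb N$, let $C^n:\mathbb Z^d_n\times\mathbb Z^d_n\to[0,\infty)$, where $\mathbb Z_n^d=\frac1n\mathbb Z^d$. Assume: (T1) $C^n(a,a)=0$ for all $n\in\mathbb N$, $a\in\mathbb Z_n^d$; (T2) $\sup_{a\in\mathbb Z_n^d}\sum_{b\in\mathbb Z_n^d}C^n(a,b)<\infty$ for all $n\in\mathbb N$; (T3) for all $\rho>0$: $\limsup_{n\to\infty}\sup_{a\in\mathbb Z_n^d}\sum_{b\in\mathbb Z_n^d,\,|b|>\rho}C^n(a,a+b)<\infty$; (T4) $\lim_{r\to\infty}\limsup_{n\to\infty}\sup_{a\in\mathbb Z_n^d}\sum_{b\in\mathbb Z_n^d,\,|b|>r}C^n(a,a+b)=0$; (T5) there is $\rho>0$ such that for all $i=1,\dots,d$: $\limsup_{n\to\infty}\sup_{a\in\mathbb Z_n^d}\big|\sum_{b\in\mathbb Z_n^d,\,|b|<\rho}b_i\,C^n(a,a+b)\big|<\infty$; (T6) there is $\rho>0$ such that for all $i,k=1,\dots,d$: $\limsup_{n\to\infty}\sup_{a\in\mathbb Z_n^d}\big|\sum_{b\in\mathbb Z_n^d,\,|b|<\rho}b_ib_k\,C^n(a,a+b)\big|<\infty$. For each $n$ let $\{X^n_t\}_{t\ge0}$, with law $\mathbb P^n$, be the continuous-time Markov chain on $\mathbb Z_n^d$ with jump rates $C^n$. If the family of initial distributions $\mathbb P^n(X^n_0\in\bullet)$, $n\in\mathbb N$, is tight, then the family of processes $\{X_t^n\}_{t\ge0}$,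 $n\in\mathbb N$, is tight.
   Context: Under (T1) and (T2) the chain $\{X^n_t\}_{t\ge0}$ with infinitesimal generator $\mathcal A^nf(a)=\sum_{b\in\mathbb Z_n^d}(f(b)-f(a))C^n(a,b)$ exists, is conservative and regular (finitely many jumps in finite time intervals): from state $a$ it jumps to $b$ with probability $C^n(a,b)/\sum_cC^n(a,c)$ after an exponential waiting time with parameter $\sum_cC^n(a,c)$. The chains are viewed as random elements of the Skorokhod space $\mathbb D(\mathbb R^d)$ of càdlàg functions $[0,\infty)\to\mathbb R^d$ with Skorokhod's $J_1$ topology; tightness of the processes means tightness of their laws on this space. *)

theory Defs
  imports "HOL-Probability.Probability"
begin

subsection \<open>Skorokhod space\<close>

definition cadlag :: "(real \<Rightarrow> 'a::topological_space) \<Rightarrow> bool" where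
  "cadlag x \<longleftrightarrow> (\<forall>t\<ge>0. (x \<longlongrightarrow> x t) (at_right t)) \<and> (\<forall>t>0. \<exists>l. (x \<longlongrightarrow> l) (at_left t))"

text \<open>Only the values at times \<open>t \<ge> 0\<close> are meaningful; extensionality makes an element of the
  type the same thing as a cadlag function on \<open>[0,\<infinity>)\<close>.\<close>

typedef (overloaded) 'a skorokhod =
  "{x :: real \<Rightarrow> 'a::metric_space. x \<in> extensional {0..} \<and> cadlag x}"
  morphisms path Abs_skorokhod
proof -
  have "(\<lambda>_. undefined) \<in> {x :: real \<Rightarrow> 'a. x \<in> extensional {0..} \<and> cadlag x}"
    by (auto simp: cadlag_def extensional_def)
  then show ?thesis by blast
qed

definition time_change :: "(real \<Rightarrow> real) \<Rightarrow> bool" where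
  "time_change \<tau> \<longleftrightarrow> strict_mono_on {0..} \<tau> \<and> \<tau> ` {0..} = {0..}"

definition J1_nbhd :: "'a::metric_space skorokhod \<Rightarrow> real \<Rightarrow> real \<Rightarrow> 'a skorokhod set" where
  "J1_nbhd x T \<epsilon> = {y. \<exists>\<tau>. time_change \<tau> \<and> (\<forall>s\<ge>0. \<bar>\<tau> s - s\<bar> < \<epsilon>) \<and>
     (\<forall>s\<in>{0..T}. dist (path y (\<tau> s)) (path x s) < \<epsilon>)}"

lemma J1_nbhd_mono: "T' \<le> T \<Longrightarrow> \<epsilon> \<le> \<epsilon>' \<Longrightarrow> J1_nbhd x T \<epsilon> \<subseteq> J1_nbhd x T' \<epsilon>'"
  unfolding J1_nbhd_def by (fastforce elim: order.strict_trans2)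

text \<open>A sequence \<open>y\<^sub>k\<close> is eventually in every \<open>J1_nbhd x T \<epsilon>\<close> iff there are time changes
  \<open>\<tau>\<^sub>k\<close> with \<open>\<tau>\<^sub>k \<rightarrow> id\<close> uniformly on \<open>[0,\<infinity>)\<close> and \<open>y\<^sub>k \<circ> \<tau>\<^sub>k \<rightarrow> x\<close> uniformly on every
  \<open>[0,T]\<close>, that is, iff \<open>y\<^sub>k \<rightarrow> x\<close> in Skorokhod's \<open>J\<^sub>1\<close> sense (Jacod--Shiryaev, Theorem VI.1.14).
  As that convergence is metrizable, the following open sets are exactly those of the
  \<open>J\<^sub>1\<close> topology.\<close>

instantiation skorokhod :: (metric_space) topological_space
begin

definition open_skorokhod :: "'a skorokhod set \<Rightarrow> bool" where
  "open_skorokhod U \<longleftrightarrow> (\<forall>x\<in>U. \<exists>T>0. \<exists>\<epsilon>>0. J1_nbhd x T \<epsilon> \<subseteq> U)"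

instance
proof
  show "open (UNIV :: 'a skorokhod set)"
    unfolding open_skorokhod_def by (auto intro: exI[of _ "1::real"])
next
  fix U V :: "'a skorokhod set"
  assume U: "open U" and V: "open V"
  show "open (U \<inter> V)"
    unfolding open_skorokhod_def
  proof
    fix x assume "x \<in> U \<inter> V"
    with U V obtain T \<epsilon> T' \<epsilon>' where *: "T > 0" "\<epsilon> > 0" "J1_nbhd x T \<epsilon> \<subseteq> U"
      "T' > 0" "\<epsilon>' > 0" "J1_nbhd x T' \<epsilon>' \<subseteq> V"
      unfolding open_skorokhod_def by (meson IntE)
    have "J1_nbhd x (max T T') (min \<epsilon> \<epsilon>') \<subseteq> U \<inter> V"
      using * J1_nbhd_mono[of T "max T T'" "min \<epsilon> \<epsilon>'" \<epsilon> x]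
        J1_nbhd_mono[of T' "max T T'" "min \<epsilon> \<epsilon>'" \<epsilon>' x] by fastforce
    with * show "\<exists>T>0. \<exists>\<epsilon>>0. J1_nbhd x T \<epsilon> \<subseteq> U \<inter> V"
      by (intro exI[of _ "max T T'"] conjI exI[of _ "min \<epsilon> \<epsilon>'"]) auto
  qed
next
  fix K :: "'a skorokhod set set"
  assume "\<forall>U\<in>K. open U"
  then show "open (\<Union>K)"
    unfolding open_skorokhod_def by (meson Union_iff Union_upper order_trans)
qed

end

text \<open>The lower bound on \<open>measure (\<mu> i) K\<close> rules out a non-measurable \<open>K\<close> (of measure 0 by
  convention) as soon as \<open>\<epsilon> < 1\<close>.\<close>

definition tight_family :: "'i set \<Rightarrow> ('i \<Rightarrow> 'a::topological_space measure) \<Rightarrow> bool" where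
  "tight_family I \<mu> \<longleftrightarrow> (\<forall>\<epsilon>>0. \<exists>K. compact K \<and> (\<forall>i\<in>I. measure (\<mu> i) K \<ge> 1 - \<epsilon>))"

subsection \<open>Continuous-time Markov chains\<close>

definition scaled_lattice :: "nat \<Rightarrow> (real ^ 'd) set" where
  "scaled_lattice n = range (\<lambda>k :: int ^ 'd. \<chi> i. real_of_int (k $ i) / real n)"

definition transition_semigroup :: "'s set \<Rightarrow> (real \<Rightarrow> 's \<Rightarrow> 's pmf) \<Rightarrow> bool" where
  "transition_semigroup S p \<longleftrightarrow>
     (\<forall>t\<ge>0. \<forall>a\<in>S. set_pmf (p t a) \<subseteq> S) \<and>
     (\<forall>a\<in>S. p 0 a = return_pmf a) \<and>
     (\<forall>s\<ge>0. \<forall>t\<ge>0. \<forall>a\<in>S. p (s + t) a = bind_pmf (p s a) (p t))"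

definition rate_operator :: "'s set \<Rightarrow> ('s \<Rightarrow> 's \<Rightarrow> real) \<Rightarrow> ('s \<Rightarrow> real) \<Rightarrow> 's \<Rightarrow> real" where
  "rate_operator S C f a = (\<Sum>\<^sub>\<infinity>b\<in>S. (f b - f a) * C a b)"

text \<open>The limit is only required pointwise in \<open>a\<close>. Taking \<open>f\<close> to be an indicator, it says that the
  transition probabilities have the Q-matrix with off-diagonal entries \<open>C a b\<close>; when the total
  rates out of the states are bounded, this determines \<open>p\<close>.\<close>

definition has_generator ::
  "'s set \<Rightarrow> (real \<Rightarrow> 's \<Rightarrow> 's pmf) \<Rightarrow> (('s \<Rightarrow> real) \<Rightarrow> 's \<Rightarrow> real) \<Rightarrow> bool" where
  "has_generator S p A \<longleftrightarrow> (\<forall>f. bounded (f ` S) \<longrightarrow> (\<forall>a\<in>S.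
     ((\<lambda>t. (measure_pmf.expectation (p t a) f - f a) / t) \<longlongrightarrow> A f a) (at_right 0)))"

text \<open>The last conjunct is the Markov property with transition probabilities \<open>p\<close>, in terms of
  finite-dimensional distributions. The process has to stay in \<open>S\<close> almost surely only, so that
  the coordinate process on the path space under the law of the chain is included.\<close>

definition markov_chain ::
  "'w measure \<Rightarrow> (real \<Rightarrow> 'w \<Rightarrow> 's::topological_space) \<Rightarrow> 's set \<Rightarrow> ('s \<Rightarrow> 's \<Rightarrow> real) \<Rightarrow> bool" where
  "markov_chain M Y S C \<longleftrightarrow>
     prob_space M \<and>
     (\<forall>t\<ge>0. Y t \<in> borel_measurable M) \<and>
     (\<forall>t\<ge>0. AE \<omega> in M. Y t \<omega> \<in> S) \<and>
     (\<exists>p. transition_semigroup S p \<and> has_generator S p (rate_operator S C) \<and>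
       (\<forall>k t a. t 0 = 0 \<and> (\<forall>j<k. t j \<le> t (Suc j)) \<and> (\<forall>j\<le>k. a j \<in> S) \<longrightarrow>
         measure M {\<omega> \<in> space M. \<forall>j\<le>k. Y (t j) \<omega> = a j} =
         measure M {\<omega> \<in> space M. Y 0 \<omega> = a 0} *
           (\<Prod>j<k. pmf (p (t (Suc j) - t j) (a j)) (a (Suc j)))))"

end

theory Submission
  imports Defs
begin

text \<open>A set of cadlag paths is relatively compact as soon as, on every \<open>[0,T)\<close>, the paths are uniformly
  bounded and admit partitions with uniformly long pieces on which they oscillate by at most \<open>\<eta>\<close>: along
  an ultrafilter the partitions converge, and the right limits of the pointwise limit define the
  limit path. For the chains such partitions are found greedily along a time grid, a new
  piece starting as soon as the path has moved by \<open>r\<close>. The bounded function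
  \<open>f\<^sub>c(x) = 2 |x - c|\<^sup>2 / (r\<^sup>2 + |x - c|\<^sup>2)\<close> vanishes at \<open>c\<close> and is at least 1 at distance \<open>r\<close> from \<open>c\<close>,
  and its image under the generator is bounded by some \<open>K\<close>, uniformly in \<open>c\<close> and in large \<open>n\<close>. Hence
  \<open>f\<^sub>c(X\<^sub>t) - K t\<close> is a supermartingale, which makes pieces shorter than \<open>\<delta>\<close> improbable; as \<open>K\<close> tends
  to 0 when \<open>r\<close> grows, the same argument confines the path to a large ball. The bounds do not depend
  on the mesh of the grid, so the mesh can be sent to 0. The finitely many small \<open>n\<close> are harmless
  because every single cadlag path admits such partitions.\<close>

subsection \<open>Ultrafilters\<close>

text \<open>The Markov property is given through finite-dimensional distributions, so stopping times
  in continuous time are avoided: the values on a grid have the law of an explicit random walk, and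
  all estimates are inductions over its steps. Every grid uses pieces of the same length \<delta>,
  split into more and more steps; this is why the bounds survive when the mesh tends to 0. The
  probability of a short piece is of order \<open>K * \<delta> * (1 + K * T)\<close>: one piece is
  short with probability at most \<open>K * \<delta>\<close>, and since the test function climbs
  from 0 to 1 before each restart, about \<open>K * T\<close> restarts are to be expected. The test
  function is bounded because (T3) and (T4) give no moments of long jumps, and smooth so that short
  jumps enter only through the first and second moments of (T5) and (T6). Compactness and closedness
  are argued directly from the neighbourhoods \<open>J1_nbhd\<close>; an ultrafilter gives limits at
  all times at once. One passage to the limit, in which times may move slightly, serves closedness,
  compactness and the passage to mesh 0.\<close>

definition ultra :: "'a filter \<Rightarrow> bool" where
  "ultra F \<longleftrightarrow> F \<noteq> bot \<and> (\<forall>P. eventually P F \<or> eventually (\<lambda>x. \<not> P x) F)"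

text \<open>Zorn's lemma for the proper filters below \<open>F\<close>. A chain is bounded by its
  infimum, which is proper because an event holds eventually along it iff it does along some member.
  If a maximal filter does not eventually refute \<open>P\<close>, its meet with \<open>P\<close> is
  still proper, hence equal to it.\<close>

lemma ultra_exists:
  assumes "F \<noteq> bot"
  obtains U where "U \<le> F" "ultra U"
proof -
  define A where "A = {G. G \<le> F \<and> G \<noteq> bot}"
  let ?r = "relation_of (\<lambda>G H. H \<le> G) A"
  have "partial_order_on A ?r"
    by (auto simp: partial_order_on_def preorder_on_def refl_on_def trans_def antisym_def relation_of_def)
  moreover have "\<exists>u\<in>A. \<forall>a\<in>C. u \<le> a" if C: "C \<in> Chains ?r" for C
  proof (cases "C = {}")
    case True
    then show ?thesis using assms by (auto simp: A_def)
  next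
    case False
    have lin: "G \<le> H \<or> H \<le> G" if "G \<in> C" "H \<in> C" for G H
      using C that by (auto simp: Chains_def relation_of_def)
    have CA: "C \<subseteq> A" using C by (auto simp: Chains_def relation_of_def)
    have *: "eventually P (Inf C) = (\<exists>b\<in>C. eventually P b)" for P
      by (rule eventually_Inf_base[OF False]) (metis lin inf.order_iff inf.commute order_refl)
    have "Inf C \<noteq> bot"
    proof
      assume "Inf C = bot"
      then have "eventually (\<lambda>_. False) (Inf C)" by simp
      with * CA show False by (auto simp: A_def trivial_limit_def)
    qed
    moreover have "Inf C \<le> F"
      using False CA by (auto simp: A_def intro: Inf_lower2)
    ultimately show ?thesis by (auto simp: A_def intro: Inf_lower)
  qed
  ultimately obtain U where U: "U \<in> A" and max: "\<And>G. G \<in> A \<Longrightarrow> G \<le> U \<Longrightarrow> G = U"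
    using predicate_Zorn[of A "\<lambda>G H. H \<le> G"] by blast
  have "eventually P U" if "\<not> eventually (\<lambda>x. \<not> P x) U" for P
  proof -
    have "inf U (principal {x. P x}) \<noteq> bot"
      using that by (auto simp: trivial_limit_def eventually_inf_principal)
    then have "inf U (principal {x. P x}) \<in> A"
      using U by (auto simp: A_def intro: le_infI1)
    from max[OF this] have "inf U (principal {x. P x}) = U" by simp
    moreover have "eventually P (inf U (principal {x. P x}))"
      by (simp add: eventually_inf_principal)
    ultimately show ?thesis by simp
  qed
  then have "ultra U" using U by (auto simp: ultra_def A_def)
  with U that show ?thesis by (auto simp: A_def)
qed

text \<open>Compactness gives a cluster point. Along an ultrafilter a cluster point is a limit,
  since a neighbourhood that is not eventually entered would be eventually avoided.\<close>

lemma ultra_tendsto: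
  assumes U: "ultra F" and S: "compact S" "\<forall>\<^sub>F x in F. f x \<in> S"
  obtains l where "l \<in> S" "(f \<longlongrightarrow> l) F"
proof -
  have "filtermap f F \<noteq> bot" using U by (auto simp: ultra_def filtermap_bot_iff)
  moreover have "\<forall>\<^sub>F y in filtermap f F. y \<in> S" using S by (simp add: eventually_filtermap)
  ultimately obtain l where l: "l \<in> S" "inf (nhds l) (filtermap f F) \<noteq> bot"
    using S(1) by (auto simp: compact_filter)
  have "(f \<longlongrightarrow> l) F"
  proof (rule topological_tendstoI)
    fix V assume V: "open V" "l \<in> V"
    show "\<forall>\<^sub>F x in F. f x \<in> V"
    proof (rule ccontr)
      assume "\<not> (\<forall>\<^sub>F x in F. f x \<in> V)"
      then have "\<forall>\<^sub>F x in F. f x \<notin> V" using U by (auto simp: ultra_def)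
      then have "\<forall>\<^sub>F y in filtermap f F. y \<notin> V" by (simp add: eventually_filtermap)
      moreover have "\<forall>\<^sub>F y in nhds l. y \<in> V" using V by (rule eventually_nhds_in_open)
      ultimately have "\<forall>\<^sub>F y in inf (nhds l) (filtermap f F). False"
        by (auto simp: eventually_inf)
      with l show False by (simp add: trivial_limit_def)
    qed
  qed
  with l that show ?thesis by blast
qed

subsection \<open>Compact sets in Skorokhod space\<close>

text \<open>Only open pieces matter: values at the partition points are lost in pointwise limits, and
  right-continuity recovers them at the left end points.\<close>

definition osc_partition ::
  "real \<Rightarrow> real \<Rightarrow> real \<Rightarrow> (nat \<Rightarrow> real) \<Rightarrow> (real \<Rightarrow> 'a::metric_space) \<Rightarrow> bool" where
  "osc_partition T \<delta> \<eta> t y \<longleftrightarrow> t 0 = 0 \<and> (\<forall>i. t i + \<delta> \<le> t (Suc i)) \<and>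
     (\<forall>i u v. t i < u \<and> u < t (Suc i) \<and> u < T \<and> t i < v \<and> v < t (Suc i) \<and> v < T \<longrightarrow>
        dist (y u) (y v) \<le> \<eta>)"

text \<open>All conditions concern times strictly below \<open>T\<close>, so that times
  \<open>\<sigma> u\<close> converging to \<open>u < T\<close> eventually satisfy them too. No
  partition point is prescribed at \<open>T\<close>; the partition runs on to infinity.\<close>

definition tame ::
  "real \<Rightarrow> real \<Rightarrow> real \<Rightarrow> real \<Rightarrow> (real \<Rightarrow> 'a::real_normed_vector) \<Rightarrow> bool" where
  "tame T R \<delta> \<eta> y \<longleftrightarrow> (\<forall>u. 0 \<le> u \<and> u < T \<longrightarrow> norm (y u) \<le> R) \<and> (\<exists>t. osc_partition T \<delta> \<eta> t y)"

lemma osc_partition_ge: "osc_partition T \<delta> \<eta> t y \<Longrightarrow> real i * \<delta> \<le> t i"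
proof (induction i)
  case (Suc i)
  moreover have "t i + \<delta> \<le> t (Suc i)" using Suc.prems by (simp add: osc_partition_def)
  ultimately show ?case by (simp add: algebra_simps)
qed (simp add: osc_partition_def)

text \<open>Points beyond \<open>T\<close> carry no information. Clipping puts the i-th point into a
  compact interval that does not depend on the path, so that it converges along an ultrafilter; the
  summand \<open>real i * \<delta>\<close> preserves the gaps.\<close>

lemma osc_partition_clip:
  assumes "osc_partition T \<delta> \<eta> t y" "0 \<le> T" "0 \<le> \<delta>"
  shows "osc_partition T \<delta> \<eta> (\<lambda>i. min (t i) (T + real i * \<delta>)) y"
proof -
  have *: "t i + \<delta> \<le> t (Suc i)" "t 0 = 0" for i using assms by (auto simp: osc_partition_def)
  have **: "t i < u" if "min (t i) (T + real i * \<delta>) < u" "u < T" for i u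
    using assms that by (smt (verit) mult_nonneg_nonneg of_nat_0_le_iff)
  show ?thesis
    unfolding osc_partition_def
  proof (intro conjI allI impI)
    show "min (t 0) (T + real 0 * \<delta>) = 0" using * assms by simp
    show "min (t i) (T + real i * \<delta>) + \<delta> \<le> min (t (Suc i)) (T + real (Suc i) * \<delta>)" for i
      using *(1)[of i] by (simp add: min_def algebra_simps)
    fix i u v
    assume "min (t i) (T + real i * \<delta>) < u \<and> u < min (t (Suc i)) (T + real (Suc i) * \<delta>) \<and> u < T \<and>
      min (t i) (T + real i * \<delta>) < v \<and> v < min (t (Suc i)) (T + real (Suc i) * \<delta>) \<and> v < T"
    then have "t i < u \<and> u < t (Suc i) \<and> u < T \<and> t i < v \<and> v < t (Suc i) \<and> v < T"
      using **[of i u] **[of i v] by simp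
    then show "dist (y u) (y v) \<le> \<eta>"
      using assms(1) unfolding osc_partition_def by blast
  qed
qed

lemma osc_partition_mono:
  assumes "osc_partition T \<delta> \<eta> t y" "T' \<le> T" "\<delta>' \<le> \<delta>" "\<eta> \<le> \<eta>'"
  shows "osc_partition T' \<delta>' \<eta>' t y"
  using assms unfolding osc_partition_def by (smt (verit))

lemma tame_mono:
  assumes "tame T R \<delta> \<eta> y" "T' \<le> T" "R \<le> R'" "\<delta>' \<le> \<delta>" "\<eta> \<le> \<eta>'"
  shows "tame T' R' \<delta>' \<eta>' y"
  using assms osc_partition_mono unfolding tame_def by (smt (verit))

text \<open>A time strictly inside a limiting piece is eventually strictly inside the corresponding
  approximating piece, even after a vanishing shift of time. The shift \<open>\<sigma>\<close> is a
  Skorokhod time change for closedness, the identity for compactness, and rounding up to the grid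
  for the passage to mesh 0.\<close>

lemma osc_partition_limit:
  assumes F: "F \<noteq> bot" and ev: "\<forall>\<^sub>F j in F. osc_partition T \<delta> \<eta> (t j) (y j)"
    and \<sigma>: "\<And>u. 0 \<le> u \<Longrightarrow> u < T \<Longrightarrow> ((\<lambda>j. \<sigma> j u) \<longlongrightarrow> u) F"
    and g: "\<And>u. 0 \<le> u \<Longrightarrow> u < T \<Longrightarrow> ((\<lambda>j. y j (\<sigma> j u)) \<longlongrightarrow> g u) F"
    and t: "\<And>i. ((\<lambda>j. t j i) \<longlongrightarrow> s i) F" and "0 \<le> \<delta>"
  shows "osc_partition T \<delta> \<eta> s g"
  unfolding osc_partition_def
proof (intro conjI allI impI)
  have "((\<lambda>j. 0) \<longlongrightarrow> s 0) F"
    using t[of 0] by (rule tendsto_cong[THEN iffD1, rotated])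
      (use ev in eventually_elim, auto simp: osc_partition_def)
  then show s0: "s 0 = 0" using F tendsto_const_iff by metis
  show gap: "s i + \<delta> \<le> s (Suc i)" for i
    by (rule tendsto_le[OF F t tendsto_add[OF t tendsto_const]])
      (use ev in eventually_elim, auto simp: osc_partition_def)
  have s: "0 \<le> s i" for i
    by (induction i) (use s0 gap \<open>0 \<le> \<delta>\<close> in \<open>auto intro: order_trans add_increasing2\<close>)
  fix i u v
  assume uv: "s i < u \<and> u < s (Suc i) \<and> u < T \<and> s i < v \<and> v < s (Suc i) \<and> v < T"
  then have u: "s i < u" "u < s (Suc i)" "u < T" and v: "s i < v" "v < s (Suc i)" "v < T" by auto
  have in_piece: "\<forall>\<^sub>F j in F. t j i < \<sigma> j u \<and> \<sigma> j u < t j (Suc i) \<and> \<sigma> j u < T"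
    if "s i < u" "u < s (Suc i)" "u < T" for u
  proof -
    have l: "((\<lambda>j. \<sigma> j u) \<longlongrightarrow> u) F" using \<sigma> that s[of i] by force
    have "\<forall>\<^sub>F j in F. 0 < \<sigma> j u - t j i" "\<forall>\<^sub>F j in F. 0 < t j (Suc i) - \<sigma> j u"
      by (rule order_tendstoD(1)[OF tendsto_diff]; (rule l t)?; use that in simp)+
    with order_tendstoD(2)[OF l \<open>u < T\<close>] show ?thesis by eventually_elim auto
  qed
  have "\<forall>\<^sub>F j in F. dist (y j (\<sigma> j u)) (y j (\<sigma> j v)) \<le> \<eta>"
    using ev in_piece[OF u] in_piece[OF v]
  proof eventually_elim
    case (elim j)
    then show ?case unfolding osc_partition_def by blast
  qed
  moreover have "((\<lambda>j. dist (y j (\<sigma> j u)) (y j (\<sigma> j v))) \<longlongrightarrow> dist (g u) (g v)) F"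
    using uv s[of i] by (intro tendsto_dist g) auto
  ultimately show "dist (g u) (g v) \<le> \<eta>" using F tendsto_upperbound by blast
qed

text \<open>Besides the partition of the limit, the approximating partitions are returned:
  compactness has to map the ones onto the others by time changes.\<close>

lemma osc_partition_ultralimit:
  assumes F: "ultra F" and ev: "\<forall>\<^sub>F j in F. \<exists>t. osc_partition T \<delta> \<eta> t (y j)"
    and \<sigma>: "\<And>u. 0 \<le> u \<Longrightarrow> u < T \<Longrightarrow> ((\<lambda>j. \<sigma> j u) \<longlongrightarrow> u) F"
    and g: "\<And>u. 0 \<le> u \<Longrightarrow> u < T \<Longrightarrow> ((\<lambda>j. y j (\<sigma> j u)) \<longlongrightarrow> g u) F"
    and "0 \<le> \<delta>" "0 \<le> T"
  obtains t s where "\<forall>\<^sub>F j in F. osc_partition T \<delta> \<eta> (t j) (y j)"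
    "\<And>i. ((\<lambda>j. t j i) \<longlongrightarrow> s i) F" "osc_partition T \<delta> \<eta> s g"
proof -
  \<comment> \<open>Where no partition exists the choice is arbitrary; by hypothesis this happens
    only off a set of the ultrafilter.\<close>
  define t0 where "t0 j = (SOME t. osc_partition T \<delta> \<eta> t (y j))" for j
  define t where "t j i = min (t0 j i) (T + real i * \<delta>)" for j i
  have t: "\<forall>\<^sub>F j in F. osc_partition T \<delta> \<eta> (t j) (y j)"
    using ev
  proof eventually_elim
    case (elim j)
    then have "osc_partition T \<delta> \<eta> (t0 j) (y j)" unfolding t0_def by (rule someI_ex)
    then show ?case unfolding t_def by (rule osc_partition_clip) fact+
  qed
  have "\<exists>l. ((\<lambda>j. t j i) \<longlongrightarrow> l) F" for i
  proof (rule ultra_tendsto[OF F, of "{0..T + real i * \<delta>}"])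
    show "\<forall>\<^sub>F j in F. t j i \<in> {0..T + real i * \<delta>}"
      using t
    proof eventually_elim
      case (elim j)
      from osc_partition_ge[OF this, of i] \<open>0 \<le> \<delta>\<close> show ?case
        by (auto simp: t_def intro: order_trans[rotated])
    qed
  qed auto
  then obtain s where s: "\<And>i. ((\<lambda>j. t j i) \<longlongrightarrow> s i) F" by metis
  have "osc_partition T \<delta> \<eta> s g"
    using F by (intro osc_partition_limit[OF _ t \<sigma> g s \<open>0 \<le> \<delta>\<close>]) (auto simp: ultra_def)
  with t s that show ?thesis by blast
qed

lemma tame_ultralimit:
  assumes F: "ultra F" and ev: "\<forall>\<^sub>F j in F. tame T R \<delta> \<eta> (y j)"
    and \<sigma>: "\<And>u. 0 \<le> u \<Longrightarrow> u < T \<Longrightarrow> ((\<lambda>j. \<sigma> j u) \<longlongrightarrow> u) F"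
    and \<sigma>0: "\<And>u. 0 \<le> u \<Longrightarrow> \<forall>\<^sub>F j in F. 0 \<le> \<sigma> j u"
    and g: "\<And>u. 0 \<le> u \<Longrightarrow> u < T \<Longrightarrow> ((\<lambda>j. y j (\<sigma> j u)) \<longlongrightarrow> g u) F"
    and "0 \<le> \<delta>" "0 \<le> T"
  shows "tame T R \<delta> \<eta> g"
  unfolding tame_def
proof (intro conjI allI impI)
  have ev': "\<forall>\<^sub>F j in F. \<exists>t. osc_partition T \<delta> \<eta> t (y j)"
    using ev by eventually_elim (auto simp: tame_def)
  show "\<exists>t. osc_partition T \<delta> \<eta> t g"
    using osc_partition_ultralimit[OF F ev' \<sigma> g \<open>0 \<le> \<delta>\<close> \<open>0 \<le> T\<close>] by metis
  fix u assume u: "0 \<le> u \<and> u < T"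
  then have "\<forall>\<^sub>F j in F. \<sigma> j u < T" using \<sigma> order_tendstoD(2) by metis
  then have "\<forall>\<^sub>F j in F. norm (y j (\<sigma> j u)) \<le> R"
    using ev \<sigma>0[of u, OF conjunct1[OF u]]
    by eventually_elim (auto simp: tame_def)
  moreover have "((\<lambda>j. norm (y j (\<sigma> j u))) \<longlongrightarrow> norm (g u)) F"
    using u by (intro tendsto_norm g) auto
  ultimately show "norm (g u) \<le> R" using F tendsto_upperbound by (auto simp: ultra_def)
qed

lemma cadlag_path: "cadlag (path x)"
  using path[of x] by auto

text \<open>If every neighbourhood of \<open>x\<close> met the set, a sequence from the set would
  approach \<open>x\<close> with horizons \<open>j + 1\<close> and errors
  \<open>1 / (j + 1)\<close>, and its time changes could serve as \<open>\<sigma>\<close>.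
  Closedness also makes the tame events measurable.\<close>

lemma closed_tame:
  assumes "0 \<le> \<delta>" "0 \<le> T"
  shows "closed {x :: 'a::real_normed_vector skorokhod. tame T R \<delta> \<eta> (path x)}"
proof -
  have "\<exists>T'>0. \<exists>\<epsilon>>0. J1_nbhd x T' \<epsilon> \<subseteq> {x. \<not> tame T R \<delta> \<eta> (path x)}"
    if x: "\<not> tame T R \<delta> \<eta> (path x)" for x :: "'a skorokhod"
  proof (rule ccontr)
    assume neg: "\<not> ?thesis"
    have "\<exists>y. y \<in> J1_nbhd x (real (Suc j)) (1 / real (Suc j)) \<and> tame T R \<delta> \<eta> (path y)" for j
    proof -
      have "\<not> J1_nbhd x (real (Suc j)) (1 / real (Suc j)) \<subseteq> {x. \<not> tame T R \<delta> \<eta> (path x)}"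
        using neg by (metis of_nat_0_less_iff zero_less_Suc zero_less_divide_1_iff)
      then show ?thesis by blast
    qed
    then obtain y where y: "\<And>j. y j \<in> J1_nbhd x (real (Suc j)) (1 / real (Suc j))"
      "\<And>j. tame T R \<delta> \<eta> (path (y j))" by metis
    from y(1) obtain \<tau> where \<tau>: "\<And>j. time_change (\<tau> j)"
      "\<And>j s. s \<ge> 0 \<Longrightarrow> \<bar>\<tau> j s - s\<bar> < 1 / real (Suc j)"
      "\<And>j s. s \<in> {0..real (Suc j)} \<Longrightarrow> dist (path (y j) (\<tau> j s)) (path x s) < 1 / real (Suc j)"
      unfolding J1_nbhd_def by (simp add: Ball_def) metis
    obtain F where F: "F \<le> sequentially" "ultra F"
      using ultra_exists[of sequentially] by auto
    have null: "(\<lambda>j. 1 / real (Suc j)) \<longlonglongrightarrow> 0"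
      by (rule LIMSEQ_inverse_real_of_nat[unfolded inverse_eq_divide])
    have "tame T R \<delta> \<eta> (path x)"
    proof (rule tame_ultralimit[OF F(2), where y = "\<lambda>j. path (y j)" and \<sigma> = \<tau>])
      fix u :: real assume u: "0 \<le> u"
      show "\<forall>\<^sub>F j in F. 0 \<le> \<tau> j u"
        using \<tau>(1) u by (auto simp: time_change_def intro!: always_eventually)
      have "(\<lambda>j. \<tau> j u) \<longlonglongrightarrow> u"
        by (rule LIM_zero_cancel, rule Lim_null_comparison[OF _ null])
          (use \<tau>(2)[OF u] in \<open>auto intro!: always_eventually less_imp_le\<close>)
      then show "((\<lambda>j. \<tau> j u) \<longlongrightarrow> u) F" using F(1) by (rule tendsto_mono[rotated])
      have "\<forall>\<^sub>F j in sequentially. u \<le> real j"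
        by (meson eventually_sequentially nat_ceiling_le_eq)
      then have "\<forall>\<^sub>F j in sequentially. norm (dist (path (y j) (\<tau> j u)) (path x u)) \<le> 1 / real (Suc j)"
      proof eventually_elim
        case (elim j)
        then show ?case using \<tau>(3)[of u j] u by simp
      qed
      then have "(\<lambda>j. dist (path (y j) (\<tau> j u)) (path x u)) \<longlonglongrightarrow> 0"
        using null by (rule Lim_null_comparison)
      then have "(\<lambda>j. path (y j) (\<tau> j u)) \<longlonglongrightarrow> path x u" by (rule tendsto_dist_iff[THEN iffD2])
      then show "((\<lambda>j. path (y j) (\<tau> j u)) \<longlongrightarrow> path x u) F" using F(1) by (rule tendsto_mono[rotated])
    qed (use y assms in auto)
    with x show False by blast
  qed
  then show ?thesis
    unfolding closed_def open_skorokhod_def by (simp add: Collect_neg_eq)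
qed

section \<open>Time changes through prescribed points\<close>

text \<open>\<open>B\<close> is either the next segment of a piecewise linear map or the final
  half-line, which is why it is left general.\<close>

lemma glue_strict_mono:
  fixes f g :: "real \<Rightarrow> real"
  assumes f: "strict_mono_on {0..p} f" and g: "strict_mono_on B g" and B: "p \<in> B" "B \<subseteq> {p..}"
    and "f p = g p" "0 \<le> p"
  defines "h \<equiv> \<lambda>u. if u \<le> p then f u else g u"
  shows "strict_mono_on ({0..p} \<union> B) h" "h ` ({0..p} \<union> B) = f ` {0..p} \<union> g ` B"
proof -
  have hB: "h u = g u" if "u \<in> B" for u using that B assms(5) by (auto simp: h_def)
  show "strict_mono_on ({0..p} \<union> B) h"
  proof (rule strict_mono_onI)
    fix u v assume uv: "u \<in> {0..p} \<union> B" "v \<in> {0..p} \<union> B" "u < v"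
    consider "v \<le> p" | "u \<le> p" "p < v" | "p < u" by linarith
    then show "h u < h v"
    proof cases
      case 1
      then show ?thesis using uv B f by (auto simp: h_def strict_mono_on_def subset_eq)
    next
      case 2
      have "h u \<le> f p"
        using 2 uv B \<open>0 \<le> p\<close> f strict_mono_on_leD[OF f, of u p] by (auto simp: h_def)
      also have "f p < g v"
        using 2 uv B assms(5) strict_mono_onD[OF g, of p v] by auto
      finally show ?thesis using 2 by (simp add: h_def)
    next
      case 3
      then show ?thesis using uv strict_mono_onD[OF g, of u v] by (auto simp: h_def)
    qed
  qed
  show "h ` ({0..p} \<union> B) = f ` {0..p} \<union> g ` B"
    unfolding image_Un by (rule arg_cong2[of _ _ _ _ "(\<union>)"]; rule image_cong) (use hB in \<open>auto simp: h_def\<close>)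
qed

text \<open>Linear interpolation: on a segment the deviation from the identity is a convex
  combination of the deviations at its two ends, hence still below \<epsilon>.\<close>

lemma piecewise_linear:
  fixes t s :: "nat \<Rightarrow> real"
  assumes "t 0 = 0" "s 0 = 0" and t: "\<And>i. t i < t (Suc i)" and s: "\<And>i. s i < s (Suc i)"
    and close: "\<And>i. i \<le> N \<Longrightarrow> \<bar>s i - t i\<bar> < \<epsilon>"
  shows "\<exists>\<tau>. strict_mono_on {0..t N} \<tau> \<and> \<tau> ` {0..t N} = {0..s N} \<and>
    (\<forall>u\<in>{0..t N}. \<bar>\<tau> u - u\<bar> < \<epsilon>) \<and> (\<forall>i\<le>N. \<tau> (t i) = s i)"
  using close
proof (induction N)
  case 0
  show ?case using assms(1,2) 0[of 0] by (intro exI[of _ id]) (auto simp: strict_mono_on_def)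
next
  case (Suc N)
  then obtain \<tau> where \<tau>: "strict_mono_on {0..t N} \<tau>" "\<tau> ` {0..t N} = {0..s N}"
    "\<And>u. u \<in> {0..t N} \<Longrightarrow> \<bar>\<tau> u - u\<bar> < \<epsilon>" "\<And>i. i \<le> N \<Longrightarrow> \<tau> (t i) = s i" by force
  have mt: "t i \<le> t j" and ms: "s i \<le> s j" if "i \<le> j" for i j
    by (rule lift_Suc_mono_le[of t, OF less_imp_le[OF t] that], rule lift_Suc_mono_le[of s, OF less_imp_le[OF s] that])
  have tN: "0 \<le> t i" "0 \<le> s i" for i
    using mt[of 0 i] ms[of 0 i] assms(1,2) by auto
  define c where "c = (s (Suc N) - s N) / (t (Suc N) - t N)"
  have c: "c > 0" "c * (t (Suc N) - t N) = s (Suc N) - s N"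
    using t[of N] s[of N] by (auto simp: c_def)
  define g where "g u = s N + c * (u - t N)" for u
  have g: "strict_mono_on {t N..t (Suc N)} g" using c by (auto simp: strict_mono_on_def g_def)
  have im: "g ` {t N..t (Suc N)} = {s N..s (Suc N)}"
  proof (intro equalityI subsetI)
    fix v assume v: "v \<in> {s N..s (Suc N)}"
    have "g (t N + (v - s N) / c) = v" using c by (simp add: g_def)
    moreover have "(v - s N) / c \<le> (c * (t (Suc N) - t N)) / c"
      using v c(1) by (intro divide_right_mono) (auto simp: c(2))
    then have "t N + (v - s N) / c \<in> {t N..t (Suc N)}" using v c(1) by auto
    ultimately show "v \<in> g ` {t N..t (Suc N)}" by (metis imageI)
  next
    fix v assume "v \<in> g ` {t N..t (Suc N)}"
    then obtain u where u: "v = g u" "t N \<le> u" "u \<le> t (Suc N)" by auto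
    have "c * (u - t N) \<le> c * (t (Suc N) - t N)" using u c by (intro mult_left_mono) auto
    then show "v \<in> {s N..s (Suc N)}" using u c by (auto simp: g_def)
  qed
  let ?h = "\<lambda>u. if u \<le> t N then \<tau> u else g u"
  have eq: "{0..t N} \<union> {t N..t (Suc N)} = {0..t (Suc N)}" "{0..s N} \<union> {s N..s (Suc N)} = {0..s (Suc N)}"
    using tN[of N] t[of N] s[of N] by (auto simp: ivl_disj_un_two_touch)
  have "\<tau> (t N) = g (t N)" using \<tau>(4)[of N] by (simp add: g_def)
  moreover have "t N \<in> {t N..t (Suc N)}" "{t N..t (Suc N)} \<subseteq> {t N..}" using t[of N] by auto
  ultimately have gl: "strict_mono_on {0..t (Suc N)} ?h" "?h ` {0..t (Suc N)} = {0..s (Suc N)}"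
    using glue_strict_mono[OF \<tau>(1) g _ _ _ tN(1)] unfolding eq \<tau>(2) im by blast+
  have "\<bar>?h u - u\<bar> < \<epsilon>" if u: "u \<in> {0..t (Suc N)}" for u
  proof (cases "u \<le> t N")
    case True
    then show ?thesis using \<tau>(3)[of u] u by simp
  next
    case False
    define l where "l = (u - t N) / (t (Suc N) - t N)"
    have l: "0 \<le> l" "l \<le> 1" "l * (t (Suc N) - t N) = u - t N" using False u t[of N] by (auto simp: l_def)
    have "g u - u = (1 - l) * (s N - t N) + l * (s (Suc N) - t (Suc N))"
      unfolding g_def l(3)[symmetric] using c(2) l(3) by algebra
    also have "\<bar>\<dots>\<bar> \<le> (1 - l) * \<bar>s N - t N\<bar> + l * \<bar>s (Suc N) - t (Suc N)\<bar>"
      using l by (intro order_trans[OF abs_triangle_ineq]) (auto simp: abs_mult)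
    also have "\<dots> < \<epsilon>"
      using Suc.prems[of N] Suc.prems[of "Suc N"] l by (intro convex_bound_lt) auto
    finally show ?thesis using False by simp
  qed
  moreover have "?h (t i) = s i" if "i \<le> Suc N" for i
  proof (cases "i = Suc N")
    case True
    then show ?thesis using t[of N] c by (simp add: g_def)
  next
    case False
    then show ?thesis using that \<tau>(4)[of i] mt[of i N] by simp
  qed
  ultimately have "\<forall>u\<in>{0..t (Suc N)}. \<bar>?h u - u\<bar> < \<epsilon>" "\<forall>i\<le>Suc N. ?h (t i) = s i"
    by blast+
  with gl show ?case by blast
qed

text \<open>Beyond the last prescribed point the map is a translation by \<open>s N - t N\<close>,
  whose deviation from the identity is the one already attained at \<open>t N\<close>.\<close>

lemma time_change_through:
  fixes t s :: "nat \<Rightarrow> real"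
  assumes "t 0 = 0" "s 0 = 0" and t: "\<And>i. t i < t (Suc i)" and s: "\<And>i. s i < s (Suc i)"
    and close: "\<And>i. i \<le> N \<Longrightarrow> \<bar>s i - t i\<bar> < \<epsilon>"
  obtains \<tau> where "time_change \<tau>" "\<And>u. 0 \<le> u \<Longrightarrow> \<bar>\<tau> u - u\<bar> < \<epsilon>" "\<And>i. i \<le> N \<Longrightarrow> \<tau> (t i) = s i"
proof -
  have "\<exists>\<tau>. strict_mono_on {0..t N} \<tau> \<and> \<tau> ` {0..t N} = {0..s N} \<and>
    (\<forall>u\<in>{0..t N}. \<bar>\<tau> u - u\<bar> < \<epsilon>) \<and> (\<forall>i\<le>N. \<tau> (t i) = s i)"
    by (rule piecewise_linear) (fact assms)+
  then obtain \<tau> where \<tau>: "strict_mono_on {0..t N} \<tau>" "\<tau> ` {0..t N} = {0..s N}"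
    "\<And>u. u \<in> {0..t N} \<Longrightarrow> \<bar>\<tau> u - u\<bar> < \<epsilon>" "\<And>i. i \<le> N \<Longrightarrow> \<tau> (t i) = s i" by metis
  have mt: "t i \<le> t j" and ms: "s i \<le> s j" if "i \<le> j" for i j
    by (rule lift_Suc_mono_le[of t, OF less_imp_le[OF t] that], rule lift_Suc_mono_le[of s, OF less_imp_le[OF s] that])
  have tN: "0 \<le> t i" "0 \<le> s i" for i
    using mt[of 0 i] ms[of 0 i] assms(1,2) by auto
  define g where "g u = u + (s N - t N)" for u
  have g: "strict_mono_on {t N..} g" by (auto simp: strict_mono_on_def g_def)
  have im: "g ` {t N..} = {s N..}"
    using image_add_atLeast[of "s N - t N" "t N"] by (simp add: g_def[abs_def] add.commute)
  have eq: "{0..t N} \<union> {t N..} = {0..}" "{0..s N} \<union> {s N..} = {0..}"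
    using tN[of N] by auto
  have "\<tau> (t N) = g (t N)" using \<tau>(4)[of N] by (simp add: g_def)
  moreover have "t N \<in> {t N..}" "{t N..} \<subseteq> {t N..}" by auto
  ultimately have gl: "strict_mono_on {0..} (\<lambda>u. if u \<le> t N then \<tau> u else g u)"
    "(\<lambda>u. if u \<le> t N then \<tau> u else g u) ` {0..} = {0..}"
    using glue_strict_mono[OF \<tau>(1) g _ _ _ tN(1)] unfolding eq \<tau>(2) im by blast+
  show ?thesis
  proof (rule that)
    let ?h = "\<lambda>u. if u \<le> t N then \<tau> u else g u"
    show "time_change ?h" using gl by (auto simp: time_change_def)
    show "\<bar>?h u - u\<bar> < \<epsilon>" if "0 \<le> u" for u
      using \<tau>(3)[of u] that close[of N] by (auto simp: g_def)
    show "?h (t i) = s i" if "i \<le> N" for i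
      using \<tau>(4)[of i] that mt[of i N] by auto
  qed
qed

section \<open>Right limits of regulated functions\<close>

text \<open>Existence of one-sided limits, in Cauchy form. The value at \<open>u\<close> itself is
  unconstrained, as it must be for a pointwise limit of paths whose jump times move.\<close>

definition regulated :: "(real \<Rightarrow> 'a::metric_space) \<Rightarrow> bool" where
  "regulated g \<longleftrightarrow> (\<forall>e>0.
     (\<forall>u\<ge>0. \<exists>q>u. \<forall>v w. u < v \<and> v < q \<and> u < w \<and> w < q \<longrightarrow> dist (g v) (g w) \<le> e) \<and>
     (\<forall>u>0. \<exists>p\<ge>0. p < u \<and> (\<forall>v w. p < v \<and> v < u \<and> p < w \<and> w < u \<longrightarrow> dist (g v) (g w) \<le> e)))"

lemma tendsto_if_small_oscillation:
  fixes g :: "'b \<Rightarrow> 'a::complete_space"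
  assumes "F \<noteq> bot"
    and "\<And>e. e > 0 \<Longrightarrow> \<exists>P. eventually P F \<and> (\<forall>x y. P x \<and> P y \<longrightarrow> dist (g x) (g y) \<le> e)"
  shows "\<exists>l. (g \<longlongrightarrow> l) F"
proof -
  have "cauchy_filter (filtermap g F)"
    unfolding cauchy_filter_metric_filtermap
  proof (intro allI impI)
    fix e :: real assume "e > 0"
    then obtain P where "eventually P F" "\<And>x y. P x \<Longrightarrow> P y \<Longrightarrow> dist (g x) (g y) \<le> e / 2"
      using assms(2)[of "e / 2"] by auto
    with \<open>e > 0\<close> show "\<exists>P. eventually P F \<and> (\<forall>x y. P x \<and> P y \<longrightarrow> dist (g x) (g y) < e)"
      by (intro exI[of _ P]) force
  qed
  then have "\<exists>c. filtermap g F \<le> nhds c"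
    using assms(1) by (intro cauchy_filter_complete_converges[of _ UNIV])
      (auto simp: complete_UNIV filtermap_bot_iff)
  then show ?thesis by (simp add: filterlim_def)
qed

text \<open>Because \<open>p \<le> u\<close> may be an equality, a bound on an open piece extends to
  its left end point once values are replaced by right limits.\<close>

lemma dist_right_limit_le:
  fixes g :: "real \<Rightarrow> 'a::metric_space"
  assumes "(g \<longlongrightarrow> a) (at_right u)" "p \<le> u" "u < q" "\<And>v. p < v \<Longrightarrow> v < q \<Longrightarrow> dist (g v) c \<le> \<eta>"
  shows "dist a c \<le> \<eta>"
proof -
  have "((\<lambda>v. dist (g v) c) \<longlongrightarrow> dist a c) (at_right u)"
    using assms(1) by (intro tendsto_intros)
  moreover have "\<forall>\<^sub>F v in at_right u. dist (g v) c \<le> \<eta>"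
    using assms by (intro eventually_at_right_field[THEN iffD2] exI[of _ q]) auto
  ultimately show ?thesis by (rule tendsto_upperbound) simp
qed

lemma regulated_right_limit:
  fixes g :: "real \<Rightarrow> 'a::complete_space"
  assumes "regulated g" "0 \<le> u"
  shows "(g \<longlongrightarrow> Lim (at_right u) g) (at_right u)"
proof -
  have "\<exists>l. (g \<longlongrightarrow> l) (at_right u)"
  proof (rule tendsto_if_small_oscillation)
    fix e :: real assume "e > 0"
    then obtain q where "q > u" "\<And>v w. u < v \<Longrightarrow> v < q \<Longrightarrow> u < w \<Longrightarrow> w < q \<Longrightarrow> dist (g v) (g w) \<le> e"
      using assms by (auto simp: regulated_def) metis
    then show "\<exists>P. eventually P (at_right u) \<and> (\<forall>x y. P x \<and> P y \<longrightarrow> dist (g x) (g y) \<le> e)"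
      by (intro exI[of _ "\<lambda>v. u < v \<and> v < q"]) (auto simp: eventually_at_right_field intro!: exI[of _ q])
  qed simp
  then show ?thesis by (metis tendsto_Lim trivial_limit_at_right_real)
qed

text \<open>Right limits taken inside an open interval oscillate there no more than the function
  itself, so the Cauchy conditions pass from \<open>g\<close> to its right limits.\<close>

lemma regulated_cadlag:
  fixes g :: "real \<Rightarrow> 'a::complete_space"
  assumes g: "regulated g"
  shows "cadlag (\<lambda>u. if 0 \<le> u then Lim (at_right u) g else undefined)" (is "cadlag ?x")
  unfolding cadlag_def
proof (intro conjI allI impI)
  note lim = regulated_right_limit[OF g]
  fix u :: real assume u: "0 \<le> u"
  show "(?x \<longlongrightarrow> ?x u) (at_right u)"
  proof (rule tendstoI)
    fix e :: real assume "e > 0"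
    then obtain q where q: "q > u" "\<And>v w. u < v \<Longrightarrow> v < q \<Longrightarrow> u < w \<Longrightarrow> w < q \<Longrightarrow> dist (g v) (g w) \<le> e / 2"
      using assms u unfolding regulated_def by (meson half_gt_zero)
    have "dist (?x v) (?x u) < e" if v: "u < v" "v < q" for v
    proof -
      have "dist (g w) (?x v) \<le> e / 2" if w: "u < w" "w < q" for w
        using dist_right_limit_le[OF lim, of v u q "g w" "e / 2"] q v w u by (auto simp: dist_commute)
      then have "dist (?x u) (?x v) \<le> e / 2"
        using dist_right_limit_le[OF lim, of u u q "?x v" "e / 2"] q u by auto
      with \<open>e > 0\<close> show ?thesis by (simp only: dist_commute)
    qed
    then show "\<forall>\<^sub>F v in at_right u. dist (?x v) (?x u) < e"
      using q(1) unfolding eventually_at_right_field by blast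
  qed
next
  note lim = regulated_right_limit[OF g]
  fix u :: real assume u: "0 < u"
  show "\<exists>l. (?x \<longlongrightarrow> l) (at_left u)"
  proof (rule tendsto_if_small_oscillation)
    fix e :: real assume "e > 0"
    then obtain p where p: "0 \<le> p" "p < u" "\<And>v w. p < v \<Longrightarrow> v < u \<Longrightarrow> p < w \<Longrightarrow> w < u \<Longrightarrow> dist (g v) (g w) \<le> e"
      using assms u unfolding regulated_def by meson
    have "dist (?x v) (?x w) \<le> e" if v: "p < v" "v < u" and w: "p < w" "w < u" for v w
    proof -
      have "dist (g z) (?x w) \<le> e" if z: "p < z" "z < u" for z
        using dist_right_limit_le[OF lim, of w p u "g z" e] p w z by (auto simp: dist_commute)
      then show ?thesis
        using dist_right_limit_le[OF lim, of v p u "?x w" e] p v by auto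
    qed
    then show "\<exists>P. eventually P (at_left u) \<and> (\<forall>x y. P x \<and> P y \<longrightarrow> dist (?x x) (?x y) \<le> e)"
      using p(2) by (intro exI[of _ "\<lambda>v. p < v \<and> v < u"] conjI)
        (blast intro: eventually_at_left_field[THEN iffD2])+
  qed simp
qed

lemma osc_partition_unbounded:
  assumes "osc_partition T \<delta> \<eta> t y" "0 < \<delta>"
  obtains i where "u < t i"
proof -
  obtain i :: nat where "u < real i * \<delta>"
    using assms(2) ex_less_of_nat_mult by blast
  with osc_partition_ge[OF assms(1), of i] show ?thesis by (intro that[of i]) linarith
qed

lemma osc_partition_piece:
  assumes "osc_partition T \<delta> \<eta> t y" "0 < \<delta>" "0 \<le> u"
  obtains i where "t i \<le> u" "u < t (Suc i)"
proof -
  obtain k where "u < t k" using osc_partition_unbounded assms by blast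
  moreover have "\<not> u < t 0" using assms by (auto simp: osc_partition_def)
  ultimately obtain i where "\<not> u < t i" "u < t (Suc i)"
    using ex_least_nat_less[of "\<lambda>i. u < t i" k] by blast
  then show ?thesis by (intro that[of i]) auto
qed

lemma osc_partition_piece_left:
  assumes "osc_partition T \<delta> \<eta> t y" "0 < \<delta>" "0 < u"
  obtains i where "t i < u" "u \<le> t (Suc i)"
proof -
  obtain k where "u < t k" using osc_partition_unbounded assms by blast
  moreover have "\<not> u \<le> t 0" using assms by (auto simp: osc_partition_def)
  ultimately obtain i where "\<not> u \<le> t i" "u \<le> t (Suc i)"
    using ex_least_nat_less[of "\<lambda>i. u \<le> t i" k] by auto
  then show ?thesis by (intro that[of i]) auto
qed

text \<open>As \<open>m\<close> grows, horizon and accuracy improve together, so one scale serves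
  given \<open>e\<close> and \<open>u\<close>. Right of \<open>u\<close> the piece is taken with its
  left end point included, left of \<open>u\<close> with its right end point included.\<close>

lemma regulated_if_osc_partition:
  assumes "\<And>m. 0 < \<delta> m" "\<And>m. \<exists>t. osc_partition (real m) (\<delta> m) (1 / real (Suc m)) t g"
  shows "regulated g"
  unfolding regulated_def
proof (intro allI impI conjI)
  fix e u :: real assume e: "e > 0"
  obtain m where m: "u < real m" "1 / real (Suc m) < e"
  proof -
    obtain a b where a: "u < real a" and b: "1 / real (Suc b) < e"
      using reals_Archimedean2 nat_approx_posE[OF e] by metis
    have "1 / real (Suc (max a b)) \<le> 1 / real (Suc b)" by (intro divide_left_mono) auto
    with a b that[of "max a b"] show ?thesis by linarith
  qed
  from assms(2) obtain t where t: "osc_partition (real m) (\<delta> m) (1 / real (Suc m)) t g" by blast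
  have osc: "dist (g v) (g w) \<le> e"
    if "t i < v" "v < t (Suc i)" "v < real m" "t i < w" "w < t (Suc i)" "w < real m" for i v w
    using t that m(2) unfolding osc_partition_def by (meson order_trans less_imp_le)
  { assume "u \<ge> 0"
    then obtain i where "t i \<le> u" "u < t (Suc i)" using osc_partition_piece[OF t assms(1)] by blast
    then show "\<exists>q>u. \<forall>v w. u < v \<and> v < q \<and> u < w \<and> w < q \<longrightarrow> dist (g v) (g w) \<le> e"
      using m(1) osc[of i]
      by (intro exI[of _ "min (t (Suc i)) (real m)"]) auto }
  { assume "u > 0"
    then obtain i where i: "t i < u" "u \<le> t (Suc i)" using osc_partition_piece_left[OF t assms(1)] by blast
    have "0 \<le> t i" using osc_partition_ge[OF t, of i] assms(1)[of m] by (auto intro: order_trans[rotated])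
    with i m show "\<exists>p\<ge>0. p < u \<and> (\<forall>v w. p < v \<and> v < u \<and> p < w \<and> w < u \<longrightarrow> dist (g v) (g w) \<le> e)"
      using osc[of i] by (intro exI[of _ "t i"]) auto }
qed

text \<open>Along an ultrafilter on the set, the paths converge at every time to some
  \<open>g\<close> and the partitions of all scales converge too. The limit path \<open>X\<close>
  consists of the right limits of \<open>g\<close>. For \<open>J1\<close> closeness, the limit
  partition of a fine scale is mapped onto that of a nearby path \<open>y\<close>; on each piece
  both paths are then compared at a single interior time.\<close>

lemma compact_tame:
  fixes R \<delta> :: "nat \<Rightarrow> real"
  assumes \<delta>: "\<And>m. 0 < \<delta> m"
  shows "compact {x :: 'a::euclidean_space skorokhod.
    \<forall>m. tame (real m) (R m) (\<delta> m) (1 / real (Suc m)) (path x)}" (is "compact ?K")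
  unfolding compact_filter
proof (intro allI impI)
  fix G :: "'a skorokhod filter" assume "G \<noteq> bot" and GK: "\<forall>\<^sub>F x in G. x \<in> ?K"
  then obtain F where F: "F \<le> G" "ultra F" using ultra_exists by blast
  then have FK: "\<forall>\<^sub>F x in F. x \<in> ?K" and Fbot: "F \<noteq> bot"
    using GK by (auto simp: ultra_def filter_leD)
  have "\<exists>l. ((\<lambda>x. path x u) \<longlongrightarrow> l) F" if u: "0 \<le> u" for u
  proof -
    obtain m where m: "u < real m" using reals_Archimedean2 by blast
    have "\<forall>\<^sub>F x in F. path x u \<in> cball 0 (R m)"
      using FK by eventually_elim (use u m in \<open>auto simp: tame_def\<close>)
    from ultra_tendsto[OF F(2) compact_cball this] show ?thesis by blast
  qed
  then obtain g where g: "\<And>u. 0 \<le> u \<Longrightarrow> ((\<lambda>x. path x u) \<longlongrightarrow> g u) F" by metis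
  have "\<exists>t s. (\<forall>\<^sub>F x in F. osc_partition (real m) (\<delta> m) (1 / real (Suc m)) (t x) (path x)) \<and>
    (\<forall>i. ((\<lambda>x. t x i) \<longlongrightarrow> s i) F) \<and> osc_partition (real m) (\<delta> m) (1 / real (Suc m)) s g" for m
  proof (rule osc_partition_ultralimit[OF F(2), where \<sigma> = "\<lambda>x u. u" and y = path and g = g and T = "real m"
        and \<delta> = "\<delta> m" and \<eta> = "1 / real (Suc m)"])
    show "\<forall>\<^sub>F x in F. \<exists>t. osc_partition (real m) (\<delta> m) (1 / real (Suc m)) t (path x)"
      using FK by eventually_elim (auto simp: tame_def)
  qed (use g \<delta> in \<open>auto simp: less_imp_le\<close>)
  then have "\<forall>m. \<exists>t. \<exists>s. (\<forall>\<^sub>F x in F. osc_partition (real m) (\<delta> m) (1 / real (Suc m)) (t x) (path x)) \<and>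
    (\<forall>i. ((\<lambda>x. t x i) \<longlongrightarrow> s i) F) \<and> osc_partition (real m) (\<delta> m) (1 / real (Suc m)) s g" by blast
  from choice[OF this] obtain t where "\<forall>m. \<exists>s. (\<forall>\<^sub>F x in F. osc_partition (real m) (\<delta> m) (1 / real (Suc m)) (t m x) (path x)) \<and>
    (\<forall>i. ((\<lambda>x. t m x i) \<longlongrightarrow> s i) F) \<and> osc_partition (real m) (\<delta> m) (1 / real (Suc m)) s g" by blast
  from choice[OF this] obtain s where t: "\<And>m. \<forall>\<^sub>F x in F. osc_partition (real m) (\<delta> m) (1 / real (Suc m)) (t m x) (path x)"
    and ts: "\<And>m i. ((\<lambda>x. t m x i) \<longlongrightarrow> s m i) F"
    and s: "\<And>m. osc_partition (real m) (\<delta> m) (1 / real (Suc m)) (s m) g"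
    by blast
  have reg: "regulated g" by (rule regulated_if_osc_partition[of \<delta>]) (use \<delta> s in blast)+
  define X where "X = Abs_skorokhod (\<lambda>u. if 0 \<le> u then Lim (at_right u) g else undefined)"
  have X: "path X = (\<lambda>u. if 0 \<le> u then Lim (at_right u) g else undefined)"
    unfolding X_def using regulated_cadlag[OF reg]
    by (intro Abs_skorokhod_inverse) (auto simp: extensional_def)
  have lim: "(g \<longlongrightarrow> path X u) (at_right u)" if "0 \<le> u" for u
    using regulated_right_limit[OF reg that] that by (simp add: X)
  have s_nonneg: "0 \<le> s m i" for m i
    using osc_partition_ge[OF s, of i m] \<delta>[of m] by (auto intro: order_trans[rotated])
  \<comment> \<open>\<open>X\<close> and \<open>g\<close> may differ at jump times, so
    \<open>X\<close> is compared with values of \<open>g\<close> at interior times of the same piece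
    only.\<close>
  have gX: "dist (path X u) (g w) \<le> 1 / real (Suc m)"
    if "s m i \<le> u" "u < s m (Suc i)" "u < real m" "s m i < w" "w < s m (Suc i)" "w < real m" for m i u w
  proof (rule dist_right_limit_le[OF lim])
    show "s m i \<le> u" "u < min (s m (Suc i)) (real m)" using that by auto
    show "0 \<le> u" using that s_nonneg[of m i] by simp
    show "dist (g v) (g w) \<le> 1 / real (Suc m)" if "s m i < v" "v < min (s m (Suc i)) (real m)" for v
      using s[of m] that \<open>s m i < w\<close> \<open>w < s m (Suc i)\<close> \<open>w < real m\<close> unfolding osc_partition_def by auto
  qed
  have "X \<in> ?K"
  proof (safe, unfold tame_def, intro conjI allI impI)
    fix m
    have "osc_partition (real m) (\<delta> m) (1 / real (Suc m)) (s m) (path X)"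
      unfolding osc_partition_def
    proof (intro conjI allI impI)
      fix i u v assume uv: "s m i < u \<and> u < s m (Suc i) \<and> u < real m \<and> s m i < v \<and> v < s m (Suc i) \<and> v < real m"
      show "dist (path X u) (path X v) \<le> 1 / real (Suc m)"
        using gX[of m i v] uv s_nonneg[of m i]
        by (intro dist_right_limit_le[OF lim, of u "s m i" "min (s m (Suc i)) (real m)"]) (auto simp: dist_commute)
    qed (use s[of m] in \<open>auto simp: osc_partition_def\<close>)
    then show "\<exists>t. osc_partition (real m) (\<delta> m) (1 / real (Suc m)) t (path X)" by blast
    fix u assume u: "0 \<le> u \<and> u < real m"
    have "norm (g v) \<le> R m" if v: "0 \<le> v" "v < real m" for v
    proof -
      have "\<forall>\<^sub>F x in F. norm (path x v) \<le> R m"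
        using FK by eventually_elim (use v in \<open>auto simp: tame_def\<close>)
      with tendsto_norm[OF g[OF v(1)]] show ?thesis using Fbot tendsto_upperbound by blast
    qed
    then show "norm (path X u) \<le> R m"
      using dist_right_limit_le[OF lim, of u u "real m" 0 "R m"] u by auto
  qed
  moreover have near: "\<forall>\<^sub>F y in F. y \<in> J1_nbhd X T \<epsilon>" if "T > 0" "\<epsilon> > 0" for T \<epsilon>
  proof -
    \<comment> \<open>A time change within \<epsilon> of the identity keeps times from
      \<open>{0..T}\<close> below \<open>m\<close>; the distance on a piece will be a sum of three
      terms of size \<open>1 / (m + 1)\<close>.\<close>
    obtain m where m: "T + \<epsilon> < real m" "3 / real (Suc m) < \<epsilon>"
    proof -
      obtain a where a: "T + \<epsilon> < real a" using reals_Archimedean2 by blast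
      obtain b where b: "1 / real (Suc b) < \<epsilon> / 3" using nat_approx_posE[of "\<epsilon> / 3"] \<open>\<epsilon> > 0\<close> by auto
      have "1 / real (Suc (max a b)) \<le> 1 / real (Suc b)" by (intro divide_left_mono) auto
      with b have "3 * (1 / real (Suc (max a b))) < \<epsilon>" by linarith
      with a show thesis by (intro that[of "max a b"]) simp_all
    qed
    define \<eta> where "\<eta> = 1 / real (Suc m)"
    obtain N where N: "real m < s m N" using osc_partition_unbounded[OF s \<delta>] by blast
    have sm: "s m i < s m (Suc i)" for i
      using s[of m] \<delta>[of m] unfolding osc_partition_def by (smt (verit))
    \<comment> \<open>One sample time strictly inside each limiting piece, cut at \<open>m\<close>.
      Finitely many samples reduce uniform closeness to pointwise convergence.\<close>
    define p where "p i = (s m i + min (s m (Suc i)) (real m)) / 2" for i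
    have p: "s m i < p i" "p i < s m (Suc i)" "p i < real m" if "s m i < real m" for i
      using that sm[of i] by (auto simp: p_def min_def field_simps)
    have "\<forall>\<^sub>F y in F. \<forall>i\<in>{..N}. \<bar>t m y i - s m i\<bar> < \<epsilon>"
      using tendstoD[OF ts \<open>\<epsilon> > 0\<close>, of m] by (intro eventually_ball_finite) (auto simp: dist_real_def)
    moreover have "\<forall>\<^sub>F y in F. \<forall>i\<in>{..<N}. s m i < real m \<longrightarrow>
      t m y i < p i \<and> p i < t m y (Suc i) \<and> dist (path y (p i)) (g (p i)) < \<eta>"
    proof (intro eventually_ball_finite ballI, goal_cases)
      case (2 i)
      show ?case
      proof (cases "s m i < real m")
        case True
        note p = p[OF this]
        have "0 \<le> p i" using p s_nonneg[of m i] by linarith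
        then have "\<forall>\<^sub>F y in F. dist (path y (p i)) (g (p i)) < \<eta>"
          by (intro tendstoD g) (auto simp: \<eta>_def)
        with order_tendstoD(2)[OF ts p(1)] order_tendstoD(1)[OF ts p(2)] show ?thesis
          by eventually_elim auto
      qed simp
    qed simp
    ultimately show ?thesis
      using t[of m]
    proof eventually_elim
      case (elim y)
      have tm: "t m y i < t m y (Suc i)" for i
        using elim(3) \<delta>[of m] unfolding osc_partition_def by (smt (verit))
      obtain \<tau> where \<tau>: "time_change \<tau>" "\<And>u. 0 \<le> u \<Longrightarrow> \<bar>\<tau> u - u\<bar> < \<epsilon>" "\<And>i. i \<le> N \<Longrightarrow> \<tau> (s m i) = t m y i"
        by (rule time_change_through[of "s m" "t m y" N \<epsilon>])
          (use s[of m] elim sm tm in \<open>auto simp: osc_partition_def\<close>)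
      have "dist (path y (\<tau> u)) (path X u) < \<epsilon>" if u: "u \<in> {0..T}" for u
      proof -
        obtain i where i: "s m i \<le> u" "u < s m (Suc i)"
          using osc_partition_piece[OF s \<delta>, of u] u by auto
        have um: "u < real m" "s m i < real m" using u i m \<open>\<epsilon> > 0\<close> by auto
        have "i < N"
        proof (rule ccontr)
          assume "\<not> i < N"
          then have "s m N \<le> s m i" using lift_Suc_mono_le[of "s m" N i, OF less_imp_le[OF sm]] by simp
          with N um show False by simp
        qed
        \<comment> \<open>Strict monotonicity carries the half-open piece of \<open>X\<close> into
          the half-open piece of \<open>y\<close>, so that partition points are matched exactly and
          no jump is compared with a continuity interval.\<close>
        have "\<tau> (s m i) \<le> \<tau> u" "\<tau> u < \<tau> (s m (Suc i))"
          using \<tau>(1) i u s_nonneg[of m i] s_nonneg[of m "Suc i"] unfolding time_change_def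
          by (auto intro!: strict_mono_on_leD[of "{0..}" \<tau> "s m i" u] strict_mono_onD[of "{0..}" \<tau> u])
        then have \<tau>u: "t m y i \<le> \<tau> u" "\<tau> u < t m y (Suc i)" using \<tau>(3) \<open>i < N\<close> by auto
        have \<tau>u': "\<tau> u < real m" using \<tau>(2)[of u] u m by auto
        have \<tau>0: "0 \<le> \<tau> u" using \<tau>(1) u by (auto simp: time_change_def)
        note p = p[OF um(2)]
        have pi: "t m y i < p i" "p i < t m y (Suc i)" "dist (path y (p i)) (g (p i)) < \<eta>"
          using elim(2) \<open>i < N\<close> um by auto
        have "dist (path y (\<tau> u)) (path y (p i)) \<le> \<eta>"
        proof (rule dist_right_limit_le)
          show "(path y \<longlongrightarrow> path y (\<tau> u)) (at_right (\<tau> u))"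
            using cadlag_path[of y] \<tau>0 by (auto simp: cadlag_def)
          show "t m y i \<le> \<tau> u" "\<tau> u < min (t m y (Suc i)) (real m)" using \<tau>u \<tau>u' by auto
          show "dist (path y v) (path y (p i)) \<le> \<eta>" if "t m y i < v" "v < min (t m y (Suc i)) (real m)" for v
            using elim(3) that pi p unfolding osc_partition_def \<eta>_def by auto
        qed
        moreover have "dist (path X u) (g (p i)) \<le> \<eta>"
          unfolding \<eta>_def using i um p by (intro gX)
        moreover have "dist (path y (\<tau> u)) (path X u) \<le>
          dist (path y (\<tau> u)) (path y (p i)) + dist (path y (p i)) (g (p i)) + dist (path X u) (g (p i))"
          by (smt (verit) dist_commute dist_triangle)
        moreover have "3 * \<eta> < \<epsilon>" using m by (simp add: \<eta>_def)
        ultimately show ?thesis using pi(3) by linarith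
      qed
      with \<tau> show ?case unfolding J1_nbhd_def by blast
    qed
  qed
  \<comment> \<open>By definition an open set around \<open>X\<close> contains some
    \<open>J1_nbhd X T \<epsilon>\<close>, so it is enough that the ultrafilter eventually enters
    each of these.\<close>
  have "F \<le> nhds X"
    unfolding le_filter_def eventually_nhds
  proof (intro allI impI, elim exE conjE)
    fix P U assume "open U" "X \<in> U" "\<forall>x\<in>U. P x"
    then obtain T \<epsilon> where "T > 0" "\<epsilon> > 0" "J1_nbhd X T \<epsilon> \<subseteq> U" unfolding open_skorokhod_def by blast
    with near[OF this(1,2)] \<open>\<forall>x\<in>U. P x\<close> show "eventually P F"
      by (elim eventually_mono) blast
  qed
  then have "F \<le> inf (nhds X) G" using F by simp
  with Fbot have "inf (nhds X) G \<noteq> bot" by (metis bot.extremum_uniqueI)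
  ultimately show "\<exists>x\<in>?K. inf (nhds x) G \<noteq> bot" by blast
qed

section \<open>Partitions of a single cadlag path\<close>

lemma cadlag_regulated:
  assumes "cadlag x"
  shows "regulated x"
  unfolding regulated_def
proof (intro allI impI conjI)
  fix e u :: real assume e: "e > 0"
  have close: "dist (x v) (x w) \<le> e" if "dist (x v) l < e / 2" "dist (x w) l < e / 2" for v w l
    using dist_triangle3[of "x v" "x w" l] that by (simp add: dist_commute)
  { assume "u \<ge> 0"
    then have "(x \<longlongrightarrow> x u) (at_right u)" using assms by (auto simp: cadlag_def)
    then have "\<forall>\<^sub>F v in at_right u. dist (x v) (x u) < e / 2" using e by (intro tendstoD) auto
    then show "\<exists>q>u. \<forall>v w. u < v \<and> v < q \<and> u < w \<and> w < q \<longrightarrow> dist (x v) (x w) \<le> e"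
      using close[of _ "x u"] unfolding eventually_at_right_field by metis }
  { assume u: "u > 0"
    then obtain l where "(x \<longlongrightarrow> l) (at_left u)" using assms by (auto simp: cadlag_def)
    then have "\<forall>\<^sub>F v in at_left u. dist (x v) l < e / 2" using e by (intro tendstoD) auto
    then obtain b where "b < u" "\<And>v. b < v \<Longrightarrow> v < u \<Longrightarrow> dist (x v) l < e / 2"
      unfolding eventually_at_left_field by metis
    then show "\<exists>p\<ge>0. p < u \<and> (\<forall>v w. p < v \<and> v < u \<and> p < w \<and> w < u \<longrightarrow> dist (x v) (x w) \<le> e)"
      using close[of _ l] u by (intro exI[of _ "max b 0"]) auto }
qed

lemma regulated_local:
  assumes "regulated x" "e > 0" "0 \<le> u"
  obtains d where "d > 0"
    "\<And>v w. u < v \<Longrightarrow> v < u + d \<Longrightarrow> u < w \<Longrightarrow> w < u + d \<Longrightarrow> dist (x v) (x w) \<le> e"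
    "\<And>v w. 0 \<le> v \<Longrightarrow> 0 \<le> w \<Longrightarrow> u - d < v \<Longrightarrow> v < u \<Longrightarrow> u - d < w \<Longrightarrow> w < u \<Longrightarrow> dist (x v) (x w) \<le> e"
proof -
  obtain q where q: "q > u" "\<And>v w. u < v \<Longrightarrow> v < q \<Longrightarrow> u < w \<Longrightarrow> w < q \<Longrightarrow> dist (x v) (x w) \<le> e"
    using assms unfolding regulated_def by meson
  show ?thesis
  proof (cases "u = 0")
    case True
    with q show ?thesis by (intro that[of "q - u"]) auto
  next
    case False
    then obtain p where p: "p < u" "\<And>v w. p < v \<Longrightarrow> v < u \<Longrightarrow> p < w \<Longrightarrow> w < u \<Longrightarrow> dist (x v) (x w) \<le> e"
      using assms unfolding regulated_def by (metis order_le_less)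
    with q show ?thesis by (intro that[of "min (q - u) (u - p)"]) auto
  qed
qed

text \<open>Near \<open>u\<close> the path is within 1 of a sample value on either side, which
  together with the value at \<open>u\<close> gives a local bound; Bolzano's bisection principle
  makes it global.\<close>

lemma regulated_bounded:
  fixes x :: "real \<Rightarrow> 'a::real_normed_vector"
  assumes "regulated x" "0 \<le> T"
  shows "\<exists>R. \<forall>u\<in>{0..T}. norm (x u) \<le> R"
proof -
  have "0 \<le> (0::real) \<longrightarrow> (\<exists>R. \<forall>u\<in>{0..T}. norm (x u) \<le> R)"
  proof (rule Bolzano[OF \<open>0 \<le> T\<close>, where P = "\<lambda>a b. 0 \<le> a \<longrightarrow> (\<exists>R. \<forall>u\<in>{a..b}. norm (x u) \<le> R)"], goal_cases)
    case trans: (1 a b c)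
    show ?case
    proof
      assume "0 \<le> a"
      with trans obtain R S where "\<forall>u\<in>{a..b}. norm (x u) \<le> R" "\<forall>u\<in>{b..c}. norm (x u) \<le> S" by auto
      then show "\<exists>R. \<forall>u\<in>{a..c}. norm (x u) \<le> R"
        by (intro exI[of _ "max R S"]) (auto simp: le_max_iff_disj)
    qed
  next
    case local: (2 u)
    obtain d where d: "d > 0"
      "\<And>v w. u < v \<Longrightarrow> v < u + d \<Longrightarrow> u < w \<Longrightarrow> w < u + d \<Longrightarrow> dist (x v) (x w) \<le> 1"
      "\<And>v w. 0 \<le> v \<Longrightarrow> 0 \<le> w \<Longrightarrow> u - d < v \<Longrightarrow> v < u \<Longrightarrow> u - d < w \<Longrightarrow> w < u \<Longrightarrow> dist (x v) (x w) \<le> 1"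
      using regulated_local[OF assms(1) zero_less_one, of u] local by blast
    \<comment> \<open>Keeps the left sample time nonnegative and within \<open>d\<close> of
      \<open>u\<close>. For \<open>u = 0\<close> there are no admissible times to the left.\<close>
    define e where "e = min (d / 2) (u / 2)"
    define R where "R = norm (x u) + norm (x (u + d / 2)) + norm (x (u - e)) + 1"
    have near: "norm (x v) \<le> norm (x w) + 1" if "dist (x v) (x w) \<le> 1" for v w
      using that norm_triangle_ineq2[of "x v" "x w"] by (simp add: dist_norm)
    have "norm (x v) \<le> R" if v: "0 \<le> v" "u - d < v" "v < u + d" for v
    proof -
      consider "v = u" | "u < v" | "v < u" by linarith
      then show ?thesis
      proof cases
        case 2
        then have "norm (x v) \<le> norm (x (u + d / 2)) + 1"
          using near[OF d(2)[of v "u + d / 2"]] d(1) v by simp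
        then show ?thesis
          using norm_ge_zero[of "x u"] norm_ge_zero[of "x (u - e)"] unfolding R_def by linarith
      next
        case 3
        then have "norm (x v) \<le> norm (x (u - e)) + 1"
          using near[OF d(3)[of v "u - e"]] d(1) v by (simp add: e_def min_def split: if_splits)
        then show ?thesis
          using norm_ge_zero[of "x u"] norm_ge_zero[of "x (u + d / 2)"] unfolding R_def by linarith
      qed (simp add: R_def)
    qed
    then show ?case using d(1) by (intro exI[of _ d]) (auto intro!: exI[of _ R])
  qed
  then show ?thesis by simp
qed

text \<open>\<open>r\<close> relates the ends of an open interval with small oscillation. Bisection
  connects 0 to \<open>T\<close> by a finite chain of such intervals, and induction along the chain
  takes \<delta> as a lower bound for their lengths.\<close>

lemma regulated_osc_partition:
  assumes "regulated x" "0 \<le> T" "\<eta> > 0"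
  shows "\<exists>\<delta>>0. \<exists>t. osc_partition T \<delta> \<eta> t x"
proof -
  define r where "r p q \<longleftrightarrow> p < q \<and> (\<forall>v w. p < v \<and> v < q \<and> p < w \<and> w < q \<longrightarrow> dist (x v) (x w) \<le> \<eta>)" for p q
  have "0 \<le> (0::real) \<longrightarrow> r\<^sup>*\<^sup>* 0 T"
  proof (rule Bolzano[OF \<open>0 \<le> T\<close>, where P = "\<lambda>a b. 0 \<le> a \<longrightarrow> r\<^sup>*\<^sup>* a b"], goal_cases)
    case (1 a b c)
    then show ?case by (meson rtranclp_trans order_trans)
  next
    case local: (2 u)
    obtain d where d: "d > 0"
      "\<And>v w. u < v \<Longrightarrow> v < u + d \<Longrightarrow> u < w \<Longrightarrow> w < u + d \<Longrightarrow> dist (x v) (x w) \<le> \<eta>"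
      "\<And>v w. 0 \<le> v \<Longrightarrow> 0 \<le> w \<Longrightarrow> u - d < v \<Longrightarrow> v < u \<Longrightarrow> u - d < w \<Longrightarrow> w < u \<Longrightarrow> dist (x v) (x w) \<le> \<eta>"
      using regulated_local[OF assms(1) \<open>\<eta> > 0\<close>, of u] local by blast
    have "r\<^sup>*\<^sup>* a b" if "0 \<le> a" "a \<le> u" "u \<le> b" "b - a < d" for a b
    proof -
      have "r\<^sup>*\<^sup>* a u" using that d by (cases "a = u") (auto simp: r_def intro!: r_into_rtranclp)
      moreover have "r\<^sup>*\<^sup>* u b" using that d by (cases "b = u") (auto simp: r_def intro!: r_into_rtranclp)
      ultimately show ?thesis by simp
    qed
    with d(1) show ?case by blast
  qed
  then have "r\<^sup>*\<^sup>* 0 T" by simp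
  moreover have "\<exists>\<delta>>0. \<exists>t. t 0 = a \<and> (\<forall>i. t i + \<delta> \<le> t (Suc i)) \<and>
     (\<forall>i u v. t i < u \<and> u < t (Suc i) \<and> u < T \<and> t i < v \<and> v < t (Suc i) \<and> v < T \<longrightarrow>
        dist (x u) (x v) \<le> \<eta>)" if "r\<^sup>*\<^sup>* a T" for a
    using that
  proof (induction rule: converse_rtranclp_induct)
    case base
    \<comment> \<open>From \<open>T\<close> on the partition continues with unit steps, whose pieces
      contain no time below \<open>T\<close>.\<close>
    have "\<not> (T + real i < u \<and> u < T)" for i u by (smt (verit) of_nat_0_le_iff)
    then show ?case
      by - (rule exI[of _ 1], rule conjI, simp, rule exI[of _ "\<lambda>i. T + real i"], simp)
  next
    case (step a b)
    then obtain \<delta> t where "\<delta> > 0" and t: "t 0 = b" "\<And>i. t i + \<delta> \<le> t (Suc i)"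
      "\<And>i u v. t i < u \<Longrightarrow> u < t (Suc i) \<Longrightarrow> u < T \<Longrightarrow> t i < v \<Longrightarrow> v < t (Suc i) \<Longrightarrow> v < T \<Longrightarrow>
        dist (x u) (x v) \<le> \<eta>" by blast
    have r: "a < b" "\<And>u v. a < u \<Longrightarrow> u < b \<Longrightarrow> a < v \<Longrightarrow> v < b \<Longrightarrow> dist (x u) (x v) \<le> \<eta>"
      using step(1) by (auto simp: r_def)
    let ?t = "case_nat a t"
    have "?t i + min \<delta> (b - a) \<le> ?t (Suc i)" for i
      using t(1) t(2)[of "i - 1"] by (cases i) auto
    moreover have "dist (x u) (x v) \<le> \<eta>"
      if "?t i < u" "u < ?t (Suc i)" "u < T" "?t i < v" "v < ?t (Suc i)" "v < T" for i u v
      using that t(1) t(3) r by (cases i) auto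
    ultimately show ?case
      using r(1) \<open>\<delta> > 0\<close> by (intro exI[of _ "min \<delta> (b - a)"] conjI exI[of _ ?t]) auto
  qed
  ultimately show ?thesis unfolding osc_partition_def by blast
qed

text \<open>Merges the bound \<open>R\<close> and the piece length \<delta> into one index
  \<open>j\<close>, along which the tame events increase.\<close>

lemma eventually_tame:
  fixes x :: "real \<Rightarrow> 'a::real_normed_vector"
  assumes "0 < \<delta>"
    shows "\<forall>\<^sub>F j in sequentially. \<forall>y :: real \<Rightarrow> 'a. tame T R \<delta> \<eta> y \<longrightarrow> tame T (real j) (1 / real (Suc j)) \<eta> y"
proof -
  have "\<forall>\<^sub>F j in sequentially. R \<le> real j"
    by (rule eventually_sequentiallyI[of "nat \<lceil>R\<rceil>"]) linarith
  moreover have "\<forall>\<^sub>F j in sequentially. 1 / real (Suc j) < \<delta>"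
    using order_tendstoD(2)[OF LIMSEQ_inverse_real_of_nat[unfolded inverse_eq_divide] assms] .
  ultimately show ?thesis by eventually_elim (auto intro: tame_mono)
qed

section \<open>A tightness criterion for laws of cadlag paths\<close>

text \<open>The compact set imposes tameness at countably many scales, each with an index
  \<open>j\<close> that is uniform in \<open>n\<close>. For a fixed \<open>n\<close> the tame events
  exhaust the whole space, which handles the \<open>n\<close> below \<open>N\<close>.\<close>

lemma tight_family_skorokhod:
  fixes M :: "nat \<Rightarrow> 'w measure" and X :: "nat \<Rightarrow> 'w \<Rightarrow> 'a::euclidean_space skorokhod"
  assumes prob: "\<And>n. n \<ge> 1 \<Longrightarrow> prob_space (M n)"
    and X: "\<And>n. n \<ge> 1 \<Longrightarrow> X n \<in> M n \<rightarrow>\<^sub>M borel"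
    and tame: "\<And>T \<eta> \<epsilon>. T \<ge> 0 \<Longrightarrow> \<eta> > 0 \<Longrightarrow> \<epsilon> > 0 \<Longrightarrow> \<exists>R \<delta> N. \<delta> > 0 \<and>
      (\<forall>n\<ge>max 1 N. 1 - \<epsilon> \<le> measure (M n) {\<omega>\<in>space (M n). tame T R \<delta> \<eta> (path (X n \<omega>))})"
  shows "tight_family {1..} (\<lambda>n. distr (M n) borel (X n))"
proof -
  define A where "A n T R \<delta> \<eta> = {\<omega>\<in>space (M n). tame T R \<delta> \<eta> (path (X n \<omega>))}" for n T R \<delta> \<eta>
  have A: "A n T R \<delta> \<eta> \<in> sets (M n)" if "n \<ge> 1" "0 \<le> \<delta>" "0 \<le> T" for n T R \<delta> \<eta>
    using measurable_sets[OF X borel_closed[OF closed_tame[of \<delta> T R \<eta>]]] that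
    by (simp add: A_def vimage_def Int_def conj_commute)
  have unif: "\<exists>j. \<forall>n\<ge>1. 1 - \<epsilon> \<le> measure (M n) (A n T (real j) (1 / real (Suc j)) \<eta>)"
    if pos: "T \<ge> 0" "\<eta> > 0" "\<epsilon> > 0" for T \<eta> \<epsilon>
  proof -
    from tame[OF pos] obtain R \<delta> N where "\<delta> > 0"
      and N: "\<And>n. n \<ge> max 1 N \<Longrightarrow> 1 - \<epsilon> \<le> measure (M n) (A n T R \<delta> \<eta>)"
      unfolding A_def by blast
    have "\<forall>\<^sub>F j in sequentially. 1 - \<epsilon> < measure (M n) (A n T (real j) (1 / real (Suc j)) \<eta>)"
      if n: "n \<ge> 1" for n
    proof -
      interpret prob_space "M n" using prob n .
      let ?B = "\<lambda>j. A n T (real j) (1 / real (Suc j)) \<eta>"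
      have "range ?B \<subseteq> events" using A[OF n] pos by auto
      moreover have "incseq ?B"
      proof (rule monoI)
        fix i j :: nat assume "i \<le> j"
        then have "1 / real (Suc j) \<le> 1 / real (Suc i)" by (intro divide_left_mono) auto
        with \<open>i \<le> j\<close> show "?B i \<subseteq> ?B j" by (auto simp: A_def intro: tame_mono)
      qed
      ultimately have "(\<lambda>j. prob (?B j)) \<longlonglongrightarrow> prob (\<Union>j. ?B j)" by (rule finite_Lim_measure_incseq)
      also have "(\<Union>j. ?B j) = space (M n)"
      proof -
        have "\<exists>j. tame T (real j) (1 / real (Suc j)) \<eta> (path (X n \<omega>))" for \<omega>
        proof -
          note reg = cadlag_regulated[OF cadlag_path[of "X n \<omega>"]]
          obtain R \<delta> where "\<delta> > 0" "tame T R \<delta> \<eta> (path (X n \<omega>))"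
            using regulated_bounded[OF reg pos(1)] regulated_osc_partition[OF reg pos(1,2)]
            unfolding tame_def by (metis atLeastAtMost_iff less_imp_le)
          with eventually_tame[of \<delta> T R \<eta>] show ?thesis
            by (metis (no_types, lifting) eventually_sequentially order_refl)
        qed
        then show ?thesis by (auto simp: A_def)
      qed
      finally show ?thesis using prob_space pos(3) by (intro order_tendstoD(1)) auto
    qed
    then have "\<forall>\<^sub>F j in sequentially. \<forall>n\<in>{1..<N}. 1 - \<epsilon> < measure (M n) (A n T (real j) (1 / real (Suc j)) \<eta>)"
      by (intro eventually_ball_finite) auto
    \<comment> \<open>A single \<open>j\<close> that is good for each of the finitely many
      \<open>n < N\<close> and that also dominates \<open>R\<close> and \<delta>, hence is good for
      all other \<open>n\<close>.\<close>
    from eventually_conj[OF this eventually_tame[OF \<open>\<delta> > 0\<close>, of T R \<eta>, where 'a = 'a]]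
    obtain j where j: "\<forall>n\<in>{1..<N}. 1 - \<epsilon> < measure (M n) (A n T (real j) (1 / real (Suc j)) \<eta>)"
      "\<And>y :: real \<Rightarrow> 'a. tame T R \<delta> \<eta> y \<Longrightarrow> tame T (real j) (1 / real (Suc j)) \<eta> y"
      unfolding eventually_sequentially by blast
    have "1 - \<epsilon> \<le> measure (M n) (A n T (real j) (1 / real (Suc j)) \<eta>)" if n: "n \<ge> 1" for n
    proof (cases "n < N")
      case True
      with j(1) n show ?thesis by (simp add: less_imp_le)
    next
      case False
      interpret prob_space "M n" using prob n .
      have "1 - \<epsilon> \<le> measure (M n) (A n T R \<delta> \<eta>)" using N n False by simp
      also have "\<dots> \<le> measure (M n) (A n T (real j) (1 / real (Suc j)) \<eta>)"
        using n pos A[OF n] j(2) by (intro finite_measure_mono) (auto simp: A_def)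
      finally show ?thesis .
    qed
    then show ?thesis by blast
  qed
  show ?thesis
    unfolding tight_family_def
  proof (intro allI impI)
    fix \<epsilon> :: real assume "\<epsilon> > 0"
    \<comment> \<open>Scale \<open>m\<close> has horizon \<open>m\<close>, accuracy
      \<open>1 / (m + 1)\<close> and failure budget \<open>\<epsilon> / 2 ^ (m + 1)\<close>; the
      budgets sum to \<epsilon>.\<close>
    have "\<forall>m. \<exists>j. \<forall>n\<ge>1. 1 - \<epsilon> * (1 / 2) ^ Suc m \<le> measure (M n) (A n (real m) (real j) (1 / real (Suc j)) (1 / real (Suc m)))"
      using \<open>\<epsilon> > 0\<close> by (intro allI unif) auto
    from choice[OF this] obtain j where j: "\<And>m n. n \<ge> 1 \<Longrightarrow> 1 - \<epsilon> * (1 / 2) ^ Suc m \<le>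
      measure (M n) (A n (real m) (real (j m)) (1 / real (Suc (j m))) (1 / real (Suc m)))" by blast
    define K where "K = {x :: 'a skorokhod. \<forall>m. tame (real m) (real (j m)) (1 / real (Suc (j m))) (1 / real (Suc m)) (path x)}"
    have "compact K" unfolding K_def by (rule compact_tame) simp
    moreover have "closed K" unfolding K_def by (intro closed_Collect_all closed_tame) auto
    then have KM: "K \<in> sets borel" by (rule borel_closed)
    have "1 - \<epsilon> \<le> measure (distr (M n) borel (X n)) K" if n: "n \<ge> 1" for n
    proof -
      interpret prob_space "M n" using prob n .
      let ?B = "\<lambda>m. A n (real m) (real (j m)) (1 / real (Suc (j m))) (1 / real (Suc m))"
      have B: "?B m \<in> events" for m using A[OF n] by simp
      have sums: "(\<lambda>m. \<epsilon> * (1 / 2) ^ Suc m) sums \<epsilon>" using sums_mult[OF power_half_series, of \<epsilon>] by simp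
      have le: "prob (space (M n) - ?B m) \<le> \<epsilon> * (1 / 2) ^ Suc m" for m
        using j[OF n, of m] prob_compl[OF B[of m]] by simp
      have summ: "summable (\<lambda>m. prob (space (M n) - ?B m))"
        by (rule summable_comparison_test'[OF sums_summable[OF sums]]) (use le in simp)
      have "prob (\<Union>m. space (M n) - ?B m) \<le> (\<Sum>m. prob (space (M n) - ?B m))"
        using B summ by (intro finite_measure_subadditive_countably) auto
      also have "\<dots> \<le> \<epsilon>"
        using suminf_le[OF le summ sums_summable[OF sums]] sums_unique[OF sums] by simp
      also have "(\<Union>m. space (M n) - ?B m) = space (M n) - (X n -` K \<inter> space (M n))"
        by (auto simp: K_def A_def)
      also have "prob \<dots> = 1 - prob (X n -` K \<inter> space (M n))"
        using measurable_sets[OF X[OF n] KM] by (rule prob_compl)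
      also have "prob (X n -` K \<inter> space (M n)) = measure (distr (M n) borel (X n)) K"
        using X[OF n] KM by (simp add: measure_distr)
      finally show ?thesis by simp
    qed
    ultimately show "\<exists>K. compact K \<and> (\<forall>n\<in>{1..}. 1 - \<epsilon> \<le> measure (distr (M n) borel (X n)) K)" by auto
  qed
qed

subsection \<open>Exit probabilities of Markov chains in discrete time\<close>

text \<open>The list holds the positions after steps 1 to \<open>k\<close>; the starting point is
  kept outside it, because it serves as the first anchor of the greedy partition.\<close>

fun walk :: "('s \<Rightarrow> 's pmf) \<Rightarrow> nat \<Rightarrow> 's \<Rightarrow> 's list pmf" where
  "walk \<kappa> 0 a = return_pmf []"
| "walk \<kappa> (Suc k) a = bind_pmf (\<kappa> a) (\<lambda>b. map_pmf ((#) b) (walk \<kappa> k b))"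

lemma measure_bind_pmf:
  "measure (measure_pmf (bind_pmf p q)) E = (\<integral>x. measure (measure_pmf (q x)) E \<partial>measure_pmf p)"
proof -
  have "ennreal (measure (measure_pmf (bind_pmf p q)) E) = (\<integral>\<^sup>+x. ennreal (measure (measure_pmf (q x)) E) \<partial>measure_pmf p)"
    by (simp add: measure_pmf.emeasure_eq_measure[symmetric])
  also have "\<dots> = ennreal (\<integral>x. measure (measure_pmf (q x)) E \<partial>measure_pmf p)"
    by (intro nn_integral_eq_integral measure_pmf.integrable_const_bound[of _ 1]) auto
  finally show ?thesis by (simp add: integral_nonneg_AE)
qed

lemma measure_walk_Suc:
  "measure (walk \<kappa> (Suc k) a) E = (\<integral>b. measure (walk \<kappa> k b) ((#) b -` E) \<partial>measure_pmf (\<kappa> a))"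
  by (simp add: measure_bind_pmf)

lemma set_walk:
  assumes "\<And>a. a \<in> S \<Longrightarrow> set_pmf (\<kappa> a) \<subseteq> S" "a \<in> S"
  shows "set_pmf (walk \<kappa> k a) \<subseteq> {xs. set xs \<subseteq> S \<and> length xs = k}"
  using assms(2)
proof (induction k arbitrary: a)
  case (Suc k)
  have "set_pmf (walk \<kappa> k b) \<subseteq> {xs. set xs \<subseteq> S \<and> length xs = k}" if "b \<in> set_pmf (\<kappa> a)" for b
    using assms(1)[OF Suc.prems] that by (intro Suc.IH) auto
  with assms(1)[OF Suc.prems] show ?case by (auto simp: subset_eq)
qed simp

text \<open>With \<open>a\<close> put back in position 0, this is the product that occurs in the
  finite-dimensional distributions of \<open>markov_chain\<close>.\<close>

lemma pmf_walk:
  "length xs = k \<Longrightarrow> pmf (walk \<kappa> k a) xs = (\<Prod>j<k. pmf (\<kappa> ((a # xs) ! j)) ((a # xs) ! Suc j))"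
proof (induction xs arbitrary: a k)
  case (Cons b xs)
  then obtain k' where k: "k = Suc k'" "length xs = k'" by auto
  have *: "(#) b' -` {b # xs} = (if b' = b then {xs} else {})" for b' by auto
  have "pmf (walk \<kappa> (Suc k') a) (b # xs) = (\<integral>b'. measure (walk \<kappa> k' b') ((#) b' -` {b # xs}) \<partial>measure_pmf (\<kappa> a))"
    by (subst pmf.rep_eq, rule measure_walk_Suc)
  also have "\<dots> = (\<integral>b'. indicator {b} b' * pmf (walk \<kappa> k' b) xs \<partial>measure_pmf (\<kappa> a))"
    by (intro Bochner_Integration.integral_cong) (auto simp: * pmf.rep_eq)
  also have "\<dots> = pmf (\<kappa> a) b * pmf (walk \<kappa> k' b) xs" by (simp add: pmf.rep_eq)
  finally show ?case using Cons.IH[OF k(2), of b] unfolding k(1) prod.lessThan_Suc_shift by simp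
qed simp

text \<open>The greedy partition, run from an anchor \<open>c\<close> set \<open>l\<close> steps ago, starts a new piece less than \<open>m\<close>
  steps after the previous one.\<close>

fun short_gap :: "('s \<Rightarrow> 's \<Rightarrow> bool) \<Rightarrow> nat \<Rightarrow> 's \<Rightarrow> nat \<Rightarrow> 's list \<Rightarrow> bool" where
  "short_gap far m c l [] \<longleftrightarrow> False"
| "short_gap far m c l (b # bs) \<longleftrightarrow>
     (if far c b then Suc l < m \<or> short_gap far m b 0 bs else short_gap far m c (Suc l) bs)"

text \<open>The one-step form of the supermartingale property: \<open>f c\<close> gains at most
  \<open>q\<close> per step on average, vanishes at the anchor \<open>c\<close>, and is at least 1
  at states far from it. For a grid of mesh \<open>h\<close> and a generator bound \<open>K\<close>,
  \<open>q\<close> is \<open>K * h\<close>.\<close>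

locale test_functions =
  fixes S :: "'s set" and \<kappa> :: "'s \<Rightarrow> 's pmf" and f :: "'s \<Rightarrow> 's \<Rightarrow> real"
    and far :: "'s \<Rightarrow> 's \<Rightarrow> bool" and B q :: real
  assumes closed: "\<And>a. a \<in> S \<Longrightarrow> set_pmf (\<kappa> a) \<subseteq> S"
    and nonneg: "\<And>c a. 0 \<le> f c a" and bounded: "\<And>c a. f c a \<le> B" and self: "\<And>a. f a a = 0"
    and far: "\<And>c a. far c a \<Longrightarrow> 1 \<le> f c a"
    and q: "0 \<le> q"
    and drift: "\<And>a c. a \<in> S \<Longrightarrow> c \<in> S \<Longrightarrow> measure_pmf.expectation (\<kappa> a) (f c) \<le> f c a + q"
begin

text \<open>First-step analysis: a bound that is affine in \<open>f c\<close> after the first step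
  survives averaging over that step at the price \<open>w * q\<close>.\<close>

lemma measure_walk_Suc_le:
  assumes "a \<in> S" "c \<in> S" "0 \<le> w"
    and le: "\<And>b. b \<in> S \<Longrightarrow> measure (walk \<kappa> k b) ((#) b -` E) \<le> c0 + w * f c b"
  shows "measure (walk \<kappa> (Suc k) a) E \<le> c0 + w * (f c a + q)"
proof -
  have int: "integrable (measure_pmf (\<kappa> a)) (f c)"
    using nonneg bounded by (intro measure_pmf.integrable_const_bound[of _ B]) auto
  have "measure (walk \<kappa> (Suc k) a) E \<le> (\<integral>b. c0 + w * f c b \<partial>measure_pmf (\<kappa> a))"
    unfolding measure_walk_Suc
  proof (rule integral_mono_AE)
    show "AE b in measure_pmf (\<kappa> a). measure (walk \<kappa> k b) ((#) b -` E) \<le> c0 + w * f c b"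
      using le closed[OF \<open>a \<in> S\<close>] by (auto simp: AE_measure_pmf_iff)
    show "integrable (measure_pmf (\<kappa> a)) (\<lambda>b. measure (walk \<kappa> k b) ((#) b -` E))"
      by (intro measure_pmf.integrable_const_bound[of _ 1]) auto
  qed (use int in simp)
  also have "\<dots> = c0 + w * measure_pmf.expectation (\<kappa> a) (f c)" using int by simp
  also have "\<dots> \<le> c0 + w * (f c a + q)" using assms drift by (intro add_left_mono mult_left_mono) auto
  finally show ?thesis .
qed

text \<open>Induction with the supermartingale as bound: once a far state is hit, the right-hand
  side is at least 1 and the estimate is trivial.\<close>

lemma exit_probability:
  assumes "a \<in> S" "c \<in> S"
  shows "measure (walk \<kappa> k a) {xs. \<exists>b\<in>set xs. far c b} \<le> f c a + real k * q"
  using assms(1)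
proof (induction k arbitrary: a)
  case (Suc k)
  have "measure (walk \<kappa> (Suc k) a) {xs. \<exists>b\<in>set xs. far c b} \<le> real k * q + 1 * (f c a + q)"
  proof (rule measure_walk_Suc_le)
    fix b assume "b \<in> S"
    show "measure (walk \<kappa> k b) ((#) b -` {xs. \<exists>b\<in>set xs. far c b}) \<le> real k * q + 1 * f c b"
    proof (cases "far c b")
      case True
      have "measure (walk \<kappa> k b) ((#) b -` {xs. \<exists>b\<in>set xs. far c b}) \<le> 1" by simp
      moreover have "0 \<le> real k * q" using q by simp
      ultimately show ?thesis using far[OF True] by linarith
    next
      case False
      with Suc.IH[OF \<open>b \<in> S\<close>] show ?thesis by (simp add: vimage_def)
    qed
  qed (use Suc assms in auto)
  then show ?case by (simp add: algebra_simps)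
qed (use nonneg in simp)

text \<open>The right-hand side is a supermartingale: the first term pays for the future pieces, the second
  one for the current piece.\<close>

lemma short_gap_bound:
  assumes "a \<in> S" "c \<in> S" and D: "D = q * real m" "D \<le> 1"
  shows "measure (walk \<kappa> k a) {xs. short_gap far m c l xs} \<le>
    q * D * real k + (if Suc l < m then f c a + q * (real m - real l) else D * f c a)"
  using assms(1,2)
proof (induction k arbitrary: a c l)
  case 0
  then show ?case using nonneg q D by auto
next
  case (Suc k)
  have D0: "0 \<le> D" using D q by simp
  \<comment> \<open>At a restart the anchor is the current state, where the test function vanishes;
    only the budget \<open>q * real m = D\<close> of the new piece remains.\<close>
  have restart: "measure (walk \<kappa> k b) {xs. short_gap far m b 0 xs} \<le> q * D * real k + D" if "b \<in> S" for b
    using Suc.IH[OF that that, of 0] D D0 by (auto simp: self split: if_splits)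
  have IH: "measure (walk \<kappa> k b) {xs. short_gap far m c (Suc l) xs} \<le>
    q * D * real k + (if Suc (Suc l) < m then f c b + q * (real m - real (Suc l)) else D * f c b)" if "b \<in> S" for b
    using Suc.IH[OF that Suc.prems(2)] .
  have Df: "D * f c b \<le> f c b" for b using mult_right_mono[OF D(2) nonneg[of c b]] by simp
  have qk: "0 \<le> q * D * real k" using q D0 by simp
  show ?case
  proof (cases "Suc l < m")
    case True
    \<comment> \<open>A far state reached now is the bad event itself, and then \<open>f c b\<close>
      alone is at least 1. When the piece comes of age, the weight of \<open>f c\<close> drops from
      1 to \<open>D \<le> 1\<close>.\<close>
    have ql: "0 \<le> q * (real m - real (Suc l))" using True q by simp
    have "measure (walk \<kappa> (Suc k) a) {xs. short_gap far m c l xs} \<le>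
      (q * D * real k + q * (real m - real (Suc l))) + 1 * (f c a + q)"
    proof (rule measure_walk_Suc_le)
      fix b assume b: "b \<in> S"
      show "measure (walk \<kappa> k b) ((#) b -` {xs. short_gap far m c l xs}) \<le>
        (q * D * real k + q * (real m - real (Suc l))) + 1 * f c b"
      proof (cases "far c b")
        case True
        have "measure (walk \<kappa> k b) ((#) b -` {xs. short_gap far m c l xs}) \<le> 1" by simp
        with far[OF True] qk ql show ?thesis by linarith
      next
        case False
        then show ?thesis using IH[OF b] Df[of b] ql by (auto simp: vimage_def split: if_splits)
      qed
    qed (use Suc in auto)
    also have "\<dots> \<le> q * D * real (Suc k) + (f c a + q * (real m - real l))"
      using q D0 by (simp add: algebra_simps)
    finally show ?thesis using True by simp
  next
    case False
    \<comment> \<open>The piece is long enough, so a far state only starts a new piece of cost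
      \<open>D\<close>, which \<open>D * f c b \<ge> D\<close> pays. The drift of
      \<open>D * f c\<close> is \<open>D * q\<close> per step and produces the term linear in
      \<open>k\<close>.\<close>
    have "measure (walk \<kappa> (Suc k) a) {xs. short_gap far m c l xs} \<le>
      q * D * real k + D * (f c a + q)"
    proof (rule measure_walk_Suc_le)
      fix b assume b: "b \<in> S"
      show "measure (walk \<kappa> k b) ((#) b -` {xs. short_gap far m c l xs}) \<le> q * D * real k + D * f c b"
      proof (cases "far c b")
        case True
        then have "(#) b -` {xs. short_gap far m c l xs} = {xs. short_gap far m b 0 xs}"
          using \<open>\<not> Suc l < m\<close> by auto
        with restart[OF b] mult_left_mono[OF far[OF True] D0] show ?thesis by simp
      next
        case False
        then show ?thesis using IH[OF b] \<open>\<not> Suc l < m\<close> by (auto simp: vimage_def split: if_splits)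
      qed
    qed (use Suc D0 in auto)
    then show ?thesis using False by (simp add: algebra_simps)
  qed
qed

text \<open>At the start the anchor is the current state. The factor \<open>q * real m\<close> is
  the price of one piece, and \<open>1 + real k * q\<close> bounds the expected number of
  pieces.\<close>

lemma short_gap_probability:
  assumes "a \<in> S" "q * real m \<le> 1"
  shows "measure (walk \<kappa> k a) {xs. short_gap far m a 0 xs} \<le> q * real m * (1 + real k * q)"
proof -
  have "0 \<le> q * real m" using q by simp
  then show ?thesis
    using short_gap_bound[OF assms(1) assms(1) refl assms(2), of k 0] self[of a]
    by (auto simp: algebra_simps split: if_splits)
qed

end

text \<open>Grid time is counted from the anchor \<open>c\<close>, so that position \<open>j\<close>
  of the list is time \<open>Suc l + j\<close>, and \<open>l < t 1\<close> says that the current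
  piece is still running. Its points are within \<open>r\<close> of their anchor; this last conjunct
  is what the induction needs, and two points of a piece are then within \<open>2 * r\<close> of
  each other.\<close>

lemma partition_if_not_short_gap:
  fixes c :: "'a::metric_space"
  assumes "\<not> short_gap (\<lambda>c b. r \<le> dist c b) m c l xs" and r0: "0 \<le> r"
  shows "\<exists>t. t 0 = 0 \<and> l < t 1 \<and> (\<forall>i. t i + m \<le> t (Suc i)) \<and>
    (\<forall>i j k. j < length xs \<and> k < length xs \<and> t i \<le> Suc l + j \<and> Suc l + j < t (Suc i) \<and>
       t i \<le> Suc l + k \<and> Suc l + k < t (Suc i) \<longrightarrow> dist (xs ! j) (xs ! k) \<le> 2 * r) \<and>
    (\<forall>j<length xs. Suc l + j < t 1 \<longrightarrow> dist c (xs ! j) \<le> r)"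
  using assms(1)
proof (induction xs arbitrary: c l)
  case Nil
  \<comment> \<open>After the end of the list only the gaps matter, so the next points are placed
    \<open>m\<close> apart.\<close>
  show ?case by (rule exI[of _ "case_nat 0 (\<lambda>i. Suc l + Suc i * m)"]) (auto split: nat.split)
next
  case (Cons b bs)
  show ?case
  proof (cases "r \<le> dist c b")
    case True
    with Cons.prems have "\<not> Suc l < m" "\<not> short_gap (\<lambda>c b. r \<le> dist c b) m b 0 bs" by auto
    from Cons.IH[OF this(2)] obtain t where t: "t 0 = 0" "0 < t 1" "\<And>i. t i + m \<le> t (Suc i)"
      "\<And>i j k. j < length bs \<Longrightarrow> k < length bs \<Longrightarrow> t i \<le> Suc j \<Longrightarrow> Suc j < t (Suc i) \<Longrightarrow>
       t i \<le> Suc k \<Longrightarrow> Suc k < t (Suc i) \<Longrightarrow> dist (bs ! j) (bs ! k) \<le> 2 * r"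
      "\<And>j. j < length bs \<Longrightarrow> Suc j < t 1 \<Longrightarrow> dist b (bs ! j) \<le> r" by auto
    \<comment> \<open>The new piece starts at time \<open>Suc l\<close>, which is local time 0 for
      the partition built from the new anchor \<open>b\<close>. The completed piece has length
      \<open>Suc l \<ge> m\<close>.\<close>
    let ?t = "case_nat 0 (\<lambda>i. Suc l + t i)"
    have mono: "t i \<le> t j" if "i \<le> j" for i j
      by (rule lift_Suc_mono_le[of t, OF add_leD1[OF t(3)] that])
    have pos: "i = 0" if "t i = 0" for i
      using that t(2) mono[of 1 i] by (cases i) auto
    show ?thesis
    proof (intro exI[of _ ?t] conjI allI impI)
      fix i j k
      assume jk: "j < length (b # bs) \<and> k < length (b # bs) \<and> ?t i \<le> Suc l + j \<and> Suc l + j < ?t (Suc i) \<and>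
        ?t i \<le> Suc l + k \<and> Suc l + k < ?t (Suc i)"
      then obtain i' where i: "i = Suc i'" using t(1) by (cases i) auto
      with jk have jk': "t i' \<le> j" "j < t (Suc i')" "t i' \<le> k" "k < t (Suc i')" by auto
      have first: "dist b (bs ! j') \<le> r" if "t i' = 0" "Suc j' < t (Suc i')" "j' < length bs" for j'
        using t(5)[of j'] that pos[of i'] by auto
      show "dist ((b # bs) ! j) ((b # bs) ! k) \<le> 2 * r"
        using jk jk' t(4)[of "j - 1" "k - 1" i'] first[of "j - 1"] first[of "k - 1"] r0
        by (cases j; cases k) (auto simp: dist_commute)
    qed (use t \<open>\<not> Suc l < m\<close> in \<open>auto split: nat.split simp: not_less_eq\<close>)
  next
    case False
    with Cons.prems have "\<not> short_gap (\<lambda>c b. r \<le> dist c b) m c (Suc l) bs" by auto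
    from Cons.IH[OF this] obtain t where t: "t 0 = 0" "Suc l < t 1" "\<And>i. t i + m \<le> t (Suc i)"
      "\<And>i j k. j < length bs \<Longrightarrow> k < length bs \<Longrightarrow> t i \<le> Suc (Suc l) + j \<Longrightarrow> Suc (Suc l) + j < t (Suc i) \<Longrightarrow>
       t i \<le> Suc (Suc l) + k \<Longrightarrow> Suc (Suc l) + k < t (Suc i) \<Longrightarrow> dist (bs ! j) (bs ! k) \<le> 2 * r"
      "\<And>j. j < length bs \<Longrightarrow> Suc (Suc l) + j < t 1 \<Longrightarrow> dist c (bs ! j) \<le> r" by auto
    have mono: "t i \<le> t j" if "i \<le> j" for i j
      by (rule lift_Suc_mono_le[of t, OF add_leD1[OF t(3)] that])
    have pos: "i = 0" if "t i \<le> Suc l" for i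
      using that t(2) mono[of 1 i] by (cases i) auto
    have b: "dist c b \<le> r" using False by simp
    show ?thesis
    proof (intro exI[of _ t] conjI allI impI)
      fix i j k
      assume jk: "j < length (b # bs) \<and> k < length (b # bs) \<and> t i \<le> Suc l + j \<and> Suc l + j < t (Suc i) \<and>
        t i \<le> Suc l + k \<and> Suc l + k < t (Suc i)"
      have first: "dist c (bs ! j') \<le> r" if "t i \<le> Suc l" "Suc (Suc l) + j' < t (Suc i)" "j' < length bs" for j'
        using t(5)[of j'] that pos[of i] by auto
      have "dist b (bs ! j') \<le> 2 * r" if "t i \<le> Suc l" "Suc (Suc l) + j' < t (Suc i)" "j' < length bs" for j'
        using first[OF that] b dist_triangle3[of b "bs ! j'" c] by simp
      then show "dist ((b # bs) ! j) ((b # bs) ! k) \<le> 2 * r"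
        using jk t(4)[of "j - 1" "k - 1" i] r0
        by (cases j; cases k) (auto simp: dist_commute)
    next
      fix j assume "j < length (b # bs)" "Suc l + j < t 1"
      then show "dist c ((b # bs) ! j) \<le> r" using t(5)[of "j - 1"] b by (cases j) auto
    qed (use t in auto)
  qed
qed

section \<open>From the walk to the process on a grid\<close>

text \<open>The finite-dimensional distributions determine the probability of following one given
  lattice trajectory, which is the initial weight times the weight under \<open>walk\<close>. There
  are countably many trajectories, so \<open>A\<close> is built as the disjoint union of the cells
  of the good ones. This makes \<open>A\<close> measurable whatever \<open>bad\<close> is.\<close>

lemma markov_chain_walk:
  fixes Y :: "real \<Rightarrow> 'w \<Rightarrow> 's::t1_space"
  assumes M: "prob_space M" and Y: "\<And>t. t \<ge> 0 \<Longrightarrow> Y t \<in> borel_measurable M"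
    and S: "AE \<omega> in M. Y 0 \<omega> \<in> S" "countable S"
    and p: "transition_semigroup S p"
    and fdd: "\<And>k t a. t 0 = 0 \<Longrightarrow> (\<forall>j<k. t j \<le> t (Suc j)) \<Longrightarrow> (\<forall>j\<le>k. a j \<in> S) \<Longrightarrow>
         measure M {\<omega> \<in> space M. \<forall>j\<le>k. Y (t j) \<omega> = a j} =
         measure M {\<omega> \<in> space M. Y 0 \<omega> = a 0} *
           (\<Prod>j<k. pmf (p (t (Suc j) - t j) (a j)) (a (Suc j)))"
    and h: "0 \<le> h"
    and bad: "\<And>a. a \<in> S \<Longrightarrow> measure (walk (p h) k a) {xs. bad a xs} \<le> \<beta>"
  obtains A where "A \<in> sets M" "1 - \<beta> \<le> measure M A"
    "\<And>\<omega>. \<omega> \<in> A \<Longrightarrow> \<not> bad (Y 0 \<omega>) (map (\<lambda>j. Y (h * real (Suc j)) \<omega>) [0..<k])"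
proof -
  interpret prob_space M by fact
  define G where "G a = {xs. set xs \<subseteq> S \<and> length xs = k \<and> \<not> bad a xs}" for a
  define cell where "cell a xs = {\<omega> \<in> space M. \<forall>j\<le>k. Y (h * real j) \<omega> = (a # xs) ! j}" for a xs
  have Y_sets: "{\<omega> \<in> space M. Y t \<omega> = a} \<in> events" if "0 \<le> t" for t a
    using measurable_sets[OF Y[OF that] borel_closed[OF closed_singleton[of a]]]
    by (simp add: vimage_def Int_def conj_commute)
  have cell_sets: "cell a xs \<in> events" for a xs
  proof -
    have "cell a xs = {\<omega> \<in> space M. \<forall>j\<in>{..k}. Y (h * real j) \<omega> = (a # xs) ! j}" by (auto simp: cell_def)
    then show ?thesis using h by (auto intro!: sets.sets_Collect_finite_All Y_sets)
  qed
  have countG: "countable (G a)" for a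
    using countable_lists[OF S(2)] by (rule countable_subset[rotated]) (auto simp: G_def)
  have cell_decode: "Y 0 \<omega> = a \<and> map (\<lambda>j. Y (h * real (Suc j)) \<omega>) [0..<k] = xs"
    if "\<omega> \<in> cell a xs" "xs \<in> G a" for \<omega> a xs
  proof
    have *: "Y (h * real j) \<omega> = (a # xs) ! j" if "j \<le> k" for j
      using \<open>\<omega> \<in> cell a xs\<close> that by (auto simp: cell_def)
    show "Y 0 \<omega> = a" using *[of 0] by simp
    show "map (\<lambda>j. Y (h * real (Suc j)) \<omega>) [0..<k] = xs"
      using \<open>xs \<in> G a\<close> *[of "Suc _"] by (intro nth_equalityI) (auto simp: G_def simp del: of_nat_Suc)
  qed
  have cell_prob: "prob (cell a xs) = prob {\<omega> \<in> space M. Y 0 \<omega> = a} * pmf (walk (p h) k a) xs"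
    if "a \<in> S" "xs \<in> G a" for a xs
  proof -
    have "prob (cell a xs) = prob {\<omega> \<in> space M. Y 0 \<omega> = (a # xs) ! 0} *
      (\<Prod>j<k. pmf (p (h * real (Suc j) - h * real j) ((a # xs) ! j)) ((a # xs) ! Suc j))"
      unfolding cell_def
    proof (rule fdd)
      show "\<forall>j\<le>k. (a # xs) ! j \<in> S"
        using that by (auto simp: G_def nth_Cons split: nat.split)
    qed (use h in \<open>auto intro: mult_left_mono\<close>)
    also have "(\<Prod>j<k. pmf (p (h * real (Suc j) - h * real j) ((a # xs) ! j)) ((a # xs) ! Suc j)) =
      pmf (walk (p h) k a) xs"
      using that by (subst pmf_walk) (auto simp: G_def algebra_simps)
    finally show ?thesis by simp
  qed
  define A where "A a = (\<Union>xs\<in>G a. cell a xs)" for a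
  have A_sets: "A a \<in> events" for a
    unfolding A_def using countG cell_sets by (intro sets.countable_UN') auto
  have A_le: "emeasure M {\<omega> \<in> space M. Y 0 \<omega> = a} * ennreal (1 - \<beta>) \<le> emeasure M (A a)" if a: "a \<in> S" for a
  proof -
    have closed: "\<And>a. a \<in> S \<Longrightarrow> set_pmf (p h a) \<subseteq> S"
      using p h by (auto simp: transition_semigroup_def)
    have "1 - \<beta> \<le> measure (walk (p h) k a) (- {xs. bad a xs})"
      using bad[OF a] measure_pmf.prob_compl[of "{xs. bad a xs}" "walk (p h) k a"] by (simp add: Compl_eq_Diff_UNIV)
    also have "\<dots> = measure (walk (p h) k a) (G a)"
      using set_walk[where \<kappa> = "p h", OF closed a, of k]
      by (intro measure_pmf.finite_measure_eq_AE) (auto simp: AE_measure_pmf_iff G_def)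
    finally have "ennreal (1 - \<beta>) \<le> emeasure (walk (p h) k a) (G a)"
      by (simp add: measure_pmf.emeasure_eq_measure ennreal_leI)
    then have "emeasure M {\<omega> \<in> space M. Y 0 \<omega> = a} * ennreal (1 - \<beta>) \<le>
      emeasure M {\<omega> \<in> space M. Y 0 \<omega> = a} * emeasure (walk (p h) k a) (G a)" by (rule mult_left_mono) simp
    also have "\<dots> = (\<integral>\<^sup>+xs. emeasure M {\<omega> \<in> space M. Y 0 \<omega> = a} * ennreal (pmf (walk (p h) k a) xs) \<partial>count_space (G a))"
      by (subst nn_integral_cmult) (simp_all add: nn_integral_pmf)
    also have "\<dots> = (\<integral>\<^sup>+xs. emeasure M (cell a xs) \<partial>count_space (G a))"
      using a by (intro nn_integral_cong) (simp add: emeasure_eq_measure cell_prob ennreal_mult)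
    also have "\<dots> = emeasure M (A a)"
      unfolding A_def
    proof (rule emeasure_UN_countable[symmetric])
      show "disjoint_family_on (cell a) (G a)"
        using cell_decode[of _ a] unfolding disjoint_family_on_def by blast
    qed (use cell_sets countG in auto)
    finally show ?thesis .
  qed
  have "(\<integral>\<^sup>+a. emeasure M {\<omega> \<in> space M. Y 0 \<omega> = a} \<partial>count_space S) = emeasure M (\<Union>a\<in>S. {\<omega> \<in> space M. Y 0 \<omega> = a})"
    by (rule emeasure_UN_countable[symmetric]) (use S(2) Y_sets in \<open>auto simp: disjoint_family_on_def\<close>)
  also have "\<dots> = 1"
  proof (rule emeasure_eq_1_AE)
    show "(\<Union>a\<in>S. {\<omega> \<in> space M. Y 0 \<omega> = a}) \<in> events" using S(2) Y_sets by (intro sets.countable_UN') auto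
    show "AE \<omega> in M. \<omega> \<in> (\<Union>a\<in>S. {\<omega> \<in> space M. Y 0 \<omega> = a})" using S(1) by (auto elim: AE_mp)
  qed
  finally have "ennreal (1 - \<beta>) = (\<integral>\<^sup>+a. emeasure M {\<omega> \<in> space M. Y 0 \<omega> = a} * ennreal (1 - \<beta>) \<partial>count_space S)"
    by (subst nn_integral_multc) simp_all
  also have "\<dots> \<le> (\<integral>\<^sup>+a. emeasure M (A a) \<partial>count_space S)"
    using A_le by (intro nn_integral_mono) simp
  also have "\<dots> = emeasure M (\<Union>a\<in>S. A a)"
  proof (rule emeasure_UN_countable[symmetric])
    show "disjoint_family_on A S"
      using cell_decode unfolding disjoint_family_on_def A_def by blast
  qed (use A_sets S(2) in auto)
  finally have "1 - \<beta> \<le> prob (\<Union>a\<in>S. A a)" by (simp add: emeasure_eq_measure)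
  moreover have "(\<Union>a\<in>S. A a) \<in> events" using S(2) A_sets by (intro sets.countable_UN') auto
  moreover have "\<not> bad (Y 0 \<omega>) (map (\<lambda>j. Y (h * real (Suc j)) \<omega>) [0..<k])" if "\<omega> \<in> (\<Union>a\<in>S. A a)" for \<omega>
    using that cell_decode by (fastforce simp: A_def G_def)
  ultimately show thesis using that by blast
qed

subsection \<open>Transition semigroups with bounded rates\<close>

text \<open>Continuity method: the set of times at which the bound holds is closed, and
  \<open>step\<close> leads from its supremum to a later such time unless the supremum is
  \<open>T\<close>. Arbitrarily small good increments suffice, so a bound on the derivative along a
  sequence can be used.\<close>

lemma growth_bound:
  fixes u :: "real \<Rightarrow> real"
  assumes cont: "continuous_on {0..T} u" and "0 \<le> T"
    and step: "\<And>t d. 0 \<le> t \<Longrightarrow> t < T \<Longrightarrow> 0 < d \<Longrightarrow> \<exists>s. 0 < s \<and> s \<le> d \<and> u (t + s) \<le> u t + L * s"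
  shows "u T \<le> u 0 + L * T"
proof -
  define A where "A = {t \<in> {0..T}. u t \<le> u 0 + L * t}"
  have "closed A"
    unfolding A_def by (intro continuous_on_closed_Collect_le cont continuous_intros)
  moreover have "0 \<in> A" using \<open>0 \<le> T\<close> by (simp add: A_def)
  moreover have bdd: "bdd_above A" by (auto simp: A_def intro: bdd_aboveI[of _ T])
  ultimately have c: "Sup A \<in> A" using closed_contains_Sup by blast
  have "\<not> Sup A < T"
  proof
    assume "Sup A < T"
    with c obtain s where s: "0 < s" "s \<le> T - Sup A" "u (Sup A + s) \<le> u (Sup A) + L * s"
      using step[of "Sup A" "T - Sup A"] by (auto simp: A_def)
    with c have "Sup A + s \<in> A" by (auto simp: A_def algebra_simps)
    from cSup_upper[OF this bdd] s show False by simp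
  qed
  with c have "Sup A = T" by (auto simp: A_def)
  with c show ?thesis by (auto simp: A_def)
qed

text \<open>Adding the constant \<open>B\<close> makes the integrand nonnegative and reduces the
  claim to the rule for nonnegative integrals.\<close>

lemma integral_bind_pmf_bounded:
  fixes f :: "'b \<Rightarrow> real"
  assumes "\<And>x. \<bar>f x\<bar> \<le> B"
  shows "measure_pmf.expectation (bind_pmf p k) f = measure_pmf.expectation p (\<lambda>x. measure_pmf.expectation (k x) f)"
proof -
  have int: "integrable (measure_pmf q) f" for q
    using assms by (intro measure_pmf.integrable_const_bound[of _ B]) auto
  have nn: "(\<integral>\<^sup>+x. ennreal (f x + B) \<partial>measure_pmf q) = ennreal (measure_pmf.expectation q f + B)" for q
  proof (subst nn_integral_eq_integral)
    have "0 \<le> f x + B" for x using assms[of x] by auto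
    then show "AE x in measure_pmf q. 0 \<le> f x + B" by simp
  qed (use int in auto)
  have ge: "0 \<le> measure_pmf.expectation q f + B" and le: "\<bar>measure_pmf.expectation q f\<bar> \<le> B" for q
  proof -
    have "- B \<le> measure_pmf.expectation q f" "measure_pmf.expectation q f \<le> B"
      using assms by (auto intro!: measure_pmf.integral_ge_const measure_pmf.integral_le_const int
        simp: abs_le_iff minus_le_iff)
    then show "0 \<le> measure_pmf.expectation q f + B" "\<bar>measure_pmf.expectation q f\<bar> \<le> B" by auto
  qed
  have kint: "integrable (measure_pmf p) (\<lambda>x. measure_pmf.expectation (k x) f)"
    using le by (intro measure_pmf.integrable_const_bound[of _ B]) auto
  have "ennreal (measure_pmf.expectation (bind_pmf p k) f + B) =
    (\<integral>\<^sup>+x. ennreal (measure_pmf.expectation (k x) f + B) \<partial>measure_pmf p)"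
    by (simp only: nn[symmetric] nn_integral_bind_pmf)
  also have "\<dots> = ennreal (\<integral>x. (measure_pmf.expectation (k x) f + B) \<partial>measure_pmf p)"
    using ge kint by (intro nn_integral_eq_integral) auto
  also have "(\<integral>x. (measure_pmf.expectation (k x) f + B) \<partial>measure_pmf p) =
    measure_pmf.expectation p (\<lambda>x. measure_pmf.expectation (k x) f) + B"
    using kint by simp
  finally have "ennreal (measure_pmf.expectation (bind_pmf p k) f + B) =
    ennreal (measure_pmf.expectation p (\<lambda>x. measure_pmf.expectation (k x) f) + B)" .
  moreover have "- B \<le> measure_pmf.expectation (k x) f" for x using le[of "k x"] by linarith
  then have "- B \<le> measure_pmf.expectation p (\<lambda>x. measure_pmf.expectation (k x) f)"
    by (intro measure_pmf.integral_ge_const kint) simp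
  ultimately show ?thesis using ge[of "bind_pmf p k"] by (simp add: ennreal_inj)
qed

locale bounded_rates =
  fixes S :: "'s set" and p :: "real \<Rightarrow> 's \<Rightarrow> 's pmf" and C :: "'s \<Rightarrow> 's \<Rightarrow> real" and \<Lambda> :: real
  assumes semigroup: "transition_semigroup S p"
    and generator: "has_generator S p (rate_operator S C)"
    and nonneg: "\<And>a b. a \<in> S \<Longrightarrow> b \<in> S \<Longrightarrow> 0 \<le> C a b"
    and diag: "\<And>a. a \<in> S \<Longrightarrow> C a a = 0"
    and summ: "\<And>a. a \<in> S \<Longrightarrow> C a summable_on S"
    and rate: "\<And>a. a \<in> S \<Longrightarrow> infsum (C a) S \<le> \<Lambda>"
begin

lemma set_p: "0 \<le> t \<Longrightarrow> a \<in> S \<Longrightarrow> set_pmf (p t a) \<subseteq> S"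
  using semigroup by (auto simp: transition_semigroup_def)

lemma p_0: "a \<in> S \<Longrightarrow> p 0 a = return_pmf a"
  using semigroup by (auto simp: transition_semigroup_def)

lemma p_add: "0 \<le> s \<Longrightarrow> 0 \<le> t \<Longrightarrow> a \<in> S \<Longrightarrow> p (s + t) a = bind_pmf (p s a) (p t)"
  using semigroup by (auto simp: transition_semigroup_def)

lemma rate_nonneg: "a \<in> S \<Longrightarrow> 0 \<le> \<Lambda>"
  using infsum_nonneg[of S "C a"] nonneg rate[of a] by fastforce

text \<open>The generator is only a pointwise limit. The next lemmas give increments of order \<open>s\<close> uniformly in
  the state, which justifies dominated convergence in the forward equation.\<close>

lemma stay_power:
  assumes "a \<in> S" "0 \<le> s"
  shows "pmf (p s a) a ^ n \<le> pmf (p (real n * s) a) a"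
proof (induction n)
  case 0
  then show ?case using assms by (simp add: p_0)
next
  case (Suc n)
  have "pmf (p s a) a ^ Suc n \<le> pmf (p s a) a * pmf (p (real n * s) a) a"
    using Suc by (simp add: mult_left_mono)
  also have "\<dots> = (\<integral>x. indicator {a} x * pmf (p (real n * s) a) a \<partial>measure_pmf (p s a))"
    by (simp add: pmf.rep_eq)
  also have "\<dots> \<le> (\<integral>x. pmf (p (real n * s) x) a \<partial>measure_pmf (p s a))"
    by (intro integral_mono measure_pmf.integrable_const_bound[of _ 1])
      (auto simp: indicator_def pmf_le_1)
  also have "\<dots> = pmf (p (real (Suc n) * s) a) a"
    using p_add[of s "real n * s" a] assms by (simp add: pmf_bind algebra_simps)
  finally show ?case .
qed

text \<open>Staying put during \<open>n\<close> intervals of length \<open>t / n\<close> implies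
  being at \<open>a\<close> at time \<open>t\<close>. With Bernoulli's inequality the leaving
  probability is at most \<open>n\<close> times the one for \<open>t / n\<close>, and by the
  generator applied to the indicator of \<open>a\<close> this tends to \<open>t\<close> times the
  total rate out of \<open>a\<close>.\<close>

lemma leave_probability:
  assumes a: "a \<in> S" and "0 \<le> t"
  shows "1 - pmf (p t a) a \<le> \<Lambda> * t"
proof (cases "t = 0")
  case True
  then show ?thesis using a by (simp add: p_0)
next
  case False
  with \<open>0 \<le> t\<close> have t: "0 < t" by simp
  have ind: "rate_operator S C (indicator {a}) a = - infsum (C a) S"
    unfolding rate_operator_def infsum_uminus[symmetric]
    by (intro infsum_cong) (auto simp: indicator_def diag[OF a])
  have "((\<lambda>s. (pmf (p s a) a - 1) / s) \<longlongrightarrow> - infsum (C a) S) (at_right 0)"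
  proof -
    have "bounded (indicator {a} ` S :: real set)"
      by (rule boundedI[of _ 1]) (auto simp: indicator_def)
    with generator a have "((\<lambda>s. (measure_pmf.expectation (p s a) (indicator {a}) - indicator {a} a) / s) \<longlongrightarrow>
      rate_operator S C (indicator {a}) a) (at_right 0)"
      unfolding has_generator_def by blast
    then show ?thesis by (simp add: ind pmf.rep_eq)
  qed
  moreover have "filterlim (\<lambda>n. t / real n) (at_right 0) sequentially"
  proof (rule tendsto_imp_filterlim_at_right)
    show "\<forall>\<^sub>F n in sequentially. 0 < t / real n"
      using eventually_gt_at_top[of 0] by eventually_elim (use t in simp)
    show "(\<lambda>n. t / real n) \<longlonglongrightarrow> 0" by (rule lim_const_over_n)
  qed
  ultimately have "(\<lambda>n. (pmf (p (t / real n) a) a - 1) / (t / real n)) \<longlonglongrightarrow> - infsum (C a) S"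
    by (rule filterlim_compose)
  then have "(\<lambda>n. - t * ((pmf (p (t / real n) a) a - 1) / (t / real n))) \<longlonglongrightarrow> - t * (- infsum (C a) S)"
    by (rule tendsto_mult_left)
  moreover have "\<forall>\<^sub>F n in sequentially. 1 - pmf (p t a) a \<le> - t * ((pmf (p (t / real n) a) a - 1) / (t / real n))"
    using eventually_gt_at_top[of 0]
  proof eventually_elim
    case (elim n)
    have "1 + real n * (pmf (p (t / real n) a) a - 1) \<le> (1 + (pmf (p (t / real n) a) a - 1)) ^ n"
      by (rule Bernoulli_inequality) simp
    also have "\<dots> \<le> pmf (p t a) a"
      using stay_power[OF a, of "t / real n" n] t elim by simp
    finally have "1 - pmf (p t a) a \<le> - (real n * (pmf (p (t / real n) a) a - 1))" by linarith
    also have "\<dots> = - t * ((pmf (p (t / real n) a) a - 1) / (t / real n))"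
      using t elim by (simp add: field_simps)
    finally show ?case .
  qed
  ultimately have "1 - pmf (p t a) a \<le> - t * (- infsum (C a) S)"
    by (rule tendsto_lowerbound) simp
  also have "\<dots> \<le> \<Lambda> * t" using rate[OF a] t by simp
  finally show ?thesis .
qed

text \<open>The increment vanishes unless the chain has moved away from \<open>a\<close>, and never
  exceeds \<open>2 * B\<close>.\<close>

lemma semigroup_increment:
  assumes a: "a \<in> S" and "0 \<le> s" and f: "\<And>x. \<bar>f x\<bar> \<le> B"
  shows "\<bar>measure_pmf.expectation (p s a) f - f a\<bar> \<le> 2 * B * \<Lambda> * s"
proof -
  have B: "0 \<le> B" using f[of a] by simp
  have int: "integrable (measure_pmf (p s a)) f"
    using f by (intro measure_pmf.integrable_const_bound[of _ B]) auto
  have ind: "integrable (measure_pmf (p s a)) (\<lambda>x. indicator {a} x :: real)"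
    by (intro measure_pmf.integrable_const_bound[of _ 1]) auto
  have "\<bar>measure_pmf.expectation (p s a) f - f a\<bar> = \<bar>\<integral>x. (f x - f a) \<partial>measure_pmf (p s a)\<bar>"
    using int by simp
  also have "\<dots> \<le> (\<integral>x. \<bar>f x - f a\<bar> \<partial>measure_pmf (p s a))" by (rule integral_abs_bound)
  also have "\<dots> \<le> (\<integral>x. 2 * B * (1 - indicator {a} x) \<partial>measure_pmf (p s a))"
  proof (rule integral_mono)
    show "\<bar>f x - f a\<bar> \<le> 2 * B * (1 - indicator {a} x)" for x
      using f[of x] f[of a] by (auto simp: indicator_def abs_le_iff)
  qed (use int ind in auto)
  also have "\<dots> = 2 * B * (1 - pmf (p s a) a)" using ind by (simp add: pmf.rep_eq)
  also have "\<dots> \<le> 2 * B * (\<Lambda> * s)" using B leave_probability[OF a \<open>0 \<le> s\<close>] by (intro mult_left_mono) auto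
  finally show ?thesis by (simp add: algebra_simps)
qed

text \<open>Dynkin's inequality. The difference quotients of the expectation converge along
  \<open>1 / (n + 1)\<close> to the expectation of the generator, with the dominating constant
  \<open>2 * B * \<Lambda>\<close>; the limit is at most \<open>K\<close>, and
  \<open>growth_bound\<close> integrates this.\<close>

lemma expectation_drift:
  assumes a: "a \<in> S" and "0 \<le> t" and f: "\<And>x. \<bar>f x\<bar> \<le> B"
    and Af: "\<And>x. x \<in> S \<Longrightarrow> rate_operator S C f x \<le> K"
  shows "measure_pmf.expectation (p t a) f \<le> f a + K * t"
proof -
  define u where "u t = measure_pmf.expectation (p t a) f" for t
  define d where "d s x = measure_pmf.expectation (p s x) f - f x" for s x
  have fint: "integrable (measure_pmf q) f" for q
    using f by (intro measure_pmf.integrable_const_bound[of _ B]) auto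
  have Ef: "\<bar>measure_pmf.expectation q f\<bar> \<le> B" for q :: "'s pmf"
  proof -
    have "- B \<le> measure_pmf.expectation q f" "measure_pmf.expectation q f \<le> B"
      using f by (auto intro!: measure_pmf.integral_ge_const measure_pmf.integral_le_const fint
        simp: abs_le_iff minus_le_iff)
    then show ?thesis by auto
  qed
  have Efint: "integrable (measure_pmf q) (\<lambda>x. measure_pmf.expectation (p s x) f)" for q s
    using Ef by (intro measure_pmf.integrable_const_bound[of _ B]) auto
  have incr: "u (t + s) - u t = (\<integral>x. d s x \<partial>measure_pmf (p t a))" if "0 \<le> t" "0 \<le> s" for t s
    unfolding u_def d_def p_add[OF that a] integral_bind_pmf_bounded[OF f]
    using Efint fint by simp
  have B\<Lambda>: "0 \<le> 2 * B * \<Lambda>" using f[of a] rate_nonneg[OF a] by (intro mult_nonneg_nonneg) auto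
  have lip: "\<bar>u (t + s) - u t\<bar> \<le> 2 * B * \<Lambda> * s" if "0 \<le> t" "0 \<le> s" for t s
  proof -
    have "\<bar>\<integral>x. d s x \<partial>measure_pmf (p t a)\<bar> \<le> (\<integral>x. \<bar>d s x\<bar> \<partial>measure_pmf (p t a))" by (rule integral_abs_bound)
    also have "\<dots> \<le> 2 * B * \<Lambda> * s"
    proof (rule measure_pmf.integral_le_const)
      show "integrable (measure_pmf (p t a)) (\<lambda>x. \<bar>d s x\<bar>)" unfolding d_def using Efint fint by simp
      show "AE x in measure_pmf (p t a). \<bar>d s x\<bar> \<le> 2 * B * \<Lambda> * s"
        using set_p[OF that(1) a] semigroup_increment[where f = f and B = B, OF _ that(2) f] by (auto simp: AE_measure_pmf_iff d_def)
    qed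
    finally show ?thesis using incr[OF that] by simp
  qed
  have lip': "(2 * B * \<Lambda>)-lipschitz_on {0..} u"
  proof (rule lipschitz_onI)
    show "dist (u x) (u y) \<le> 2 * B * \<Lambda> * dist x y" if "x \<in> {0..}" "y \<in> {0..}" for x y
      using lip[of x "y - x"] lip[of y "x - y"] that by (cases "x \<le> y") (auto simp: dist_real_def abs_minus_commute)
  qed (fact B\<Lambda>)
  have cont: "continuous_on {0..t} u"
    by (rule continuous_on_subset[OF lipschitz_on_continuous_on[OF lip']]) auto
  have null: "(\<lambda>n. inverse (real (Suc n))) \<longlonglongrightarrow> 0" by (rule LIMSEQ_inverse_real_of_nat)
  have at_right: "filterlim (\<lambda>n. inverse (real (Suc n))) (at_right 0) sequentially"
    using null by (rule tendsto_imp_filterlim_at_right) simp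
  have step: "\<exists>s. 0 < s \<and> s \<le> e \<and> u (r + s) \<le> u r + (K + \<epsilon>) * s"
    if r: "0 \<le> r" and "0 < e" "0 < \<epsilon>" for r e \<epsilon>
  proof -
    let ?s = "\<lambda>n. inverse (real (Suc n))"
    have AE_S: "AE x in measure_pmf (p r a). x \<in> S" using set_p[OF r a] by (auto simp: AE_measure_pmf_iff)
    have lim: "(\<lambda>n. d (?s n) x / ?s n) \<longlonglongrightarrow> rate_operator S C f x" if "x \<in> S" for x
    proof -
      have "bounded (f ` S)" using f by (auto simp: bounded_iff)
      then have "((\<lambda>s. d s x / s) \<longlongrightarrow> rate_operator S C f x) (at_right 0)"
        using generator that unfolding has_generator_def d_def by blast
      then show ?thesis using at_right by (rule filterlim_compose)
    qed
    have bound: "norm (d (?s n) x / ?s n) \<le> 2 * B * \<Lambda>" if "x \<in> S" for n x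
    proof -
      have pos: "0 < ?s n" by simp
      have "\<bar>d (?s n) x\<bar> \<le> 2 * B * \<Lambda> * ?s n"
        unfolding d_def by (rule semigroup_increment[OF that less_imp_le[OF pos] f])
      then show ?thesis
        unfolding real_norm_def abs_divide abs_of_pos[OF pos] by (subst pos_divide_le_eq[OF pos])
    qed
    have conv: "(\<lambda>n. \<integral>x. d (?s n) x / ?s n \<partial>measure_pmf (p r a)) \<longlonglongrightarrow> (\<integral>x. rate_operator S C f x \<partial>measure_pmf (p r a))"
      by (rule integral_dominated_convergence[where w = "\<lambda>_. 2 * B * \<Lambda>"])
        (use AE_S lim bound in \<open>auto elim!: eventually_mono\<close>)
    have quot: "(\<integral>x. d (?s n) x / ?s n \<partial>measure_pmf (p r a)) = (u (r + ?s n) - u r) / ?s n" for n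
      using incr[OF r, of "?s n"] by simp
    have limit: "(\<integral>x. rate_operator S C f x \<partial>measure_pmf (p r a)) < K + \<epsilon>"
    proof -
      have "norm (rate_operator S C f x) \<le> 2 * B * \<Lambda>" if "x \<in> S" for x
        using tendsto_norm[OF lim[OF that]] bound[OF that] by (intro tendsto_upperbound) auto
      then have "integrable (measure_pmf (p r a)) (rate_operator S C f)"
        using AE_S by (intro measure_pmf.integrable_const_bound[of _ "2 * B * \<Lambda>"]) (auto elim!: eventually_mono)
      then have "(\<integral>x. rate_operator S C f x \<partial>measure_pmf (p r a)) \<le> K"
        using AE_S Af by (intro measure_pmf.integral_le_const) (auto elim!: eventually_mono)
      with \<open>0 < \<epsilon>\<close> show ?thesis by simp
    qed
    have "\<forall>\<^sub>F n in sequentially. (u (r + ?s n) - u r) / ?s n < K + \<epsilon>"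
      using order_tendstoD(2)[OF conv limit] unfolding quot .
    moreover have "\<forall>\<^sub>F n in sequentially. ?s n < e" using order_tendstoD(2)[OF null \<open>0 < e\<close>] .
    ultimately have "\<forall>\<^sub>F n in sequentially. (u (r + ?s n) - u r) / ?s n < K + \<epsilon> \<and> ?s n < e" by eventually_elim simp
    then obtain n where n: "(u (r + ?s n) - u r) / ?s n < K + \<epsilon>" "?s n < e"
      unfolding eventually_sequentially by blast
    have "0 < ?s n" by simp
    with n(1) have "u (r + ?s n) - u r < (K + \<epsilon>) * ?s n" by (simp only: pos_divide_less_eq)
    with n(2) \<open>0 < ?s n\<close> show ?thesis by (intro exI[of _ "?s n"] conjI) linarith+
  qed
  have "u t \<le> u 0 + K * t + \<epsilon>" if "0 < \<epsilon>" for \<epsilon>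
  proof -
    \<comment> \<open>The strict inequality in \<open>step\<close> costs some slope; with slack
      \<open>\<epsilon> / (t + 1)\<close> the total error at time \<open>t\<close> is at most
      \<epsilon>.\<close>
    have "u t \<le> u 0 + (K + \<epsilon> / (t + 1)) * t"
      using \<open>0 \<le> t\<close> that by (intro growth_bound[OF cont] step) auto
    also have "\<epsilon> / (t + 1) * t \<le> \<epsilon>" using \<open>0 \<le> t\<close> that by (simp add: field_simps)
    then have "(K + \<epsilon> / (t + 1)) * t \<le> K * t + \<epsilon>" by (simp add: algebra_simps)
    finally show ?thesis by simp
  qed
  then have "u t \<le> u 0 + K * t" by (rule field_le_epsilon)
  then show ?thesis using p_0[OF a] by (simp add: u_def)
qed

end

subsection \<open>The generator on test functions\<close>

text \<open>With \<open>D\<close> and \<open>E\<close> the two denominators, \<open>G\<close> is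
  \<open>1 - 1 / D\<close> and \<open>1 - 1 / E\<close>, so its increment is
  \<open>(E - D) / (D * E)\<close>. Everything rests on \<open>2 * norm x \<le> D\<close>, which
  makes the bounds uniform in \<open>x\<close>. Only upper bounds are sought, so the square
  \<open>w * w\<close> in the remainder has a favourable sign and is dropped.\<close>

lemma norm_quotient_increment:
  fixes x b :: "'a::real_inner"
  defines "G \<equiv> \<lambda>x :: 'a. (norm x)\<^sup>2 / (1 + (norm x)\<^sup>2)"
  shows "G (x + b) - G x \<le> 2 * (x \<bullet> b) / (1 + (norm x)\<^sup>2)\<^sup>2 + (1 + norm b) * (norm b)\<^sup>2"
    and "G (x + b) - G x \<le> norm b + (norm b)\<^sup>2"
    and "G (x + b) - G x \<le> 1"
proof -
  define D E w n where "D = 1 + (norm x)\<^sup>2" and "E = 1 + (norm (x + b))\<^sup>2"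
    and "w = 2 * (x \<bullet> b)" and "n = norm b"
  have DE: "1 \<le> D" "1 \<le> E" "0 \<le> n" by (simp_all add: D_def E_def n_def)
  have E: "E = D + w + n\<^sup>2"
    by (simp add: D_def E_def w_def n_def power2_norm_eq_inner inner_add_left inner_add_right inner_commute)
  have "2 * norm x \<le> D"
    using sum_squares_bound[of "norm x" 1] by (simp add: D_def)
  have w: "\<bar>w\<bar> \<le> D * n"
  proof -
    have "\<bar>w\<bar> \<le> 2 * norm x * norm b" using Cauchy_Schwarz_ineq2[of x b] by (simp add: w_def abs_mult)
    also have "\<dots> \<le> D * n" unfolding n_def using \<open>2 * norm x \<le> D\<close> by (intro mult_right_mono) auto
    finally show ?thesis .
  qed
  have Gx: "G x = 1 - 1 / D" "G (x + b) = 1 - 1 / E"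
  proof -
    have "t / (1 + t) = 1 - 1 / (1 + t)" if "0 \<le> t" for t :: real
      using that by (simp add: eq_diff_eq add_divide_distrib[symmetric])
    then show "G x = 1 - 1 / D" "G (x + b) = 1 - 1 / E" by (simp_all add: G_def D_def E_def)
  qed
  have incr: "G (x + b) - G x = (w + n\<^sup>2) / (D * E)"
    using DE unfolding Gx by (simp add: field_simps E)
  have DE1: "1 \<le> D * E" using mult_mono[of 1 D 1 E] DE by simp
  have n2: "n\<^sup>2 / (D * E) \<le> n\<^sup>2"
    using DE1 by (simp add: divide_le_eq mult_le_cancel_left1)
  have "1 / D \<le> 1" "0 \<le> 1 / E" using DE by auto
  then show "G (x + b) - G x \<le> 1" unfolding Gx by linarith
  have wDE: "w / (D * E) \<le> n"
  proof -
    have "w / (D * E) \<le> D * n / (D * E)" using w DE by (intro divide_right_mono) auto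
    also have "\<dots> = n / E" using DE by simp
    also have "\<dots> \<le> n" using DE by (simp add: divide_le_eq mult_le_cancel_left1)
    finally show ?thesis .
  qed
  with n2 show "G (x + b) - G x \<le> norm b + (norm b)\<^sup>2"
    unfolding incr add_divide_distrib n_def[symmetric] by linarith
  \<comment> \<open>Replacing \<open>E\<close> by \<open>D\<close> in the linear term isolates the
    derivative of \<open>G\<close> in direction \<open>b\<close>; the correction is exact because
    \<open>E - D = w + n\<^sup>2\<close>.\<close>
  have "(w + n\<^sup>2) / (D * E) = w / D\<^sup>2 + n\<^sup>2 / (D * E) - w * (w + n\<^sup>2) / (D\<^sup>2 * E)"
  proof -
    have "w / (D * E) = w / D\<^sup>2 - w * (w + n\<^sup>2) / (D\<^sup>2 * E)"
      using DE E by (simp add: divide_simps power2_eq_square) (simp add: algebra_simps)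
    then show ?thesis by (simp add: add_divide_distrib)
  qed
  also have "- (w * (w + n\<^sup>2)) / (D\<^sup>2 * E) \<le> n * n\<^sup>2"
  proof -
    have "- (w * (w + n\<^sup>2)) \<le> \<bar>w\<bar> * n\<^sup>2"
    proof -
      have "- w * n\<^sup>2 \<le> \<bar>w\<bar> * n\<^sup>2" by (intro mult_right_mono) auto
      moreover have "0 \<le> w * w" by simp
      moreover have "- (w * (w + n\<^sup>2)) = - w * n\<^sup>2 - w * w" by (simp add: algebra_simps)
      ultimately show ?thesis by linarith
    qed
    also have "\<dots> \<le> D * n * n\<^sup>2" using w by (intro mult_right_mono) auto
    also have "\<dots> \<le> (n * n\<^sup>2) * (D\<^sup>2 * E)"
    proof -
      have "D * 1 \<le> D * (D * E)" using DE DE1 by (intro mult_left_mono) auto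
      then have "D * (n * n\<^sup>2) \<le> (D\<^sup>2 * E) * (n * n\<^sup>2)"
        using DE by (intro mult_right_mono) (auto simp: power2_eq_square mult.assoc)
      then show ?thesis by (simp add: mult_ac)
    qed
    finally have "- (w * (w + n\<^sup>2)) \<le> (n * n\<^sup>2) * (D\<^sup>2 * E)" .
    moreover have "0 < D\<^sup>2 * E" using DE by simp
    ultimately show ?thesis by (simp only: pos_divide_le_eq)
  qed
  then have "w / D\<^sup>2 + n\<^sup>2 / (D * E) - w * (w + n\<^sup>2) / (D\<^sup>2 * E) \<le> w / D\<^sup>2 + n\<^sup>2 + n * n\<^sup>2"
    using n2 by simp
  finally show "G (x + b) - G x \<le> 2 * (x \<bullet> b) / (1 + (norm x)\<^sup>2)\<^sup>2 + (1 + norm b) * (norm b)\<^sup>2"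
    unfolding incr D_def[symmetric] w_def[symmetric] n_def[symmetric] by (simp add: algebra_simps)
qed

definition test_fun :: "real \<Rightarrow> 'a::real_inner \<Rightarrow> 'a \<Rightarrow> real" where
  "test_fun r c x = 2 * ((norm (x - c))\<^sup>2 / (r\<^sup>2 + (norm (x - c))\<^sup>2))"

lemma test_fun_scale:
  assumes "0 < r"
  shows "test_fun r c x = 2 * ((norm ((x - c) /\<^sub>R r))\<^sup>2 / (1 + (norm ((x - c) /\<^sub>R r))\<^sup>2))"
proof -
  have "norm ((x - c) /\<^sub>R r) = norm (x - c) / r" using assms by (simp add: divide_inverse mult.commute)
  moreover have "1 + (norm (x - c) / r)\<^sup>2 = (r\<^sup>2 + (norm (x - c))\<^sup>2) / r\<^sup>2"
    using assms by (simp add: power_divide add_divide_distrib)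
  ultimately show ?thesis using assms by (simp add: test_fun_def power_divide)
qed

lemma test_fun_nonneg: "0 \<le> test_fun r c x" by (simp add: test_fun_def)

lemma test_fun_le: "test_fun r c x \<le> 2"
proof -
  have "u / (s + u) \<le> 1" if "0 \<le> s" "0 \<le> u" for s u :: real
    using that by (cases "s + u = 0") (auto simp: divide_le_eq_1)
  from this[of "r\<^sup>2" "(norm (x - c))\<^sup>2"] show ?thesis by (simp add: test_fun_def)
qed

lemma test_fun_self: "test_fun r c c = 0" by (simp add: test_fun_def)

lemma test_fun_far:
  assumes "0 < r" "r \<le> dist c x"
  shows "1 \<le> test_fun r c x"
proof -
  have "r\<^sup>2 \<le> (norm (x - c))\<^sup>2" using assms by (intro power_mono) (auto simp: dist_norm norm_minus_commute)
  moreover have "0 < r\<^sup>2 + (norm (x - c))\<^sup>2" using assms by (simp add: add_pos_nonneg)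
  ultimately show ?thesis by (simp add: test_fun_def pos_le_divide_eq)
qed

text \<open>The three terms bound the contribution of small, moderate and large jumps.\<close>

lemma test_fun_increment:
  fixes a c :: "'a::real_inner"
  assumes "0 < r" "0 < \<rho>" "\<rho> \<le> r'"
  obtains v where "norm v \<le> 1 / r"
    "\<And>b. test_fun r c (a + b) - test_fun r c a \<le>
      2 * (of_bool (norm b < \<rho>) * (v \<bullet> b + (1 + \<rho> / r) / r\<^sup>2 * (norm b)\<^sup>2) +
           (of_bool (\<rho> \<le> norm b) * (r' / r + (r' / r)\<^sup>2) + of_bool (r' < norm b)))"
proof -
  define x where "x = (a - c) /\<^sub>R r"
  \<comment> \<open>Half the gradient of the test function at \<open>a\<close>; the factor 2 of
    \<open>test_fun\<close> is kept outside. It does not depend on \<open>b\<close>, which (T5) will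
    require.\<close>
  define v where "v = (2 / (r * (1 + (norm x)\<^sup>2)\<^sup>2)) *\<^sub>R x"
  have "2 * norm x \<le> 1 + (norm x)\<^sup>2" using sum_squares_bound[of "norm x" 1] by simp
  also have "\<dots> \<le> (1 + (norm x)\<^sup>2)\<^sup>2" by (simp add: power2_eq_square algebra_simps)
  finally have "2 * norm x / (1 + (norm x)\<^sup>2)\<^sup>2 \<le> 1" by (simp add: divide_le_eq_1)
  then have "2 * norm x / (1 + (norm x)\<^sup>2)\<^sup>2 / r \<le> 1 / r" using \<open>0 < r\<close> by (intro divide_right_mono) auto
  then have v: "norm v \<le> 1 / r" using \<open>0 < r\<close> by (simp add: v_def mult.commute)
  show thesis
  proof (rule that[OF v])
    fix b :: 'a
    define y where "y = b /\<^sub>R r"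
    let ?G = "\<lambda>x :: 'a. (norm x)\<^sup>2 / (1 + (norm x)\<^sup>2)"
    have incr: "test_fun r c (a + b) - test_fun r c a = 2 * (?G (x + y) - ?G x)"
    proof -
      have "(a + b - c) /\<^sub>R r = x + y"
        unfolding x_def y_def scaleR_add_right[symmetric] by (rule arg_cong[where f = "scaleR _"]) simp
      then show ?thesis unfolding test_fun_scale[OF \<open>0 < r\<close>] x_def[symmetric] by simp
    qed
    have ny: "norm y = norm b / r" using \<open>0 < r\<close> by (simp add: y_def divide_inverse mult.commute)
    have vb: "2 * (x \<bullet> y) / (1 + (norm x)\<^sup>2)\<^sup>2 = v \<bullet> b"
      using \<open>0 < r\<close> by (simp add: v_def y_def divide_inverse)
    consider "norm b < \<rho>" | "\<rho> \<le> norm b" "norm b \<le> r'" | "\<rho> \<le> norm b" "r' < norm b" by linarith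
    then have "?G (x + y) - ?G x \<le> of_bool (norm b < \<rho>) * (v \<bullet> b + (1 + \<rho> / r) / r\<^sup>2 * (norm b)\<^sup>2) +
           (of_bool (\<rho> \<le> norm b) * (r' / r + (r' / r)\<^sup>2) + of_bool (r' < norm b))"
    proof cases
      case 1
      have "?G (x + y) - ?G x \<le> v \<bullet> b + (1 + norm y) * (norm y)\<^sup>2"
        using norm_quotient_increment(1)[of x y] unfolding vb .
      also have "(1 + norm y) * (norm y)\<^sup>2 \<le> (1 + \<rho> / r) * (norm y)\<^sup>2"
        using 1 \<open>0 < r\<close> unfolding ny by (intro mult_right_mono add_left_mono divide_right_mono) auto
      also have "\<dots> = (1 + \<rho> / r) / r\<^sup>2 * (norm b)\<^sup>2" by (simp add: ny power_divide)
      finally show ?thesis using 1 assms by simp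
    next
      case 2
      have "?G (x + y) - ?G x \<le> norm y + (norm y)\<^sup>2" using norm_quotient_increment(2)[of x y] .
      also have "\<dots> \<le> r' / r + (r' / r)\<^sup>2"
        using 2 \<open>0 < r\<close> unfolding ny by (intro add_mono power_mono divide_right_mono) auto
      finally show ?thesis using 2 by simp
    next
      case 3
      have "?G (x + y) - ?G x \<le> 1" using norm_quotient_increment(3)[of x y] .
      moreover have "0 \<le> r' / r + (r' / r)\<^sup>2" using assms by simp
      ultimately show ?thesis using 3 by simp
    qed
    then show "test_fun r c (a + b) - test_fun r c a \<le>
      2 * (of_bool (norm b < \<rho>) * (v \<bullet> b + (1 + \<rho> / r) / r\<^sup>2 * (norm b)\<^sup>2) +
           (of_bool (\<rho> \<le> norm b) * (r' / r + (r' / r)\<^sup>2) + of_bool (r' < norm b)))"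
      unfolding incr by (rule mult_left_mono) simp
  qed
qed

lemma bounded_mult_summable_on:
  fixes c \<phi> :: "'b \<Rightarrow> real"
  assumes "c summable_on A" "\<And>b. b \<in> A \<Longrightarrow> 0 \<le> c b" "\<And>b. b \<in> A \<Longrightarrow> \<bar>\<phi> b\<bar> \<le> B"
  shows "(\<lambda>b. \<phi> b * c b) summable_on A"
proof -
  have "(\<lambda>b. B * c b) summable_on A" using assms(1) by (rule summable_on_cmult_right)
  then have "(\<lambda>b. norm (\<phi> b * c b)) summable_on A"
    by (rule Infinite_Sum.abs_summable_on_comparison_test') (use assms in \<open>auto simp: abs_mult mult_right_mono\<close>)
  then show ?thesis by (rule abs_summable_summable)
qed

text \<open>Sums over different jump ranges become weighted sums over the whole lattice, where they
  can be added and compared.\<close>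

lemma infsum_restrict:
  fixes g :: "'b \<Rightarrow> real"
  shows "infsum (\<lambda>b. of_bool (P b) * g b) A = infsum g {b \<in> A. P b}"
  by (rule infsum_cong_neutral) auto

lemma infsum_finite_sum:
  fixes f :: "'i \<Rightarrow> 'b \<Rightarrow> real"
  assumes "finite I" "\<And>i. i \<in> I \<Longrightarrow> f i summable_on A"
  shows "(\<lambda>x. \<Sum>i\<in>I. f i x) summable_on A \<and> infsum (\<lambda>x. \<Sum>i\<in>I. f i x) A = (\<Sum>i\<in>I. infsum (f i) A)"
  using assms by (induction I rule: finite_induct) (auto simp: infsum_add intro: summable_on_add)

text \<open>\<open>D1\<close> controls only the modulus of a signed sum, so the linear term cannot
  be estimated jump by jump: it is summed exactly, with the constant coordinates of \<open>v\<close>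
  taken out of the sum. The other terms are nonnegative and are bounded separately.\<close>

lemma generator_test_fun_le:
  fixes S :: "(real ^ 'd) set" and C :: "real ^ 'd \<Rightarrow> real ^ 'd \<Rightarrow> real"
  assumes S: "\<And>a b. a \<in> S \<Longrightarrow> b \<in> S \<Longrightarrow> a + b \<in> S" "\<And>a b. a \<in> S \<Longrightarrow> b \<in> S \<Longrightarrow> a - b \<in> S"
    and a: "a \<in> S"
    and summ: "(\<lambda>b. C a (a + b)) summable_on S" and nonneg: "\<And>b. b \<in> S \<Longrightarrow> 0 \<le> C a b"
    and r: "0 < r" and \<rho>: "0 < \<rho>" "\<rho> \<le> r'"
    and D1: "\<And>i. \<bar>\<Sum>\<^sub>\<infinity>b\<in>{b\<in>S. norm b < \<rho>}. b $ i * C a (a + b)\<bar> \<le> D1"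
    and D2: "(\<Sum>\<^sub>\<infinity>b\<in>{b\<in>S. norm b < \<rho>}. (norm b)\<^sup>2 * C a (a + b)) \<le> D2"
    and D3: "(\<Sum>\<^sub>\<infinity>b\<in>{b\<in>S. \<rho> \<le> norm b}. C a (a + b)) \<le> D3"
    and D4: "(\<Sum>\<^sub>\<infinity>b\<in>{b\<in>S. r' < norm b}. C a (a + b)) \<le> D4"
  shows "rate_operator S C (test_fun r c) a \<le>
    2 * (real CARD('d) * D1 / r + (1 + \<rho> / r) / r\<^sup>2 * D2 + ((r' / r + (r' / r)\<^sup>2) * D3 + D4))"
proof -
  define w where "w b = C a (a + b)" for b
  have w0: "0 \<le> w b" if "b \<in> S" for b using nonneg S a that by (simp add: w_def)
  have w: "w summable_on S" using summ by (simp add: w_def[abs_def])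
  let ?P = "\<lambda>b :: real ^ 'd. norm b < \<rho>" and ?Q = "\<lambda>b :: real ^ 'd. \<rho> \<le> norm b"
    and ?R = "\<lambda>b :: real ^ 'd. r' < norm b"
  define k1 k2 where "k1 = (1 + \<rho> / r) / r\<^sup>2" and "k2 = r' / r + (r' / r)\<^sup>2"
  have k: "0 \<le> k1" "0 \<le> k2" using r \<rho> by (auto simp: k1_def k2_def)
  obtain v where v: "norm v \<le> 1 / r"
    "\<And>b. test_fun r c (a + b) - test_fun r c a \<le>
      2 * (of_bool (?P b) * (v \<bullet> b + k1 * (norm b)\<^sup>2) + (of_bool (?Q b) * k2 + of_bool (?R b)))"
    using test_fun_increment[OF r \<rho>] unfolding k1_def k2_def by metis
  note bms = bounded_mult_summable_on[OF w w0]
  have s0: "(\<lambda>b. (test_fun r c (a + b) - test_fun r c a) * w b) summable_on S"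
  proof (rule bms)
    show "\<bar>test_fun r c (a + b) - test_fun r c a\<bar> \<le> 2" for b
      using test_fun_nonneg[of r c] test_fun_le[of r c] by (smt (verit))
  qed
  have si: "(\<lambda>b. (of_bool (?P b) * b $ i) * w b) summable_on S" for i
  proof (rule bms)
    show "\<bar>of_bool (?P b) * b $ i\<bar> \<le> \<rho>" for b
      using component_le_norm_cart[of b i] \<rho> by auto
  qed
  have s2: "(\<lambda>b. (of_bool (?P b) * (norm b)\<^sup>2) * w b) summable_on S"
  proof (rule bms)
    show "\<bar>of_bool (?P b) * (norm b)\<^sup>2\<bar> \<le> \<rho>\<^sup>2" for b :: "real ^ 'd"
      using power_mono[of "norm b" \<rho> 2] by auto
  qed
  have s3: "(\<lambda>b. of_bool (?Q b) * w b) summable_on S" and s4: "(\<lambda>b. of_bool (?R b) * w b) summable_on S"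
    by (rule bms[where B = 1]; simp)+
  have lin: "(\<lambda>b. (of_bool (?P b) * (v \<bullet> b)) * w b) = (\<lambda>b. \<Sum>i\<in>UNIV. v $ i * ((of_bool (?P b) * b $ i) * w b))"
    by (auto simp: inner_vec_def sum_distrib_left sum_distrib_right mult_ac)
  have sv: "(\<lambda>b. v $ i * ((of_bool (?P b) * b $ i) * w b)) summable_on S" for i
    by (intro summable_on_cmult_right si)
  have s1: "(\<lambda>b. (of_bool (?P b) * (v \<bullet> b)) * w b) summable_on S"
    and i1: "infsum (\<lambda>b. (of_bool (?P b) * (v \<bullet> b)) * w b) S = (\<Sum>i\<in>UNIV. v $ i * infsum (\<lambda>b. (of_bool (?P b) * b $ i) * w b) S)"
    unfolding lin using infsum_finite_sum[of UNIV "\<lambda>i b. v $ i * ((of_bool (?P b) * b $ i) * w b)" S, OF finite sv] by (simp_all only: infsum_cmult_right')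
  \<comment> \<open>Translation by \<open>a\<close> is a bijection of the lattice and turns targets
    into jumps.\<close>
  have "rate_operator S C (test_fun r c) a = (\<Sum>\<^sub>\<infinity>b\<in>S. (test_fun r c (a + b) - test_fun r c a) * w b)"
    unfolding rate_operator_def w_def
  proof (rule infsum_reindex_bij_betw[symmetric, where g = "(+) a"])
    show "bij_betw ((+) a) S S"
      using S a by (intro bij_betw_byWitness[where f' = "\<lambda>b. b - a"]) auto
  qed
  also have "\<dots> \<le> (\<Sum>\<^sub>\<infinity>b\<in>S. 2 * ((of_bool (?P b) * (v \<bullet> b)) * w b + k1 * ((of_bool (?P b) * (norm b)\<^sup>2) * w b) +
      (k2 * (of_bool (?Q b) * w b) + of_bool (?R b) * w b)))"
  proof (rule infsum_mono[OF s0])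
    fix b assume "b \<in> S"
    from mult_right_mono[OF v(2) w0[OF this], of b]
    show "(test_fun r c (a + b) - test_fun r c a) * w b \<le> 2 * ((of_bool (?P b) * (v \<bullet> b)) * w b + k1 * ((of_bool (?P b) * (norm b)\<^sup>2) * w b) +
      (k2 * (of_bool (?Q b) * w b) + of_bool (?R b) * w b))"
      by (rule order_trans) (simp add: algebra_simps)
  qed (intro summable_on_add summable_on_cmult_right s1 s2 s3 s4)
  also have "\<dots> = 2 * (infsum (\<lambda>b. (of_bool (?P b) * (v \<bullet> b)) * w b) S + k1 * infsum (\<lambda>b. (of_bool (?P b) * (norm b)\<^sup>2) * w b) S +
      (k2 * infsum (\<lambda>b. of_bool (?Q b) * w b) S + infsum (\<lambda>b. of_bool (?R b) * w b) S))"
    by (simp only: infsum_cmult_right' infsum_add summable_on_add summable_on_cmult_right s1 s2 s3 s4)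
  also have "\<dots> \<le> 2 * (real CARD('d) * D1 / r + k1 * D2 + (k2 * D3 + D4))"
  proof (intro mult_left_mono add_mono k)
    have "infsum (\<lambda>b. (of_bool (?P b) * (v \<bullet> b)) * w b) S \<le> (\<Sum>i\<in>(UNIV :: 'd set). 1 / r * D1)"
      unfolding i1
    proof (rule sum_mono)
      fix i
      have "v $ i * infsum (\<lambda>b. (of_bool (?P b) * b $ i) * w b) S \<le>
        \<bar>v $ i\<bar> * \<bar>infsum (\<lambda>b. (of_bool (?P b) * b $ i) * w b) S\<bar>"
        unfolding abs_mult[symmetric] by (rule abs_ge_self)
      also have "infsum (\<lambda>b. (of_bool (?P b) * b $ i) * w b) S = (\<Sum>\<^sub>\<infinity>b\<in>{b\<in>S. ?P b}. b $ i * w b)"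
        by (simp only: mult.assoc infsum_restrict)
      also have "\<bar>v $ i\<bar> * \<bar>\<Sum>\<^sub>\<infinity>b\<in>{b\<in>S. ?P b}. b $ i * w b\<bar> \<le> 1 / r * D1"
        using D1[of i] component_le_norm_cart[of v i] v(1) r unfolding w_def by (intro mult_mono) auto
      finally show "v $ i * infsum (\<lambda>b. (of_bool (?P b) * b $ i) * w b) S \<le> 1 / r * D1"
        by (simp only: mult.assoc infsum_restrict)
    qed
    then show "infsum (\<lambda>b. (of_bool (?P b) * (v \<bullet> b)) * w b) S \<le> real CARD('d) * D1 / r" by simp
    show "infsum (\<lambda>b. (of_bool (?P b) * (norm b)\<^sup>2) * w b) S \<le> D2"
      using D2 by (simp only: mult.assoc infsum_restrict w_def)
    show "infsum (\<lambda>b. of_bool (?Q b) * w b) S \<le> D3" "infsum (\<lambda>b. of_bool (?R b) * w b) S \<le> D4"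
      using D3 D4 by (simp_all only: infsum_restrict w_def)
  qed simp
  finally show ?thesis unfolding k1_def k2_def .
qed

section \<open>Uniform real bounds from the rate conditions\<close>

lemma infsum_le_if_ennreal_infsum_le:
  fixes g :: "'b \<Rightarrow> real"
  assumes g: "\<And>x. x \<in> A \<Longrightarrow> 0 \<le> g x" and le: "(\<Sum>\<^sub>\<infinity>x\<in>A. ennreal (g x)) \<le> ennreal D" and "0 \<le> D"
  shows "g summable_on A" "infsum g A \<le> D"
proof -
  have fin: "sum g F \<le> D" if F: "finite F" "F \<subseteq> A" for F
  proof -
    have "ennreal (sum g F) = (\<Sum>x\<in>F. ennreal (g x))" using g F by (subst sum_ennreal) auto
    also have "\<dots> \<le> (\<Sum>\<^sub>\<infinity>x\<in>A. ennreal (g x))"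
    proof (subst infsum_finite[OF F(1), symmetric], rule infsum_mono_neutral)
      show "(\<lambda>x. ennreal (g x)) summable_on A" "(\<lambda>x. ennreal (g x)) summable_on F"
        by (auto intro: nonneg_summable_on_complete)
    qed (use F in auto)
    also note le
    finally show ?thesis using \<open>0 \<le> D\<close> by simp
  qed
  show "g summable_on A"
    using g fin by (intro nonneg_bdd_above_summable_on) (auto intro!: bdd_aboveI2)
  then show "infsum g A \<le> D" by (rule infsum_le_finite_sums) (use fin in auto)
qed

lemma limsup_less_top_bound:
  fixes F :: "nat \<Rightarrow> 'b \<Rightarrow> ennreal"
  assumes "limsup (\<lambda>n. SUP a\<in>A n. F n a) < \<infinity>"
  obtains D N where "0 \<le> D" "\<And>n a. n \<ge> N \<Longrightarrow> a \<in> A n \<Longrightarrow> F n a \<le> ennreal D"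
proof -
  obtain x where x: "limsup (\<lambda>n. SUP a\<in>A n. F n a) = ennreal x" "0 \<le> x"
    using assms by (cases "limsup (\<lambda>n. SUP a\<in>A n. F n a)") auto
  then have "limsup (\<lambda>n. SUP a\<in>A n. F n a) < ennreal (x + 1)" by (simp add: ennreal_less_iff)
  then obtain N where N: "\<And>n. n \<ge> N \<Longrightarrow> (SUP a\<in>A n. F n a) < ennreal (x + 1)"
    using Limsup_lessD[of sequentially "\<lambda>n. SUP a\<in>A n. F n a"] unfolding eventually_sequentially by blast
  have "F n a \<le> ennreal (x + 1)" if "n \<ge> N" "a \<in> A n" for n a
    using SUP_upper[OF that(2), of "F n"] less_imp_le[OF N[OF that(1)]] by (rule order_trans)
  with x that[of "x + 1" N] show ?thesis by simp
qed

lemma scaled_lattice_add: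
  assumes "a \<in> scaled_lattice n" "b \<in> scaled_lattice n"
  shows "a + b \<in> scaled_lattice n"
proof -
  obtain k l :: "int ^ 'a" where "a = (\<chi> i. real_of_int (k $ i) / real n)" "b = (\<chi> i. real_of_int (l $ i) / real n)"
    using assms by (auto simp: scaled_lattice_def)
  then have "a + b = (\<chi> i. real_of_int ((k + l) $ i) / real n)" by (simp add: vec_eq_iff add_divide_distrib)
  then show ?thesis unfolding scaled_lattice_def by (rule range_eqI)
qed

lemma scaled_lattice_diff:
  assumes "a \<in> scaled_lattice n" "b \<in> scaled_lattice n"
  shows "a - b \<in> scaled_lattice n"
proof -
  obtain k l :: "int ^ 'a" where "a = (\<chi> i. real_of_int (k $ i) / real n)" "b = (\<chi> i. real_of_int (l $ i) / real n)"
    using assms by (auto simp: scaled_lattice_def)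
  then have "a - b = (\<chi> i. real_of_int ((k - l) $ i) / real n)" by (simp add: vec_eq_iff diff_divide_distrib)
  then show ?thesis unfolding scaled_lattice_def by (rule range_eqI)
qed

lemma countable_scaled_lattice: "countable (scaled_lattice n :: (real ^ 'd) set)"
proof -
  have "countable (UNIV :: (int ^ 'd) set)"
  proof (rule countable_image_inj_on[where f = vec_nth])
    show "countable (range (vec_nth :: int ^ 'd \<Rightarrow> 'd \<Rightarrow> int))" by (rule countable_subset[of _ "Pi\<^sub>E UNIV (\<lambda>_. UNIV)"]) (auto intro: countable_PiE)
  qed (simp add: inj_on_def vec_eq_iff)
  then show ?thesis unfolding scaled_lattice_def by (rule countable_image)
qed

locale lattice_rates =
  fixes C :: "nat \<Rightarrow> real ^ 'd \<Rightarrow> real ^ 'd \<Rightarrow> real"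
  assumes nonneg: "\<And>n a b. n \<ge> 1 \<Longrightarrow> a \<in> scaled_lattice n \<Longrightarrow> b \<in> scaled_lattice n \<Longrightarrow> C n a b \<ge> 0"
    and T2: "\<And>n. n \<ge> 1 \<Longrightarrow>
      (SUP a\<in>scaled_lattice n. \<Sum>\<^sub>\<infinity>b\<in>scaled_lattice n. ennreal (C n a b)) < \<infinity>"
    and T3: "\<And>\<rho>::real. \<rho> > 0 \<Longrightarrow>
      limsup (\<lambda>n. SUP a\<in>scaled_lattice n.
        \<Sum>\<^sub>\<infinity>b\<in>{b\<in>scaled_lattice n. norm b > \<rho>}. ennreal (C n a (a + b))) < \<infinity>"
    and T4: "((\<lambda>r::real. limsup (\<lambda>n. SUP a\<in>scaled_lattice n.
        \<Sum>\<^sub>\<infinity>b\<in>{b\<in>scaled_lattice n. norm b > r}. ennreal (C n a (a + b)))) \<longlongrightarrow> 0) at_top"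
    and T5: "\<exists>\<rho>>0. \<forall>i. limsup (\<lambda>n. SUP a\<in>scaled_lattice n.
        ennreal \<bar>\<Sum>\<^sub>\<infinity>b\<in>{b\<in>scaled_lattice n. norm b < \<rho>}. b $ i * C n a (a + b)\<bar>) < \<infinity>"
    and T6: "\<exists>\<rho>>0. \<forall>i k. limsup (\<lambda>n. SUP a\<in>scaled_lattice n.
        ennreal \<bar>\<Sum>\<^sub>\<infinity>b\<in>{b\<in>scaled_lattice n. norm b < \<rho>}. b $ i * b $ k * C n a (a + b)\<bar>) < \<infinity>"
begin

lemma total_rate:
  assumes "n \<ge> 1"
  obtains \<Lambda> where "\<And>a. a \<in> scaled_lattice n \<Longrightarrow> C n a summable_on scaled_lattice n"
    "\<And>a. a \<in> scaled_lattice n \<Longrightarrow> infsum (C n a) (scaled_lattice n) \<le> \<Lambda>"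
proof -
  obtain x where x: "(SUP a\<in>scaled_lattice n. \<Sum>\<^sub>\<infinity>b\<in>scaled_lattice n. ennreal (C n a b)) = ennreal x" "0 \<le> x"
    using T2[OF assms] by (cases "SUP a\<in>scaled_lattice n. \<Sum>\<^sub>\<infinity>b\<in>scaled_lattice n. ennreal (C n a b)") auto
  have "(\<Sum>\<^sub>\<infinity>b\<in>scaled_lattice n. ennreal (C n a b)) \<le> ennreal x" if "a \<in> scaled_lattice n" for a
    unfolding x(1)[symmetric] using that by (rule SUP_upper)
  from infsum_le_if_ennreal_infsum_le[OF nonneg[OF assms] this x(2)] that show ?thesis by blast
qed

lemma summable_shift:
  assumes "n \<ge> 1" "a \<in> scaled_lattice n"
  shows "(\<lambda>b. C n a (a + b)) summable_on scaled_lattice n"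
proof -
  have "bij_betw ((+) a) (scaled_lattice n) (scaled_lattice n)"
    using assms(2) by (intro bij_betw_byWitness[where f' = "\<lambda>b. b - a"]) (auto intro: scaled_lattice_add scaled_lattice_diff)
  moreover have "C n a summable_on scaled_lattice n" using total_rate[OF assms(1)] assms(2) by metis
  ultimately show ?thesis by (subst summable_on_reindex_bij_betw)
qed

lemma tail_bound:
  assumes "n \<ge> 1" "a \<in> scaled_lattice n" "0 \<le> D"
    "(\<Sum>\<^sub>\<infinity>b\<in>{b\<in>scaled_lattice n. norm b > \<rho>}. ennreal (C n a (a + b))) \<le> ennreal D"
  shows "(\<Sum>\<^sub>\<infinity>b\<in>{b\<in>scaled_lattice n. norm b > \<rho>}. C n a (a + b)) \<le> D"
  using assms by (intro infsum_le_if_ennreal_infsum_le(2)) (auto intro: nonneg scaled_lattice_add)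

text \<open>(T5) and (T6) come with different radii \<rho> and \<sigma>, but the drift estimate
  needs one. The radius of (T5) is kept. The second moment, the sum over \<open>i\<close> of (T6)
  with \<open>k = i\<close>, moves from \<sigma> to \<rho> at the price of
  \<open>\<rho>\<^sup>2\<close> times the rate of jumps longer than some smaller \<mu>, which (T3)
  bounds.\<close>

lemma small_jump_bounds:
  obtains \<rho> D N where "0 < \<rho>" "0 \<le> D" "1 \<le> N"
    "\<And>n a i. n \<ge> N \<Longrightarrow> a \<in> scaled_lattice n \<Longrightarrow>
      \<bar>\<Sum>\<^sub>\<infinity>b\<in>{b\<in>scaled_lattice n. norm b < \<rho>}. b $ i * C n a (a + b)\<bar> \<le> D"
    "\<And>n a. n \<ge> N \<Longrightarrow> a \<in> scaled_lattice n \<Longrightarrow>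
      (\<Sum>\<^sub>\<infinity>b\<in>{b\<in>scaled_lattice n. norm b < \<rho>}. (norm b)\<^sup>2 * C n a (a + b)) \<le> D"
    "\<And>n a. n \<ge> N \<Longrightarrow> a \<in> scaled_lattice n \<Longrightarrow>
      (\<Sum>\<^sub>\<infinity>b\<in>{b\<in>scaled_lattice n. \<rho> \<le> norm b}. C n a (a + b)) \<le> D"
proof -
  obtain \<rho> where \<rho>: "0 < \<rho>" "\<And>i. limsup (\<lambda>n. SUP a\<in>scaled_lattice n.
        ennreal \<bar>\<Sum>\<^sub>\<infinity>b\<in>{b\<in>scaled_lattice n. norm b < \<rho>}. b $ i * C n a (a + b)\<bar>) < \<infinity>"
    using T5 by blast
  obtain \<sigma> where \<sigma>: "0 < \<sigma>" "\<And>i k. limsup (\<lambda>n. SUP a\<in>scaled_lattice n.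
        ennreal \<bar>\<Sum>\<^sub>\<infinity>b\<in>{b\<in>scaled_lattice n. norm b < \<sigma>}. b $ i * b $ k * C n a (a + b)\<bar>) < \<infinity>"
    using T6 by blast
  have "\<forall>i. \<exists>p. 0 \<le> fst p \<and> (\<forall>n\<ge>snd p. \<forall>a\<in>scaled_lattice n.
      \<bar>\<Sum>\<^sub>\<infinity>b\<in>{b\<in>scaled_lattice n. norm b < \<rho>}. b $ i * C n a (a + b)\<bar> \<le> fst p)"
  proof
    fix i
    obtain D N where "0 \<le> D" "\<And>n a. n \<ge> N \<Longrightarrow> a \<in> scaled_lattice n \<Longrightarrow>
        ennreal \<bar>\<Sum>\<^sub>\<infinity>b\<in>{b\<in>scaled_lattice n. norm b < \<rho>}. b $ i * C n a (a + b)\<bar> \<le> ennreal D"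
      using limsup_less_top_bound[OF \<rho>(2)[of i]] by blast
    then show "\<exists>p. 0 \<le> fst p \<and> (\<forall>n\<ge>snd p. \<forall>a\<in>scaled_lattice n.
      \<bar>\<Sum>\<^sub>\<infinity>b\<in>{b\<in>scaled_lattice n. norm b < \<rho>}. b $ i * C n a (a + b)\<bar> \<le> fst p)"
      by (intro exI[of _ "(D, N)"]) simp
  qed
  from choice[OF this] obtain p1 where p1: "\<And>i. 0 \<le> fst (p1 i)" "\<And>i n a. n \<ge> snd (p1 i) \<Longrightarrow> a \<in> scaled_lattice n \<Longrightarrow>
      \<bar>\<Sum>\<^sub>\<infinity>b\<in>{b\<in>scaled_lattice n. norm b < \<rho>}. b $ i * C n a (a + b)\<bar> \<le> fst (p1 i)" by blast
  have "\<forall>i. \<exists>p. 0 \<le> fst p \<and> (\<forall>n\<ge>snd p. \<forall>a\<in>scaled_lattice n.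
      \<bar>\<Sum>\<^sub>\<infinity>b\<in>{b\<in>scaled_lattice n. norm b < \<sigma>}. b $ i * b $ i * C n a (a + b)\<bar> \<le> fst p)"
  proof
    fix i
    obtain D N where "0 \<le> D" "\<And>n a. n \<ge> N \<Longrightarrow> a \<in> scaled_lattice n \<Longrightarrow>
        ennreal \<bar>\<Sum>\<^sub>\<infinity>b\<in>{b\<in>scaled_lattice n. norm b < \<sigma>}. b $ i * b $ i * C n a (a + b)\<bar> \<le> ennreal D"
      using limsup_less_top_bound[OF \<sigma>(2)[of i i]] by blast
    then show "\<exists>p. 0 \<le> fst p \<and> (\<forall>n\<ge>snd p. \<forall>a\<in>scaled_lattice n.
      \<bar>\<Sum>\<^sub>\<infinity>b\<in>{b\<in>scaled_lattice n. norm b < \<sigma>}. b $ i * b $ i * C n a (a + b)\<bar> \<le> fst p)"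
      by (intro exI[of _ "(D, N)"]) simp
  qed
  from choice[OF this] obtain p2 where p2: "\<And>i. 0 \<le> fst (p2 i)" "\<And>i n a. n \<ge> snd (p2 i) \<Longrightarrow> a \<in> scaled_lattice n \<Longrightarrow>
      \<bar>\<Sum>\<^sub>\<infinity>b\<in>{b\<in>scaled_lattice n. norm b < \<sigma>}. b $ i * b $ i * C n a (a + b)\<bar> \<le> fst (p2 i)" by blast
  \<comment> \<open>Strictly below both radii: (T3) speaks of jumps strictly longer than \<mu>, and
    these include all jumps of length at least \<rho> or at least \<sigma>.\<close>
  define \<mu> where "\<mu> = min (\<rho> / 2) (\<sigma> / 2)"
  have \<mu>: "0 < \<mu>" "\<mu> < \<rho>" "\<mu> < \<sigma>" using \<rho> \<sigma> by (auto simp: \<mu>_def)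
  obtain D3 N3 where D3: "0 \<le> D3" "\<And>n a. n \<ge> N3 \<Longrightarrow> a \<in> scaled_lattice n \<Longrightarrow>
      (\<Sum>\<^sub>\<infinity>b\<in>{b\<in>scaled_lattice n. norm b > \<mu>}. ennreal (C n a (a + b))) \<le> ennreal D3"
    using limsup_less_top_bound[OF T3[OF \<mu>(1)]] by blast
  define N where "N = Max (insert 1 (insert N3 (range (\<lambda>i. snd (p1 i)) \<union> range (\<lambda>i. snd (p2 i)))))"
  have N: "1 \<le> N" "N3 \<le> N" "snd (p1 i) \<le> N" "snd (p2 i) \<le> N" for i
    unfolding N_def by (rule Max_ge; simp)+
  define D where "D = (\<Sum>i\<in>UNIV. fst (p1 i)) + ((\<Sum>i\<in>UNIV. fst (p2 i)) + \<rho>\<^sup>2 * D3) + D3"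
  have D1: "fst (p1 i) \<le> (\<Sum>i\<in>UNIV. fst (p1 i))" for i
    using p1(1) by (intro member_le_sum) auto
  have pos: "0 \<le> (\<Sum>i\<in>UNIV. fst (p1 i))" "0 \<le> (\<Sum>i\<in>UNIV. fst (p2 i))" "0 \<le> \<rho>\<^sup>2 * D3"
    using p1(1) p2(1) D3(1) by (auto intro: sum_nonneg)
  have tail: "(\<Sum>\<^sub>\<infinity>b\<in>scaled_lattice n. of_bool (\<mu> < norm b) * C n a (a + b)) \<le> D3"
    if "n \<ge> N" "a \<in> scaled_lattice n" for n a
    using tail_bound[OF _ that(2) D3(1) D3(2)[OF _ that(2)]] that N by (simp only: infsum_restrict)
  show thesis
  proof (rule that[OF \<rho>(1) _ N(1), of D])
    show "0 \<le> D" using pos D3(1) by (simp add: D_def)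
  next
    fix n i and a :: "real ^ 'd" assume n: "n \<ge> N" and a: "a \<in> scaled_lattice n"
    have "\<bar>\<Sum>\<^sub>\<infinity>b\<in>{b\<in>scaled_lattice n. norm b < \<rho>}. b $ i * C n a (a + b)\<bar> \<le> fst (p1 i)"
      using p1(2) N(3)[of i] n a by (meson order_trans)
    then show "\<bar>\<Sum>\<^sub>\<infinity>b\<in>{b\<in>scaled_lattice n. norm b < \<rho>}. b $ i * C n a (a + b)\<bar> \<le> D"
      using D1[of i] pos D3(1) unfolding D_def by linarith
  next
    fix n and a :: "real ^ 'd" assume n: "n \<ge> N" and a: "a \<in> scaled_lattice n"
    then have n1: "n \<ge> 1" using N by simp
    have w0: "0 \<le> C n a (a + b)" if "b \<in> scaled_lattice n" for b
      using nonneg[OF n1 a] scaled_lattice_add[OF a that] by simp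
    note bms = bounded_mult_summable_on[OF summable_shift[OF n1 a] w0]
    have sq: "(\<lambda>b. (of_bool (norm b < \<tau>) * (norm b)\<^sup>2) * C n a (a + b)) summable_on scaled_lattice n" for \<tau>
    proof (rule bms)
      show "\<bar>of_bool (norm b < \<tau>) * (norm b)\<^sup>2\<bar> \<le> \<tau>\<^sup>2" for b :: "real ^ 'd"
        using power_mono[of "norm b" \<tau> 2] by auto
    qed
    have sqi: "(\<lambda>b. (of_bool (norm b < \<sigma>) * (b $ i)\<^sup>2) * C n a (a + b)) summable_on scaled_lattice n" for i
    proof (rule bms)
      show "\<bar>of_bool (norm b < \<sigma>) * (b $ i)\<^sup>2\<bar> \<le> \<sigma>\<^sup>2" for b :: "real ^ 'd"
        using component_le_norm_cart[of b i] power_mono[of "\<bar>b $ i\<bar>" \<sigma> 2] by auto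
    qed
    have st: "(\<lambda>b. of_bool (\<mu> < norm b) * C n a (a + b)) summable_on scaled_lattice n"
      by (rule bms[where B = 1]) auto
    have sr: "(\<lambda>b. of_bool (\<rho> \<le> norm b) * C n a (a + b)) summable_on scaled_lattice n"
      by (rule bms[where B = 1]) auto
    have "(\<Sum>\<^sub>\<infinity>b\<in>scaled_lattice n. (of_bool (norm b < \<sigma>) * (norm b)\<^sup>2) * C n a (a + b)) =
      (\<Sum>\<^sub>\<infinity>b\<in>scaled_lattice n. \<Sum>i\<in>UNIV. (of_bool (norm b < \<sigma>) * (b $ i)\<^sup>2) * C n a (a + b))"
    proof -
      have "(norm b)\<^sup>2 = (\<Sum>i\<in>UNIV. (b $ i)\<^sup>2)" for b :: "real ^ 'd"
        by (simp add: norm_vec_def L2_set_def sum_nonneg)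
      then show ?thesis by (simp only: sum_distrib_left sum_distrib_right)
    qed
    also have "\<dots> = (\<Sum>i\<in>UNIV. \<Sum>\<^sub>\<infinity>b\<in>scaled_lattice n. (of_bool (norm b < \<sigma>) * (b $ i)\<^sup>2) * C n a (a + b))"
      using infsum_finite_sum[of UNIV "\<lambda>i b. (of_bool (norm b < \<sigma>) * (b $ i)\<^sup>2) * C n a (a + b)", OF finite sqi] by blast
    also have "\<dots> \<le> (\<Sum>i\<in>UNIV. fst (p2 i))"
    proof (rule sum_mono)
      fix i
      have "\<bar>\<Sum>\<^sub>\<infinity>b\<in>{b\<in>scaled_lattice n. norm b < \<sigma>}. b $ i * b $ i * C n a (a + b)\<bar> \<le> fst (p2 i)"
        using p2(2) N(4)[of i] n a by (meson order_trans)
      then show "(\<Sum>\<^sub>\<infinity>b\<in>scaled_lattice n. (of_bool (norm b < \<sigma>) * (b $ i)\<^sup>2) * C n a (a + b)) \<le> fst (p2 i)"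
        by (simp only: mult.assoc infsum_restrict power2_eq_square)
    qed
    finally have second: "(\<Sum>\<^sub>\<infinity>b\<in>scaled_lattice n. (of_bool (norm b < \<sigma>) * (norm b)\<^sup>2) * C n a (a + b)) \<le> (\<Sum>i\<in>UNIV. fst (p2 i))" .
    have "(\<Sum>\<^sub>\<infinity>b\<in>scaled_lattice n. (of_bool (norm b < \<rho>) * (norm b)\<^sup>2) * C n a (a + b)) \<le>
      (\<Sum>\<^sub>\<infinity>b\<in>scaled_lattice n. (of_bool (norm b < \<sigma>) * (norm b)\<^sup>2) * C n a (a + b) + \<rho>\<^sup>2 * (of_bool (\<mu> < norm b) * C n a (a + b)))"
    proof (rule infsum_mono[OF sq])
      fix b :: "real ^ 'd" assume b: "b \<in> scaled_lattice n"
      \<comment> \<open>A jump that counts for \<rho> but not for \<sigma> is longer than \<mu> and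
        has square at most \<open>\<rho>\<^sup>2\<close>.\<close>
      have "of_bool (norm b < \<rho>) * (norm b)\<^sup>2 \<le> of_bool (norm b < \<sigma>) * (norm b)\<^sup>2 + \<rho>\<^sup>2 * of_bool (\<mu> < norm b)"
        using power_mono[of "norm b" \<rho> 2] \<mu> by auto
      from mult_right_mono[OF this w0[OF b]]
      show "(of_bool (norm b < \<rho>) * (norm b)\<^sup>2) * C n a (a + b) \<le>
        (of_bool (norm b < \<sigma>) * (norm b)\<^sup>2) * C n a (a + b) + \<rho>\<^sup>2 * (of_bool (\<mu> < norm b) * C n a (a + b))"
        by (simp only: distrib_right mult.assoc)
    qed (intro summable_on_add summable_on_cmult_right sq st)
    also have "\<dots> = (\<Sum>\<^sub>\<infinity>b\<in>scaled_lattice n. (of_bool (norm b < \<sigma>) * (norm b)\<^sup>2) * C n a (a + b)) +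
        \<rho>\<^sup>2 * (\<Sum>\<^sub>\<infinity>b\<in>scaled_lattice n. of_bool (\<mu> < norm b) * C n a (a + b))"
      by (subst infsum_add[OF sq summable_on_cmult_right[OF st]]) (simp only: infsum_cmult_right')
    also have "\<dots> \<le> (\<Sum>i\<in>UNIV. fst (p2 i)) + \<rho>\<^sup>2 * D3"
      using second tail[OF n a] by (intro add_mono mult_left_mono) auto
    finally show "(\<Sum>\<^sub>\<infinity>b\<in>{b\<in>scaled_lattice n. norm b < \<rho>}. (norm b)\<^sup>2 * C n a (a + b)) \<le> D"
      using pos D3(1) unfolding D_def mult.assoc infsum_restrict by linarith
    have "(\<Sum>\<^sub>\<infinity>b\<in>scaled_lattice n. of_bool (\<rho> \<le> norm b) * C n a (a + b)) \<le>
      (\<Sum>\<^sub>\<infinity>b\<in>scaled_lattice n. of_bool (\<mu> < norm b) * C n a (a + b))"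
      using \<mu> w0 by (intro infsum_mono[OF sr st] mult_right_mono) auto
    with tail[OF n a] show "(\<Sum>\<^sub>\<infinity>b\<in>{b\<in>scaled_lattice n. \<rho> \<le> norm b}. C n a (a + b)) \<le> D"
      using pos unfolding D_def infsum_restrict by linarith
  qed
qed

text \<open>For a fixed \<open>r\<close> no term has to be small, so the threshold between moderate
  and long jumps is taken to be \<rho> itself.\<close>

lemma drift_bound:
  assumes "0 < r"
  obtains K N where "0 \<le> K" "1 \<le> N" "\<And>n a c. n \<ge> N \<Longrightarrow> a \<in> scaled_lattice n \<Longrightarrow>
    rate_operator (scaled_lattice n) (C n) (test_fun r c) a \<le> K"
proof -
  obtain \<rho> D N where \<rho>: "0 < \<rho>" and D: "0 \<le> D" and N: "1 \<le> N"
    and D1: "\<And>n a i. n \<ge> N \<Longrightarrow> a \<in> scaled_lattice n \<Longrightarrow>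
      \<bar>\<Sum>\<^sub>\<infinity>b\<in>{b\<in>scaled_lattice n. norm b < \<rho>}. b $ i * C n a (a + b)\<bar> \<le> D"
    and D2: "\<And>n a. n \<ge> N \<Longrightarrow> a \<in> scaled_lattice n \<Longrightarrow>
      (\<Sum>\<^sub>\<infinity>b\<in>{b\<in>scaled_lattice n. norm b < \<rho>}. (norm b)\<^sup>2 * C n a (a + b)) \<le> D"
    and D3: "\<And>n a. n \<ge> N \<Longrightarrow> a \<in> scaled_lattice n \<Longrightarrow>
      (\<Sum>\<^sub>\<infinity>b\<in>{b\<in>scaled_lattice n. \<rho> \<le> norm b}. C n a (a + b)) \<le> D"
    using small_jump_bounds by blast
  obtain E N' where E: "0 \<le> E" "\<And>n a. n \<ge> N' \<Longrightarrow> a \<in> scaled_lattice n \<Longrightarrow>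
      (\<Sum>\<^sub>\<infinity>b\<in>{b\<in>scaled_lattice n. norm b > \<rho>}. ennreal (C n a (a + b))) \<le> ennreal E"
    using limsup_less_top_bound[OF T3[OF \<rho>]] by blast
  let ?K = "2 * (real CARD('d) * D / r + (1 + \<rho> / r) / r\<^sup>2 * D + ((\<rho> / r + (\<rho> / r)\<^sup>2) * D + E))"
  show thesis
  proof (rule that)
    show "0 \<le> ?K" using assms \<rho> D E(1) by auto
    show "1 \<le> max N N'" using N by simp
    fix n and a c :: "real ^ 'd" assume n: "n \<ge> max N N'" and a: "a \<in> scaled_lattice n"
    then have n1: "n \<ge> 1" using N by simp
    show "rate_operator (scaled_lattice n) (C n) (test_fun r c) a \<le> ?K"
      using n a \<rho> assms
      by (intro generator_test_fun_le scaled_lattice_add scaled_lattice_diff summable_shift[OF n1] nonneg[OF n1]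
        D1 D2 D3 tail_bound[OF n1 a E]) auto
  qed
qed

text \<open>Jumps longer than a large \<open>r'\<close> are rare by (T4); all other contributions vanish as \<open>r \<rightarrow> \<infinity>\<close>.\<close>

lemma drift_small:
  assumes "0 < \<kappa>"
  obtains r N where "0 < r" "1 \<le> N" "\<And>n a c. n \<ge> N \<Longrightarrow> a \<in> scaled_lattice n \<Longrightarrow>
    rate_operator (scaled_lattice n) (C n) (test_fun r c) a \<le> \<kappa>"
proof -
  obtain \<rho> D N where \<rho>: "0 < \<rho>" and D: "0 \<le> D" and N: "1 \<le> N"
    and D1: "\<And>n a i. n \<ge> N \<Longrightarrow> a \<in> scaled_lattice n \<Longrightarrow>
      \<bar>\<Sum>\<^sub>\<infinity>b\<in>{b\<in>scaled_lattice n. norm b < \<rho>}. b $ i * C n a (a + b)\<bar> \<le> D"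
    and D2: "\<And>n a. n \<ge> N \<Longrightarrow> a \<in> scaled_lattice n \<Longrightarrow>
      (\<Sum>\<^sub>\<infinity>b\<in>{b\<in>scaled_lattice n. norm b < \<rho>}. (norm b)\<^sup>2 * C n a (a + b)) \<le> D"
    and D3: "\<And>n a. n \<ge> N \<Longrightarrow> a \<in> scaled_lattice n \<Longrightarrow>
      (\<Sum>\<^sub>\<infinity>b\<in>{b\<in>scaled_lattice n. \<rho> \<le> norm b}. C n a (a + b)) \<le> D"
    using small_jump_bounds by blast
  have pos: "0 < ennreal (\<kappa> / 4)" using assms by simp
  have "\<forall>\<^sub>F r in at_top. \<rho> \<le> r \<and> limsup (\<lambda>n. SUP a\<in>scaled_lattice n.
        \<Sum>\<^sub>\<infinity>b\<in>{b\<in>scaled_lattice n. norm b > r}. ennreal (C n a (a + b))) < ennreal (\<kappa> / 4)"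
    using order_tendstoD(2)[OF T4 pos] eventually_ge_at_top[of \<rho>] by eventually_elim simp
  then obtain r' where r': "\<rho> \<le> r'" and lim: "limsup (\<lambda>n. SUP a\<in>scaled_lattice n.
        \<Sum>\<^sub>\<infinity>b\<in>{b\<in>scaled_lattice n. norm b > r'}. ennreal (C n a (a + b))) < ennreal (\<kappa> / 4)"
    by (metis (no_types, lifting) eventually_at_top_linorder order_refl)
  obtain N' where N': "\<And>n. n \<ge> N' \<Longrightarrow> (SUP a\<in>scaled_lattice n.
        \<Sum>\<^sub>\<infinity>b\<in>{b\<in>scaled_lattice n. norm b > r'}. ennreal (C n a (a + b))) < ennreal (\<kappa> / 4)"
    using Limsup_lessD[OF lim] unfolding eventually_sequentially by blast
  have E: "(\<Sum>\<^sub>\<infinity>b\<in>{b\<in>scaled_lattice n. norm b > r'}. ennreal (C n a (a + b))) \<le> ennreal (\<kappa> / 4)"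
    if "n \<ge> N'" "a \<in> scaled_lattice n" for n a
    using SUP_upper[OF that(2)] less_imp_le[OF N'[OF that(1)]] by (rule order_trans)
  \<comment> \<open>As \<open>r\<close> grows this tends to \<open>\<kappa> / 2\<close>, twice the
    tail bound \<open>\<kappa> / 4\<close>, which leaves room below \<kappa>. The threshold
    \<open>r'\<close> has been fixed before.\<close>
  let ?K = "\<lambda>r. 2 * (real CARD('d) * D / r + (1 + \<rho> / r) / r\<^sup>2 * D + ((r' / r + (r' / r)\<^sup>2) * D + \<kappa> / 4))"
  have inv: "((\<lambda>r. c / r) \<longlongrightarrow> 0) at_top" for c :: real
    by (rule tendsto_divide_0[OF tendsto_const]) (rule filterlim_at_top_imp_at_infinity[OF filterlim_ident])
  have "((\<lambda>r. 2 * (real CARD('d) * D / r + (1 + \<rho> / r) * (1 / r)\<^sup>2 * D + ((r' / r + (r' / r)\<^sup>2) * D + \<kappa> / 4)))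
     \<longlongrightarrow> 2 * (0 + (1 + 0) * 0\<^sup>2 * D + ((0 + 0\<^sup>2) * D + \<kappa> / 4))) at_top"
    by (intro tendsto_intros inv)
  then have "(?K \<longlongrightarrow> \<kappa> / 2) at_top" by (simp add: power_divide)
  moreover have "\<kappa> / 2 < \<kappa>" using assms by simp
  ultimately have "\<forall>\<^sub>F r in at_top. ?K r < \<kappa>" by (rule order_tendstoD(2))
  then have "\<forall>\<^sub>F r in at_top. ?K r < \<kappa> \<and> 0 < r" using eventually_gt_at_top[of 0] by eventually_elim simp
  then obtain r where r: "?K r < \<kappa>" "0 < r" by (metis (no_types, lifting) eventually_at_top_linorder order_refl)
  show thesis
  proof (rule that[OF r(2)])
    show "1 \<le> max N N'" using N by simp
    fix n and a c :: "real ^ 'd" assume n: "n \<ge> max N N'" and a: "a \<in> scaled_lattice n"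
    then have n1: "n \<ge> 1" and "n \<ge> N'" using N by auto
    have "rate_operator (scaled_lattice n) (C n) (test_fun r c) a \<le> ?K r"
      using n a \<rho> r' r(2) assms
      by (intro generator_test_fun_le scaled_lattice_add scaled_lattice_diff summable_shift[OF n1] nonneg[OF n1]
        D1 D2 D3 tail_bound[OF n1 a _ E[OF \<open>n \<ge> N'\<close> a]]) auto
    with r(1) show "rate_operator (scaled_lattice n) (C n) (test_fun r c) a \<le> \<kappa>" by linarith
  qed
qed

end

subsection \<open>Passing from the time grid to the path\<close>

text \<open>The path sampled at mesh \<open>h\<close> is a step function, and the discrete partition
  times multiplied by \<open>h\<close> partition it. The radius \<open>r'\<close> confines the path
  around its starting point, while \<open>r\<close> controls the oscillation on a piece.\<close>

lemma tame_grid_path: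
  fixes x :: "real \<Rightarrow> 'a::real_normed_vector"
  assumes h: "0 < h" and T: "T \<le> h * real k" and R: "norm (x 0) \<le> R" and r: "0 \<le> r" "0 \<le> r'"
    and xs: "xs = map (\<lambda>j. x (h * real (Suc j))) [0..<k]"
    and near: "\<not> (\<exists>b\<in>set xs. r' \<le> dist (x 0) b)"
    and gaps: "\<not> short_gap (\<lambda>c b. r \<le> dist c b) m (x 0) 0 xs"
  shows "tame T (R + r') (h * real m) (2 * r) (\<lambda>u. x (h * of_int \<lfloor>u / h\<rfloor>))"
proof -
  have index: "\<exists>j\<le>k. \<lfloor>u / h\<rfloor> = int j \<and> h * real j \<le> u \<and> u < h * real (Suc j)" if "0 \<le> u" "u < T" for u
  proof (intro exI conjI)
    have "0 \<le> u / h" using that h by simp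
    then show eq: "\<lfloor>u / h\<rfloor> = int (nat \<lfloor>u / h\<rfloor>)" by simp
    have "u / h < real k" using that h T by (simp add: divide_less_eq mult.commute)
    then have "\<lfloor>u / h\<rfloor> \<le> int k" by linarith
    then show "nat \<lfloor>u / h\<rfloor> \<le> k" by simp
    have "of_int \<lfloor>u / h\<rfloor> \<le> u / h" "u / h < of_int \<lfloor>u / h\<rfloor> + 1" by linarith+
    then have "of_int \<lfloor>u / h\<rfloor> * h \<le> u" "u < (of_int \<lfloor>u / h\<rfloor> + 1) * h"
      by (simp_all only: pos_le_divide_eq[OF h] pos_divide_less_eq[OF h])
    moreover have "real (nat \<lfloor>u / h\<rfloor>) = of_int \<lfloor>u / h\<rfloor>" using \<open>0 \<le> u / h\<close> by (intro of_nat_nat) simp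
    ultimately show "h * real (nat \<lfloor>u / h\<rfloor>) \<le> u" "u < h * real (Suc (nat \<lfloor>u / h\<rfloor>))"
      by (simp_all add: algebra_simps)
  qed
  have xs_nth: "xs ! j = x (h * real (Suc j))" if "j < k" for j using that by (simp add: xs)
  obtain t where t: "t 0 = 0" "0 < t 1" "\<And>i. t i + m \<le> t (Suc i)"
    "\<And>i j l. j < k \<Longrightarrow> l < k \<Longrightarrow> t i \<le> Suc j \<Longrightarrow> Suc j < t (Suc i) \<Longrightarrow> t i \<le> Suc l \<Longrightarrow> Suc l < t (Suc i) \<Longrightarrow>
      dist (xs ! j) (xs ! l) \<le> 2 * r"
    "\<And>j. j < k \<Longrightarrow> Suc j < t 1 \<Longrightarrow> dist (x 0) (xs ! j) \<le> r"
    using partition_if_not_short_gap[OF gaps r(1)] by (auto simp: xs)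
  have mono: "t i \<le> t j" if "i \<le> j" for i j
    by (rule lift_Suc_mono_le[of t, OF add_leD1[OF t(3)] that])
  have first: "i = 0" if "t i = 0" for i using that t(2) mono[of 1 i] by (cases i) auto
  have osc: "dist (x (h * real j)) (x (h * real l)) \<le> 2 * r"
    if "j \<le> k" "l \<le> k" "t i \<le> j" "j < t (Suc i)" "t i \<le> l" "l < t (Suc i)" for i j l
  proof (cases j; cases l)
    fix j' l' assume "j = Suc j'" "l = Suc l'"
    with that t(4)[of j' l' i] xs_nth[of j'] xs_nth[of l'] show ?thesis by simp
  next
    fix l' assume "j = 0" "l = Suc l'"
    with that t(5)[of l'] first[of i] xs_nth[of l'] r show ?thesis by simp
  next
    fix j' assume "j = Suc j'" "l = 0"
    with that t(5)[of j'] first[of i] xs_nth[of j'] r show ?thesis by (simp add: dist_commute)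
  qed (use r in simp)
  show ?thesis
    unfolding tame_def
  proof (intro conjI allI impI exI)
    fix u assume u: "0 \<le> u \<and> u < T"
    then obtain j where j: "j \<le> k" "\<lfloor>u / h\<rfloor> = int j" using index by blast
    show "norm (x (h * of_int \<lfloor>u / h\<rfloor>)) \<le> R + r'"
    proof (cases j)
      case 0
      then show ?thesis using j R r by simp
    next
      case (Suc j')
      then have "xs ! j' \<in> set xs" using j by (intro nth_mem) (simp add: xs)
      then have "dist (x 0) (x (h * real j)) < r'" using near Suc j xs_nth[of j'] by auto
      then have "norm (x (h * real j)) \<le> norm (x 0) + r'"
        using norm_triangle_ineq2[of "x (h * real j)" "x 0"] by (simp add: dist_norm norm_minus_commute)
      then show ?thesis using R j by simp
    qed
  next
    show "osc_partition T (h * real m) (2 * r) (\<lambda>i. h * real (t i)) (\<lambda>u. x (h * of_int \<lfloor>u / h\<rfloor>))"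
      unfolding osc_partition_def
    proof (intro conjI allI impI)
      show "h * real (t 0) = 0" by (simp add: t(1))
      show "h * real (t i) + h * real m \<le> h * real (t (Suc i))" for i
        using mult_left_mono[of "real (t i + m)" "real (t (Suc i))" h] t(3)[of i] h
        by (simp only: of_nat_le_iff less_imp_le of_nat_add distrib_left)
      fix i u v
      assume uv: "h * real (t i) < u \<and> u < h * real (t (Suc i)) \<and> u < T \<and>
        h * real (t i) < v \<and> v < h * real (t (Suc i)) \<and> v < T"
      have piece: "\<exists>j\<le>k. \<lfloor>w / h\<rfloor> = int j \<and> t i \<le> j \<and> j < t (Suc i)"
        if w: "h * real (t i) < w" "w < h * real (t (Suc i))" "w < T" for w
      proof -
        have "0 \<le> h * real (t i)" using h by simp
        with w have "0 \<le> w" by linarith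
        with index[of w] w obtain j where j: "j \<le> k" "\<lfloor>w / h\<rfloor> = int j" "h * real j \<le> w" "w < h * real (Suc j)" by blast
        have "h * real (t i) < h * real (Suc j)" "h * real j < h * real (t (Suc i))" using w j by linarith+
        with h j show ?thesis by (simp add: mult_less_cancel_left_pos del: of_nat_Suc)
      qed
      obtain j l where "j \<le> k" "\<lfloor>u / h\<rfloor> = int j" "t i \<le> j" "j < t (Suc i)"
        "l \<le> k" "\<lfloor>v / h\<rfloor> = int l" "t i \<le> l" "l < t (Suc i)"
        using piece[of u] piece[of v] uv by blast
      then show "dist (x (h * of_int \<lfloor>u / h\<rfloor>)) (x (h * of_int \<lfloor>v / h\<rfloor>)) \<le> 2 * r"
        using osc[of j l i] by simp
    qed
  qed
qed

text \<open>The ultrafilter is taken below the set of good indices. Rounding \<open>u\<close> up to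
  the grid gives times where the sampled path agrees with \<open>x\<close>; they approach
  \<open>u\<close> from the right, so right-continuity yields the pointwise limit.\<close>

lemma tame_if_frequently_grid_tame:
  fixes x :: "real \<Rightarrow> 'a::real_normed_vector"
  assumes x: "cadlag x" and h: "\<And>j. 0 < h j" "h \<longlonglongrightarrow> 0"
    and freq: "\<exists>\<^sub>F j in sequentially. tame T R \<delta> \<eta> (\<lambda>u. x (h j * of_int \<lfloor>u / h j\<rfloor>))"
    and "0 \<le> \<delta>" "0 \<le> T"
  shows "tame T R \<delta> \<eta> x"
proof -
  let ?P = "\<lambda>j. tame T R \<delta> \<eta> (\<lambda>u. x (h j * of_int \<lfloor>u / h j\<rfloor>))"
  have "inf sequentially (principal {j. ?P j}) \<noteq> bot"
    using freq by (simp add: trivial_limit_def eventually_inf_principal frequently_def)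
  then obtain F where F: "F \<le> inf sequentially (principal {j. ?P j})" "ultra F" using ultra_exists by blast
  then have Fseq: "F \<le> sequentially" by simp
  have ev: "eventually ?P F" using F(1) by (simp add: le_principal)
  let ?\<sigma> = "\<lambda>j u. h j * of_int \<lceil>u / h j\<rceil>"
  have \<sigma>_ge: "u \<le> ?\<sigma> j u" and \<sigma>_le: "?\<sigma> j u \<le> u + h j" for j u
  proof -
    have "u / h j \<le> of_int \<lceil>u / h j\<rceil>" "of_int \<lceil>u / h j\<rceil> \<le> u / h j + 1" by linarith+
    then have "u \<le> of_int \<lceil>u / h j\<rceil> * h j" "of_int \<lceil>u / h j\<rceil> * h j \<le> (u / h j + 1) * h j"
      by (simp_all only: pos_divide_le_eq[OF h(1)] mult_right_mono[OF _ less_imp_le[OF h(1)]])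
    with h(1)[of j] show "u \<le> ?\<sigma> j u" "?\<sigma> j u \<le> u + h j" by (simp_all add: algebra_simps)
  qed
  have \<sigma>: "((\<lambda>j. ?\<sigma> j u) \<longlongrightarrow> u) sequentially" for u
  proof (rule tendsto_sandwich)
    show "(\<lambda>j. u) \<longlonglongrightarrow> u" "(\<lambda>j. u + h j) \<longlonglongrightarrow> u" using tendsto_add[OF tendsto_const[of u] h(2)] by simp_all
  qed (use \<sigma>_ge \<sigma>_le in auto)
  show ?thesis
  proof (rule tame_ultralimit[OF F(2) ev, where \<sigma> = ?\<sigma>])
    fix u :: real assume u: "0 \<le> u"
    show "((\<lambda>j. ?\<sigma> j u) \<longlongrightarrow> u) F" using \<sigma> Fseq by (rule tendsto_mono[rotated])
    show "\<forall>\<^sub>F j in F. 0 \<le> ?\<sigma> j u" using \<sigma>_ge[of u] u by (auto intro!: always_eventually order_trans[of 0 u])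
    have "(\<lambda>j. x (?\<sigma> j u)) \<longlonglongrightarrow> x u"
    proof (rule tendstoI)
      fix e :: real assume "0 < e"
      have "(x \<longlongrightarrow> x u) (at_right u)" using x u by (auto simp: cadlag_def)
      then have "\<forall>\<^sub>F v in at_right u. dist (x v) (x u) < e" using \<open>0 < e\<close> by (rule tendstoD)
      then obtain b where b: "b > u" "\<And>v. u < v \<Longrightarrow> v < b \<Longrightarrow> dist (x v) (x u) < e"
        unfolding eventually_at_right_field by blast
      show "\<forall>\<^sub>F j in sequentially. dist (x (?\<sigma> j u)) (x u) < e"
        using order_tendstoD(2)[OF \<sigma> b(1)]
      proof eventually_elim
        case (elim j)
        then show ?case using b(2) \<sigma>_ge[of u j] \<open>0 < e\<close> by (cases "?\<sigma> j u = u") auto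
      qed
    qed
    moreover have eq: "h j * of_int \<lfloor>?\<sigma> j u / h j\<rfloor> = ?\<sigma> j u" for j using h(1)[of j] by simp
    ultimately show "((\<lambda>j. x (h j * of_int \<lfloor>?\<sigma> j u / h j\<rfloor>)) \<longlongrightarrow> x u) F"
      unfolding eq by (intro tendsto_mono[OF Fseq])
  qed fact+
qed

text \<open>Reverse Fatou for events. It suffices to be good for infinitely many grids, and these
  may depend on the path.\<close>

lemma (in prob_space) prob_limsup_ge:
  fixes A :: "nat \<Rightarrow> 'a set"
  assumes "\<And>j. A j \<in> events" "\<And>j. c \<le> prob (A j)"
  shows "c \<le> prob (\<Inter>i. \<Union>j\<in>{i..}. A j)"
proof -
  have "(\<lambda>i. prob (\<Union>j\<in>{i..}. A j)) \<longlonglongrightarrow> prob (\<Inter>i. \<Union>j\<in>{i..}. A j)"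
    using assms(1) by (intro finite_Lim_measure_decseq antimonoI UN_mono) auto
  moreover have "c \<le> prob (\<Union>j\<in>{i..}. A j)" for i
    using assms(1) by (intro order_trans[OF assms(2)[of i]] finite_measure_mono) auto
  ultimately show ?thesis by (intro tendsto_lowerbound) auto
qed

text \<open>The loss has three sources: \<epsilon> for a start outside the ball of radius
  \<open>R\<close>, \<open>\<kappa> * (T + \<delta>)\<close> for moving \<open>r'\<close> away from
  the start, and the remainder for pieces shorter than \<delta>.\<close>

lemma markov_chain_tame:
  fixes X :: "'w \<Rightarrow> 'a::euclidean_space skorokhod" and M :: "'w measure"
  assumes chain: "markov_chain M (\<lambda>t \<omega>. path (X \<omega>) t) S C" and X: "X \<in> M \<rightarrow>\<^sub>M borel"
    and S: "countable S"
    and C: "\<And>a b. a \<in> S \<Longrightarrow> b \<in> S \<Longrightarrow> 0 \<le> C a b" "\<And>a. a \<in> S \<Longrightarrow> C a a = 0"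
      "\<And>a. a \<in> S \<Longrightarrow> C a summable_on S" "\<And>a. a \<in> S \<Longrightarrow> infsum (C a) S \<le> \<Lambda>"
    and K: "0 < r" "0 \<le> K" "\<And>a c. a \<in> S \<Longrightarrow> rate_operator S C (test_fun r c) a \<le> K"
    and \<kappa>: "0 < r'" "0 \<le> \<kappa>" "\<And>a c. a \<in> S \<Longrightarrow> rate_operator S C (test_fun r' c) a \<le> \<kappa>"
    and R: "1 - \<epsilon> \<le> measure M {\<omega> \<in> space M. norm (path (X \<omega>) 0) \<le> R}"
    and T: "0 \<le> T" and \<delta>: "0 < \<delta>" "K * \<delta> \<le> 1"
  shows "1 - (\<epsilon> + \<kappa> * (T + \<delta>) + K * \<delta> * (1 + K * (T + \<delta>))) \<le>
    measure M {\<omega> \<in> space M. tame T (R + r') \<delta> (2 * r) (path (X \<omega>))}"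
proof -
  interpret prob_space M using chain by (simp add: markov_chain_def)
  have Y: "\<And>t. t \<ge> 0 \<Longrightarrow> (\<lambda>\<omega>. path (X \<omega>) t) \<in> borel_measurable M"
    and YS: "AE \<omega> in M. path (X \<omega>) 0 \<in> S"
    using chain by (auto simp: markov_chain_def)
  obtain p where p: "transition_semigroup S p" "has_generator S p (rate_operator S C)"
    and fdd: "\<And>k t a. t 0 = 0 \<Longrightarrow> (\<forall>j<k. t j \<le> t (Suc j)) \<Longrightarrow> (\<forall>j\<le>k. a j \<in> S) \<Longrightarrow>
         measure M {\<omega> \<in> space M. \<forall>j\<le>k. path (X \<omega>) (t j) = a j} =
         measure M {\<omega> \<in> space M. path (X \<omega>) 0 = a 0} *
           (\<Prod>j<k. pmf (p (t (Suc j) - t j) (a j)) (a (Suc j)))"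
    using chain unfolding markov_chain_def by blast
  interpret bounded_rates S p C \<Lambda> by unfold_locales (fact p C)+
  \<comment> \<open>Exactly \<open>Suc j\<close> steps of the j-th grid make up the length \<delta>.
    Since \<open>h j \<le> \<delta>\<close>, covering \<open>T\<close> by whole steps overshoots by
    at most \<delta>.\<close>
  define h where "h j = \<delta> / real (Suc j)" for j
  have h: "0 < h j" "h j * real (Suc j) = \<delta>" "h j \<le> \<delta>" for j
    using \<delta> by (auto simp: h_def divide_le_eq mult_le_cancel_left1)
  define k where "k j = nat \<lceil>T / h j\<rceil>" for j
  have k: "T \<le> h j * real (k j)" "real (k j) * h j \<le> T + \<delta>" for j
  proof -
    have "0 \<le> T / h j" using T h(1)[of j] by simp
    then have "T / h j \<le> real (k j)" "real (k j) \<le> T / h j + 1" unfolding k_def by linarith+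
    then have "T \<le> h j * real (k j)" "real (k j) * h j \<le> T + h j" using h(1)[of j] by (simp_all add: field_simps)
    with h(3)[of j] show "T \<le> h j * real (k j)" "real (k j) * h j \<le> T + \<delta>" by auto
  qed
  define xs where "xs j \<omega> = map (\<lambda>i. path (X \<omega>) (h j * real (Suc i))) [0..<k j]" for j \<omega>
  define bad where "bad j a ys \<longleftrightarrow> (\<exists>b\<in>set ys. r' \<le> dist a b) \<or> short_gap (\<lambda>c b. r \<le> dist c b) (Suc j) a 0 ys" for j and a :: 'a and ys
  define \<beta> where "\<beta> = \<kappa> * (T + \<delta>) + K * \<delta> * (1 + K * (T + \<delta>))"
  have tests: "test_functions S (p (h j)) (test_fun s) (\<lambda>c b. s \<le> dist c b) 2 (L * h j)"
    if sL: "0 < s" "0 \<le> L" "\<And>a c. a \<in> S \<Longrightarrow> rate_operator S C (test_fun s c) a \<le> L" for s L j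
  proof
    show "measure_pmf.expectation (p (h j) a) (test_fun s c) \<le> test_fun s c a + L * h j" if "a \<in> S" "c \<in> S" for a c
    proof (rule expectation_drift[OF that(1) less_imp_le[OF h(1)]])
      show "\<bar>test_fun s c x\<bar> \<le> 2" for x using test_fun_nonneg[of s c x] test_fun_le[of s c x] by simp
    qed (rule sL(3))
  qed (use sL set_p h(1)[of j] test_fun_far in \<open>auto simp: test_fun_nonneg test_fun_le test_fun_self less_imp_le\<close>)
  have "\<exists>A. A \<in> events \<and> 1 - \<beta> \<le> prob A \<and> (\<forall>\<omega>\<in>A. \<not> bad j (path (X \<omega>) 0) (xs j \<omega>))" for j
  proof -
    interpret K: test_functions S "p (h j)" "test_fun r" "\<lambda>c b. r \<le> dist c b" 2 "K * h j"
      by (rule tests) (fact K)+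
    interpret \<kappa>: test_functions S "p (h j)" "test_fun r'" "\<lambda>c b. r' \<le> dist c b" 2 "\<kappa> * h j"
      by (rule tests) (fact \<kappa>)+
    have bad: "measure (walk (p (h j)) (k j) a) {ys. bad j a ys} \<le> \<beta>" if a: "a \<in> S" for a
    proof -
      let ?W = "walk (p (h j)) (k j) a"
      have "measure ?W {ys. bad j a ys} \<le> measure ?W {ys. \<exists>b\<in>set ys. r' \<le> dist a b} +
        measure ?W {ys. short_gap (\<lambda>c b. r \<le> dist c b) (Suc j) a 0 ys}"
        unfolding bad_def Collect_disj_eq by (rule measure_Un_le) auto
      also have "measure ?W {ys. \<exists>b\<in>set ys. r' \<le> dist a b} \<le> \<kappa> * (T + \<delta>)"
      proof -
        have "measure ?W {ys. \<exists>b\<in>set ys. r' \<le> dist a b} \<le> \<kappa> * (real (k j) * h j)"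
          using \<kappa>.exit_probability[OF a a, of "k j"] by (simp add: test_fun_self mult_ac)
        also have "\<dots> \<le> \<kappa> * (T + \<delta>)" using k \<kappa>(2) by (intro mult_left_mono)
        finally show ?thesis .
      qed
      also have "measure ?W {ys. short_gap (\<lambda>c b. r \<le> dist c b) (Suc j) a 0 ys} \<le> K * \<delta> * (1 + K * (T + \<delta>))"
      proof -
        have q: "K * h j * real (Suc j) = K * \<delta>" by (simp only: mult.assoc h(2))
        have "measure ?W {ys. short_gap (\<lambda>c b. r \<le> dist c b) (Suc j) a 0 ys} \<le> K * \<delta> * (1 + K * (real (k j) * h j))"
          using K.short_gap_probability[OF a, of "Suc j" "k j"] \<delta>(2) unfolding q by (simp add: mult_ac)
        also have "\<dots> \<le> K * \<delta> * (1 + K * (T + \<delta>))"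
          using k \<delta>(1) K(2) by (intro mult_left_mono add_left_mono) auto
        finally show ?thesis .
      qed
      finally show ?thesis unfolding \<beta>_def by simp
    qed
    show ?thesis
      by (rule markov_chain_walk[where Y = "\<lambda>t \<omega>. path (X \<omega>) t" and bad = "bad j" and h = "h j" and k = "k j",
          OF prob_space_axioms Y YS S p(1) fdd less_imp_le[OF h(1)] bad]) (auto simp: xs_def)
  qed
  then obtain A where A: "\<And>j. A j \<in> events" "\<And>j. 1 - \<beta> \<le> prob (A j)"
    "\<And>j \<omega>. \<omega> \<in> A j \<Longrightarrow> \<not> bad j (path (X \<omega>) 0) (xs j \<omega>)" by metis
  define B where "B = {\<omega> \<in> space M. norm (path (X \<omega>) 0) \<le> R}"
  have B: "B \<in> events"
    using measurable_sets[OF Y[OF order_refl] borel_closed[OF closed_cball[of 0 R]]]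
    by (simp add: B_def vimage_def Int_def conj_commute)
  have AB: "1 - (\<epsilon> + \<beta>) \<le> prob (A j \<inter> B)" for j
  proof -
    have "prob (A j \<union> B) = prob (A j) + prob B - prob (A j \<inter> B)"
      using A(1) B by (intro measure_Un3) (auto simp: fmeasurable_eq_sets)
    then show ?thesis using A(2)[of j] R prob_le_1[of "A j \<union> B"] unfolding B_def by linarith
  qed
  have grid: "tame T (R + r') \<delta> (2 * r) (\<lambda>u. path (X \<omega>) (h j * of_int \<lfloor>u / h j\<rfloor>))" if "\<omega> \<in> A j \<inter> B" for j \<omega>
    using tame_grid_path[OF h(1)[of j] k(1)[of j], where x = "path (X \<omega>)" and R = R and r = r and r' = r'
      and xs = "xs j \<omega>" and m = "Suc j"] A(3)[of \<omega> j] that K(1) \<kappa>(1)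
    unfolding h(2) by (auto simp: bad_def B_def xs_def)
  have "1 - (\<epsilon> + \<beta>) \<le> prob (\<Inter>i. \<Union>j\<in>{i..}. A j \<inter> B)"
    using A(1) B AB by (intro prob_limsup_ge) auto
  also have "\<dots> \<le> prob {\<omega> \<in> space M. tame T (R + r') \<delta> (2 * r) (path (X \<omega>))}"
  proof (rule finite_measure_mono)
    show "{\<omega> \<in> space M. tame T (R + r') \<delta> (2 * r) (path (X \<omega>))} \<in> events"
      using measurable_sets[OF X borel_closed[OF closed_tame[of \<delta> T "R + r'" "2 * r"]]] T \<delta>
      by (simp add: vimage_def Int_def conj_commute)
    show "(\<Inter>i. \<Union>j\<in>{i..}. A j \<inter> B) \<subseteq> {\<omega> \<in> space M. tame T (R + r') \<delta> (2 * r) (path (X \<omega>))}"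
    proof
      fix \<omega> assume \<omega>: "\<omega> \<in> (\<Inter>i. \<Union>j\<in>{i..}. A j \<inter> B)"
      have "\<exists>\<^sub>F j in sequentially. \<omega> \<in> A j \<inter> B"
        using \<omega> by (fastforce simp: frequently_sequentially)
      then have "\<exists>\<^sub>F j in sequentially. tame T (R + r') \<delta> (2 * r) (\<lambda>u. path (X \<omega>) (h j * of_int \<lfloor>u / h j\<rfloor>))"
        by (rule frequently_elim1) (rule grid)
      moreover have "h \<longlonglongrightarrow> 0"
        using tendsto_mult_right_zero[OF LIMSEQ_inverse_real_of_nat, of \<delta>] by (simp add: h_def[abs_def] divide_inverse)
      ultimately have "tame T (R + r') \<delta> (2 * r) (path (X \<omega>))"
        using T \<delta> h(1) by (intro tame_if_frequently_grid_tame[OF cadlag_path]) auto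
      moreover have "\<omega> \<in> space M" using \<omega> by (auto simp: B_def)
      ultimately show "\<omega> \<in> {\<omega> \<in> space M. tame T (R + r') \<delta> (2 * r) (path (X \<omega>))}" by simp
    qed
  qed
  finally show ?thesis unfolding \<beta>_def by simp
qed

theorem theorem2p2:
  fixes C :: "nat \<Rightarrow> real ^ 'd \<Rightarrow> real ^ 'd \<Rightarrow> real"
    and M :: "nat \<Rightarrow> 'w measure"
    and X :: "nat \<Rightarrow> 'w \<Rightarrow> (real ^ 'd) skorokhod"
  assumes nonneg: "\<And>n a b. n \<ge> 1 \<Longrightarrow> a \<in> scaled_lattice n \<Longrightarrow> b \<in> scaled_lattice n \<Longrightarrow> C n a b \<ge> 0"
    and T1: "\<And>n a. n \<ge> 1 \<Longrightarrow> a \<in> scaled_lattice n \<Longrightarrow> C n a a = 0"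
    and T2: "\<And>n. n \<ge> 1 \<Longrightarrow>
      (SUP a\<in>scaled_lattice n. \<Sum>\<^sub>\<infinity>b\<in>scaled_lattice n. ennreal (C n a b)) < \<infinity>"
    and T3: "\<And>\<rho>::real. \<rho> > 0 \<Longrightarrow>
      limsup (\<lambda>n. SUP a\<in>scaled_lattice n.
        \<Sum>\<^sub>\<infinity>b\<in>{b\<in>scaled_lattice n. norm b > \<rho>}. ennreal (C n a (a + b))) < \<infinity>"
    and T4: "((\<lambda>r::real. limsup (\<lambda>n. SUP a\<in>scaled_lattice n.
        \<Sum>\<^sub>\<infinity>b\<in>{b\<in>scaled_lattice n. norm b > r}. ennreal (C n a (a + b)))) \<longlongrightarrow> 0) at_top"
    and T5: "\<exists>\<rho>>0. \<forall>i. limsup (\<lambda>n. SUP a\<in>scaled_lattice n.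
        ennreal \<bar>\<Sum>\<^sub>\<infinity>b\<in>{b\<in>scaled_lattice n. norm b < \<rho>}. b $ i * C n a (a + b)\<bar>) < \<infinity>"
    and T6: "\<exists>\<rho>>0. \<forall>i k. limsup (\<lambda>n. SUP a\<in>scaled_lattice n.
        ennreal \<bar>\<Sum>\<^sub>\<infinity>b\<in>{b\<in>scaled_lattice n. norm b < \<rho>}. b $ i * b $ k * C n a (a + b)\<bar>) < \<infinity>"
    and random_element: "\<And>n. n \<ge> 1 \<Longrightarrow> X n \<in> M n \<rightarrow>\<^sub>M borel"
    and chain: "\<And>n. n \<ge> 1 \<Longrightarrow>
      markov_chain (M n) (\<lambda>t \<omega>. path (X n \<omega>) t) (scaled_lattice n) (C n)"
    and initial: "tight_family {1..} (\<lambda>n. distr (M n) borel (\<lambda>\<omega>. path (X n \<omega>) 0))"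
  shows "tight_family {1..} (\<lambda>n. distr (M n) borel (X n))"
proof (rule tight_family_skorokhod)
  interpret lattice_rates C by unfold_locales (fact nonneg T2 T3 T4 T5 T6)+
  show "prob_space (M n)" if "n \<ge> 1" for n using chain[OF that] by (simp add: markov_chain_def)
  show "X n \<in> M n \<rightarrow>\<^sub>M borel" if "n \<ge> 1" for n using random_element that .
  fix T \<eta> \<epsilon> :: real assume T: "T \<ge> 0" and \<eta>: "\<eta> > 0" and \<epsilon>: "\<epsilon> > 0"
  \<comment> \<open>Half of \<eta>, since two points of a piece are only known to be within twice
    the radius of each other.\<close>
  obtain K N1 where K: "0 \<le> K" and N1: "1 \<le> N1" "\<And>n a c. n \<ge> N1 \<Longrightarrow> a \<in> scaled_lattice n \<Longrightarrow>
    rate_operator (scaled_lattice n) (C n) (test_fun (\<eta> / 2) c) a \<le> K"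
    using drift_bound[of "\<eta> / 2"] \<eta> by auto
  \<comment> \<open>A quarter of \<epsilon> for leaving the ball, spread over time
    \<open>T + 1\<close>, which exceeds \<open>T + \<delta>\<close> because of
    \<open>\<delta> \<le> 1\<close>.\<close>
  define \<kappa> where "\<kappa> = \<epsilon> / 4 / (T + 1)"
  have \<kappa>: "0 < \<kappa>" using T \<epsilon> by (simp add: \<kappa>_def)
  have \<kappa>T: "\<kappa> * (T + 1) = \<epsilon> / 4"
    by (rule nonzero_eq_divide_eq[THEN iffD1]) (use T in \<open>simp_all add: \<kappa>_def\<close>)
  obtain r N2 where r: "0 < r" and "1 \<le> N2" and N2: "\<And>n a c. n \<ge> N2 \<Longrightarrow> a \<in> scaled_lattice n \<Longrightarrow>
    rate_operator (scaled_lattice n) (C n) (test_fun r c) a \<le> \<kappa>"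
    by (rule drift_small[OF \<kappa>], rule that, assumption+)
  have "0 < \<epsilon> / 4" using \<epsilon> by simp
  from initial[unfolded tight_family_def, rule_format, OF this]
  obtain K0 where "compact K0 \<and> (\<forall>n\<in>{1..}. 1 - \<epsilon> / 4 \<le> measure (distr (M n) borel (\<lambda>\<omega>. path (X n \<omega>) 0)) K0)"
    by (elim exE)
  then have K0: "compact K0" "\<And>n. n \<ge> 1 \<Longrightarrow> 1 - \<epsilon> / 4 \<le> measure (distr (M n) borel (\<lambda>\<omega>. path (X n \<omega>) 0)) K0"
    by auto
  obtain R where R: "\<And>x. x \<in> K0 \<Longrightarrow> norm x \<le> R"
    using compact_imp_bounded[OF K0(1)] unfolding bounded_iff by blast
  define L where "L = 1 + K * (T + 1)"
  \<comment> \<open>The bounds serve, in this order, \<open>T + \<delta> \<le> T + 1\<close>, the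
    hypothesis \<open>K * \<delta> \<le> 1\<close>, and a quarter of \<epsilon> for short pieces.
    \<open>K + 1\<close> avoids dividing by zero.\<close>
  define \<delta> where "\<delta> = min 1 (min (1 / (K + 1)) (\<epsilon> / 4 / ((K + 1) * L)))"
  have L: "1 \<le> L" using K T by (simp add: L_def)
  have \<delta>: "0 < \<delta>" "\<delta> \<le> 1" using K L \<epsilon> by (auto simp: \<delta>_def)
  have "(K + 1) * \<delta> \<le> (K + 1) * (1 / (K + 1))" using K by (intro mult_left_mono) (auto simp: \<delta>_def)
  then have K\<delta>: "K * \<delta> \<le> 1" using K \<delta> by (simp add: algebra_simps)
  have "0 < (K + 1) * L" using K L by simp
  moreover have "\<delta> \<le> \<epsilon> / 4 / ((K + 1) * L)" by (simp add: \<delta>_def)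
  ultimately have "\<delta> * ((K + 1) * L) \<le> \<epsilon> / 4" by (simp only: pos_le_divide_eq)
  then have "(K + 1) * \<delta> * L \<le> \<epsilon> / 4" by (simp only: mult_ac)
  moreover have "K * \<delta> * L \<le> (K + 1) * \<delta> * L" using \<delta> L by (intro mult_right_mono) auto
  ultimately have K\<delta>L: "K * \<delta> * L \<le> \<epsilon> / 4" by linarith
  have "1 - \<epsilon> \<le> measure (M n) {\<omega>\<in>space (M n). tame T (R + r) \<delta> \<eta> (path (X n \<omega>))}"
    if n: "n \<ge> max 1 (max N1 N2)" for n
  proof -
    have n': "n \<ge> 1" "n \<ge> N1" "n \<ge> N2" using n by auto
    interpret prob_space "M n" using chain[OF n'(1)] by (simp add: markov_chain_def)
    have X0: "(\<lambda>\<omega>. path (X n \<omega>) 0) \<in> borel_measurable (M n)"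
      using chain[OF n'(1)] by (simp add: markov_chain_def)
    obtain \<Lambda> where \<Lambda>: "\<And>a. a \<in> scaled_lattice n \<Longrightarrow> C n a summable_on scaled_lattice n"
      "\<And>a. a \<in> scaled_lattice n \<Longrightarrow> infsum (C n a) (scaled_lattice n) \<le> \<Lambda>"
      using total_rate[OF n'(1)] by blast
    have "1 - \<epsilon> / 4 \<le> measure (distr (M n) borel (\<lambda>\<omega>. path (X n \<omega>) 0)) K0" using n'(1) by (rule K0(2))
    also have "\<dots> = prob ((\<lambda>\<omega>. path (X n \<omega>) 0) -` K0 \<inter> space (M n))"
      using X0 borel_compact[OF K0(1)] by (rule measure_distr)
    also have "\<dots> \<le> prob {\<omega> \<in> space (M n). norm (path (X n \<omega>) 0) \<le> R}"
    proof (rule finite_measure_mono)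
      show "{\<omega> \<in> space (M n). norm (path (X n \<omega>) 0) \<le> R} \<in> events"
        using measurable_sets[OF X0 borel_closed[OF closed_cball[of 0 R]]]
        by (simp add: vimage_def Int_def conj_commute)
    qed (use R in auto)
    finally have start: "1 - \<epsilon> / 4 \<le> prob {\<omega> \<in> space (M n). norm (path (X n \<omega>) 0) \<le> R}" .
    have "1 - (\<epsilon> / 4 + \<kappa> * (T + \<delta>) + K * \<delta> * (1 + K * (T + \<delta>))) \<le>
      prob {\<omega> \<in> space (M n). tame T (R + r) \<delta> (2 * (\<eta> / 2)) (path (X n \<omega>))}"
      using chain[OF n'(1)] random_element[OF n'(1)] countable_scaled_lattice
      by (rule markov_chain_tame)
        (use nonneg[OF n'(1)] T1[OF n'(1)] \<Lambda> \<eta> K N1(2)[OF n'(2)] r \<kappa> N2[OF n'(3)] start T \<delta> K\<delta> in auto)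
    moreover have "\<kappa> * (T + \<delta>) \<le> \<kappa> * (T + 1)" using \<kappa> \<delta> by (intro mult_left_mono) auto
    moreover have "K * \<delta> * (1 + K * (T + \<delta>)) \<le> K * \<delta> * L"
      unfolding L_def using K \<delta> by (intro mult_left_mono add_left_mono) auto
    ultimately show ?thesis using \<kappa>T K\<delta>L \<epsilon> by simp
  qed
  with \<delta>(1) show "\<exists>R \<delta> N. \<delta> > 0 \<and>
      (\<forall>n\<ge>max 1 N. 1 - \<epsilon> \<le> measure (M n) {\<omega>\<in>space (M n). tame T R \<delta> \<eta> (path (X n \<omega>))})" by blast
qed

end
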